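(* Let $d\ge 1$ and let $\mathcal H$ be a Hilbert space which is continuously embedded in $\mathscr S'(\mathbb R^d)$ and norm preserved under translations and modulations, i.e. for every $f\in\mathcal H$ and every $x,\xi\in\mathbb R^d$ the distributions $f(\cdot-x)$ and $e^{i\langle\cdot,\xi\rangle}f$ belong to $\mathcal H$ and $$\|f(\cdot-x)\|_{\mathcal H}=\|f\|_{\mathcal H},\qquad \|e^{i\langle\cdot,\xi\rangle}f\|_{\mathcal H}=\|f\|_{\mathcal H}.$$ If $\mathcal H\neq\{0\}$, then $\mathcal H=L^2(\mathbb R^d)$, and there is a constant $C>0$ such that $$\|f\|_{\mathcal H}=C\|f\|_{L^2(\mathbb R^d)},\qquad f\in\mathcal H=L^2(\mathbb R^d).$$
   Context: $\mathscr S'(\mathbb R^d)$ denotes the space of tempered distributions on $\mathbb R^d$, and $\langle\cdot,\cdot\rangle$ the standard inner product on $\mathbb R^d$. *)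

theory Defs
  imports "HOL-Analysis.Analysis"
begin

text \<open>Functions on R^d are modelled on an arbitrary Euclidean space 'a (dimension DIM('a) \<ge> 1).
  Partial derivatives along basis vectors; iterated partial derivatives indexed by lists of basis vectors.\<close>

definition dirderiv :: "'a::euclidean_space \<Rightarrow> ('a \<Rightarrow> complex) \<Rightarrow> 'a \<Rightarrow> complex" where
  "dirderiv b f x = vector_derivative (\<lambda>t::real. f (x + t *\<^sub>R b)) (at 0)"

fun pderivs :: "'a::euclidean_space list \<Rightarrow> ('a \<Rightarrow> complex) \<Rightarrow> 'a \<Rightarrow> complex" where
  "pderivs [] f = f"
| "pderivs (b # bs) f = dirderiv b (pderivs bs f)"

definition smooth_fun :: "('a::euclidean_space \<Rightarrow> complex) \<Rightarrow> bool" where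
  "smooth_fun f \<longleftrightarrow> (\<forall>bs \<in> lists Basis. continuous_on UNIV (pderivs bs f) \<and>
      (\<forall>b\<in>Basis. \<forall>x. (\<lambda>t::real. pderivs bs f (x + t *\<^sub>R b)) differentiable (at 0)))"

definition schwartz :: "('a::euclidean_space \<Rightarrow> complex) \<Rightarrow> bool" where
  "schwartz f \<longleftrightarrow> smooth_fun f \<and>
     (\<forall>k::nat. \<forall>bs \<in> lists Basis. bounded (range (\<lambda>x. (1 + norm x) ^ k * norm (pderivs bs f x))))"

definition schwartz_seminorm :: "nat \<Rightarrow> 'a::euclidean_space list \<Rightarrow> ('a \<Rightarrow> complex) \<Rightarrow> real" where
  "schwartz_seminorm k bs f = (SUP x. (1 + norm x) ^ k * norm (pderivs bs f x))"

text \<open>Tempered distributions: continuous linear functionals on the Schwartz space,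
  normalised to be 0 outside the Schwartz space (so HOL equality is equality of distributions).\<close>
definition tempered :: "(('a::euclidean_space \<Rightarrow> complex) \<Rightarrow> complex) \<Rightarrow> bool" where
  "tempered T \<longleftrightarrow>
     (\<forall>f g. schwartz f \<longrightarrow> schwartz g \<longrightarrow> T (\<lambda>x. f x + g x) = T f + T g) \<and>
     (\<forall>c f. schwartz f \<longrightarrow> T (\<lambda>x. c * f x) = c * T f) \<and>
     (\<forall>f. \<not> schwartz f \<longrightarrow> T f = 0) \<and>
     (\<exists>C M. \<forall>f. schwartz f \<longrightarrow>
        norm (T f) \<le> C * (\<Sum>k\<le>M. \<Sum>bs\<in>{bs. set bs \<subseteq> Basis \<and> length bs \<le> M}. schwartz_seminorm k bs f))"

definition dtranslate :: "'a::euclidean_space \<Rightarrow> (('a \<Rightarrow> complex) \<Rightarrow> complex) \<Rightarrow> (('a \<Rightarrow> complex) \<Rightarrow> complex)" where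
  "dtranslate x T = (\<lambda>\<phi>. T (\<lambda>y. \<phi> (y + x)))"

definition dmodulate :: "'a::euclidean_space \<Rightarrow> (('a \<Rightarrow> complex) \<Rightarrow> complex) \<Rightarrow> (('a \<Rightarrow> complex) \<Rightarrow> complex)" where
  "dmodulate \<xi> T = (\<lambda>\<phi>. T (\<lambda>y. exp (\<i> * complex_of_real (y \<bullet> \<xi>)) * \<phi> y))"

definition square_integrable :: "('a::euclidean_space \<Rightarrow> complex) \<Rightarrow> bool" where
  "square_integrable f \<longleftrightarrow> f \<in> borel_measurable lebesgue \<and> integrable lebesgue (\<lambda>x. (cmod (f x))\<^sup>2)"

definition L2_norm_fun :: "('a::euclidean_space \<Rightarrow> complex) \<Rightarrow> real" where
  "L2_norm_fun f = sqrt (LINT x|lebesgue. (cmod (f x))\<^sup>2)"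

definition dist_of :: "('a::euclidean_space \<Rightarrow> complex) \<Rightarrow> (('a \<Rightarrow> complex) \<Rightarrow> complex)" where
  "dist_of f = (\<lambda>\<phi>. if schwartz \<phi> then (LINT x|lebesgue. f x * \<phi> x) else 0)"

text \<open>A Hilbert space (V, N) of tempered distributions: a complex subspace V with a complete norm N
  satisfying the parallelogram law (hence induced by a complex inner product), such that the inclusion
  into S' is continuous (each evaluation T \<mapsto> T \<phi> is bounded).\<close>
definition hilbert_in_S' :: "(('a::euclidean_space \<Rightarrow> complex) \<Rightarrow> complex) set \<Rightarrow> ((('a \<Rightarrow> complex) \<Rightarrow> complex) \<Rightarrow> real) \<Rightarrow> bool" where
  "hilbert_in_S' V N \<longleftrightarrow>
     (\<forall>T\<in>V. tempered T) \<and>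
     (\<lambda>\<phi>. 0) \<in> V \<and>
     (\<forall>S\<in>V. \<forall>T\<in>V. (\<lambda>\<phi>. S \<phi> + T \<phi>) \<in> V) \<and>
     (\<forall>c. \<forall>T\<in>V. (\<lambda>\<phi>. c * T \<phi>) \<in> V) \<and>
     (\<forall>S\<in>V. \<forall>T\<in>V. N (\<lambda>\<phi>. S \<phi> + T \<phi>) \<le> N S + N T) \<and>
     (\<forall>c. \<forall>T\<in>V. N (\<lambda>\<phi>. c * T \<phi>) = cmod c * N T) \<and>
     (\<forall>T\<in>V. N T = 0 \<longrightarrow> T = (\<lambda>\<phi>. 0)) \<and>
     (\<forall>S\<in>V. \<forall>T\<in>V. (N (\<lambda>\<phi>. S \<phi> + T \<phi>))\<^sup>2 + (N (\<lambda>\<phi>. S \<phi> - T \<phi>))\<^sup>2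
                      = 2 * (N S)\<^sup>2 + 2 * (N T)\<^sup>2) \<and>
     (\<forall>u::nat \<Rightarrow> (('a \<Rightarrow> complex) \<Rightarrow> complex). (\<forall>n. u n \<in> V) \<longrightarrow>
        (\<forall>e>0. \<exists>M. \<forall>m\<ge>M. \<forall>n\<ge>M. N (\<lambda>\<phi>. u m \<phi> - u n \<phi>) < e) \<longrightarrow>
        (\<exists>T\<in>V. (\<lambda>n. N (\<lambda>\<phi>. u n \<phi> - T \<phi>)) \<longlonglongrightarrow> 0)) \<and>
     (\<forall>\<phi>. schwartz \<phi> \<longrightarrow> (\<exists>C. \<forall>T\<in>V. cmod (T \<phi>) \<le> C * N T))"

end

theory Submission
  imports
    Defs
    "HOL-Probability.Characteristic_Functions"
    "HOL-Probability.Sinc_Integral"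
    "HOL-Library.Function_Algebras"
begin

text \<open>
  By the parallelogram law and completeness, evaluation at a Schwartz function \<open>\<phi>\<close> is
  represented by a vector \<open>representer \<phi>\<close> of the Hilbert space, and \<open>representer \<psi> \<phi>\<close> is
  a positive hermitian form on the Schwartz space that is invariant under simultaneous translations
  and modulations of its arguments. Gaussians are superpositions of characters, so by modulation
  invariance a Gaussian factor can be moved from one argument to the other; hence on two Gaussians
  the form depends only on their product, and by translation invariance only on the width of that
  product. Evaluating the form on a convolution of two Gaussians in two ways determines the
  dependence on the width up to a factor. So on Gaussians the form is a multiple of the
  \<open>L\<^sup>2\<close> inner product. Two tempered distributions that agree on all Gaussians are equal (mollify
  the test function), which extends this to all Schwartz functions, and completeness of both spaces
  finishes the proof.
\<close>

section \<open>Hilbert spaces given by a norm on a carrier set\<close>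

lemma additive_bounded_on_unit_interval_eq_0:
  fixes g :: "real \<Rightarrow> real"
  assumes add: "\<And>s t. g (s + t) = g s + g t" and one: "g 1 = 0"
    and bound: "\<And>t. 0 \<le> t \<Longrightarrow> t \<le> 1 \<Longrightarrow> \<bar>g t\<bar> \<le> B"
  shows "g t = 0"
proof (rule ccontr)
  have zero: "g 0 = 0" using add[of 0 0] by simp
  have nat_mult: "g (real n * t) = real n * g t" for n t
    by (induction n) (simp_all add: zero add distrib_right)
  have int_zero: "g (of_int k) = 0" for k
    using nat_mult[of "nat k" 1] nat_mult[of "nat (- k)" 1] add[of "of_int k" "- of_int k"] zero one
    by (cases "k \<ge> 0") auto
  have bounded: "\<bar>g t\<bar> \<le> B" for t
  proof -
    have "g t = g (of_int \<lfloor>t\<rfloor>) + g (frac t)"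
      using add[of "of_int \<lfloor>t\<rfloor>" "frac t"] by (simp add: frac_def)
    then show ?thesis using bound[of "frac t"] frac_lt_1[of t] by (simp add: int_zero)
  qed
  assume "g t \<noteq> 0"
  then obtain n where "B < real n * \<bar>g t\<bar>" using reals_Archimedean3[of "\<bar>g t\<bar>"] by auto
  then show False using bounded[of "real n * t"] by (simp add: nat_mult abs_mult)
qed

lemma additive_bounded_imp_linear:
  fixes f :: "real \<Rightarrow> real"
  assumes add: "\<And>s t. f (s + t) = f s + f t" and bound: "\<And>t. \<bar>f t\<bar> \<le> C * \<bar>t\<bar>"
  shows "f t = t * f 1"
proof -
  have "f t - t * f 1 = 0"
  proof (rule additive_bounded_on_unit_interval_eq_0[where g="\<lambda>t. f t - t * f 1"])
    have "0 \<le> C" using bound[of 1] by simp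
    show "\<bar>f t - t * f 1\<bar> \<le> C + \<bar>f 1\<bar>" if t_unit: "0 \<le> t" "t \<le> 1" for t
    proof -
      have "\<bar>f t - t * f 1\<bar> \<le> C * t + t * \<bar>f 1\<bar>"
        using bound[of t] t_unit abs_triangle_ineq4[of "f t" "t * f 1"] by (simp add: abs_mult)
      also have "\<dots> \<le> C * 1 + 1 * \<bar>f 1\<bar>" using t_unit \<open>0 \<le> C\<close> by (intro add_mono mult_mono) auto
      finally show ?thesis by simp
    qed
  qed (simp_all add: add algebra_simps)
  then show ?thesis by simp
qed

lemma linear_plus_quadratic_nonneg_imp_0:
  fixes a c :: real
  assumes nonneg: "\<And>t. 0 \<le> t * a + t\<^sup>2 * c"
  shows "a = 0"
proof -
  define d where "d = \<bar>c\<bar> + 1"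
  have d_bounds: "d > 0" "c < d" by (auto simp: d_def)
  have "0 \<le> (- a / d) * a + (- a / d)\<^sup>2 * c" by (rule nonneg)
  also have "\<dots> = (a\<^sup>2 / d\<^sup>2) * (c - d)" using d_bounds by (simp add: power2_eq_square field_simps)
  finally have "a\<^sup>2 / d\<^sup>2 \<le> 0" using d_bounds by (simp only: zero_le_mult_iff) simp
  then show ?thesis using d_bounds by (simp add: divide_le_0_iff)
qed

locale hilbert_carrier = module scale
  for scale :: "complex \<Rightarrow> 'x::ab_group_add \<Rightarrow> 'x"  (infixr \<open>*\<^sub>C\<close> 75) +
  fixes V :: "'x set" and N :: "'x \<Rightarrow> real"
  assumes zero_V: "0 \<in> V"
    and add_V: "S \<in> V \<Longrightarrow> T \<in> V \<Longrightarrow> S + T \<in> V"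
    and scale_V: "T \<in> V \<Longrightarrow> c *\<^sub>C T \<in> V"
    and N_triangle: "S \<in> V \<Longrightarrow> T \<in> V \<Longrightarrow> N (S + T) \<le> N S + N T"
    and N_scale: "T \<in> V \<Longrightarrow> N (c *\<^sub>C T) = cmod c * N T"
    and N_eq_0: "T \<in> V \<Longrightarrow> N T = 0 \<Longrightarrow> T = 0"
    and parallelogram:
      "S \<in> V \<Longrightarrow> T \<in> V \<Longrightarrow> (N (S + T))\<^sup>2 + (N (S - T))\<^sup>2 = 2 * (N S)\<^sup>2 + 2 * (N T)\<^sup>2"
    and N_complete:
      "(\<And>n::nat. u n \<in> V) \<Longrightarrow> \<forall>e>0. \<exists>M. \<forall>m\<ge>M. \<forall>n\<ge>M. N (u m - u n) < e
        \<Longrightarrow> \<exists>T\<in>V. (\<lambda>n. N (u n - T)) \<longlonglongrightarrow> 0"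
begin

lemma minus_one_scale: "(-1) *\<^sub>C T = - T"
  by (simp add: scale_minus_left)

lemma uminus_V: "T \<in> V \<Longrightarrow> - T \<in> V"
  using scale_V[of T "-1"] by (simp add: minus_one_scale)

lemma diff_V: "S \<in> V \<Longrightarrow> T \<in> V \<Longrightarrow> S - T \<in> V"
  using add_V[of S "-T"] uminus_V by simp

lemma N_zero: "N 0 = 0"
  using N_scale[OF zero_V, of 0] by simp

lemma N_minus: "T \<in> V \<Longrightarrow> N (- T) = N T"
  using N_scale[of T "-1"] by (simp add: minus_one_scale)

lemma N_nonneg: assumes "T \<in> V" shows "0 \<le> N T"
  using N_triangle[OF assms uminus_V[OF assms]] N_minus[OF assms] N_zero by simp

lemma N_diff_commute: "S \<in> V \<Longrightarrow> T \<in> V \<Longrightarrow> N (S - T) = N (T - S)"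
  using N_minus[OF diff_V, of S T] by simp

lemma abs_N_diff_le:
  assumes "S \<in> V" "T \<in> V"
  shows "\<bar>N S - N T\<bar> \<le> N (S - T)"
  using N_triangle[OF diff_V[OF assms] assms(2)] N_triangle[OF diff_V[OF assms(2,1)] assms(1)]
    N_diff_commute[OF assms] by simp

lemma N_tendsto:
  assumes u_in_V: "\<And>n. u n \<in> V" and S_in_V: "S \<in> V" and lim: "(\<lambda>n. N (u n - S)) \<longlonglongrightarrow> 0"
  shows "(\<lambda>n. N (u n)) \<longlonglongrightarrow> N S"
proof -
  have "(\<lambda>n. N (u n) - N S) \<longlonglongrightarrow> 0"
    by (rule Lim_null_comparison[OF _ lim]) (simp add: abs_N_diff_le u_in_V S_in_V)
  then show ?thesis by (rule LIM_zero_cancel)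
qed

lemma N_Cauchy_of_tendsto:
  assumes u_in_V: "\<And>n. u n \<in> V" and S_in_V: "S \<in> V" and lim: "(\<lambda>n. N (u n - S)) \<longlonglongrightarrow> 0" and "e > 0"
  shows "\<exists>M. \<forall>m\<ge>M. \<forall>n\<ge>M. N (u m - u n) < e"
proof -
  obtain M where M_bound: "\<And>n. n \<ge> M \<Longrightarrow> N (u n - S) < e / 2"
    using LIMSEQ_D[OF lim, of "e / 2"] \<open>e > 0\<close>
    by (metis abs_less_iff diff_zero half_gt_zero real_norm_def)
  have "N (u m - u n) < e" if "m \<ge> M" "n \<ge> M" for m n
    using N_triangle[OF diff_V[OF u_in_V S_in_V] diff_V[OF S_in_V u_in_V], of m n]
      M_bound[OF that(1)] M_bound[OF that(2)] N_diff_commute[OF S_in_V u_in_V, of n]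
    by simp
  then show ?thesis by blast
qed

definition re_inner :: "'x \<Rightarrow> 'x \<Rightarrow> real" where
  "re_inner S T = ((N (S + T))\<^sup>2 - (N (S - T))\<^sup>2) / 4"

lemma re_inner_commute: "S \<in> V \<Longrightarrow> T \<in> V \<Longrightarrow> re_inner S T = re_inner T S"
  by (simp add: re_inner_def add.commute N_diff_commute)

lemma re_inner_self: "T \<in> V \<Longrightarrow> re_inner T T = (N T)\<^sup>2"
  using N_scale[of T 2] scale_left_distrib[of 1 1 T]
  by (simp add: re_inner_def N_zero power2_eq_square)

lemma re_inner_zero_left: "T \<in> V \<Longrightarrow> re_inner 0 T = 0"
  by (simp add: re_inner_def N_minus)

lemma re_inner_add_left:
  assumes S_in_V: "S \<in> V" and S'_in_V: "S' \<in> V" and T_in_V: "T \<in> V"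
  shows "re_inner (S + S') T = re_inner S T + re_inner S' T"
proof -
  have add_halves: "re_inner X T + re_inner Y T = re_inner (X + Y) (T + T) / 2"
    if X_in_V: "X \<in> V" and Y_in_V: "Y \<in> V" for X Y
  proof -
    have "(N (X + T))\<^sup>2 + (N (Y + T))\<^sup>2 = ((N (X + Y + (T + T)))\<^sup>2 + (N (X - Y))\<^sup>2) / 2"
      using parallelogram[of "X + T" "Y + T"] X_in_V Y_in_V T_in_V
      by (simp add: add_V algebra_simps)
    moreover have "(N (X - T))\<^sup>2 + (N (Y - T))\<^sup>2 = ((N (X + Y - (T + T)))\<^sup>2 + (N (X - Y))\<^sup>2) / 2"
      using parallelogram[of "X - T" "Y - T"] X_in_V Y_in_V T_in_V
      by (simp add: diff_V algebra_simps)
    ultimately show ?thesis unfolding re_inner_def by (simp add: field_simps)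
  qed
  have "re_inner (S + S') T = re_inner (S + S') (T + T) / 2"
    using add_halves[of "S + S'" 0] S_in_V S'_in_V T_in_V
    by (simp add: zero_V add_V re_inner_zero_left)
  then show ?thesis using add_halves[OF S_in_V S'_in_V] by simp
qed

lemma re_inner_add_right:
  "S \<in> V \<Longrightarrow> T \<in> V \<Longrightarrow> T' \<in> V \<Longrightarrow> re_inner S (T + T') = re_inner S T + re_inner S T'"
  using re_inner_add_left[of T T' S] re_inner_commute add_V by simp

lemma re_inner_diff_left:
  "S \<in> V \<Longrightarrow> S' \<in> V \<Longrightarrow> T \<in> V \<Longrightarrow> re_inner (S - S') T = re_inner S T - re_inner S' T"
  using re_inner_add_left[of "S - S'" S' T] by (simp add: diff_V)

lemma re_inner_bound:
  assumes S_in_V: "S \<in> V" and T_in_V: "T \<in> V"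
  shows "\<bar>re_inner S T\<bar> \<le> N S * N T"
proof -
  have upper: "re_inner S X \<le> N S * N X" if X_in_V: "X \<in> V" for X
  proof -
    have "(N (S + X))\<^sup>2 \<le> (N S + N X)\<^sup>2" by (intro power_mono N_triangle N_nonneg add_V S_in_V X_in_V)
    moreover have "(N S - N X)\<^sup>2 \<le> (N (S - X))\<^sup>2"
      using abs_N_diff_le[OF S_in_V X_in_V]
      by (metis abs_le_square_iff abs_of_nonneg N_nonneg diff_V S_in_V X_in_V)
    ultimately show ?thesis unfolding re_inner_def by (simp add: power2_eq_square algebra_simps)
  qed
  have "re_inner S (- T) = - re_inner S T" by (simp add: re_inner_def field_simps)
  then show ?thesis
    using upper[OF T_in_V] upper[OF uminus_V[OF T_in_V]] by (simp add: N_minus T_in_V)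
qed

lemma re_inner_scale_real_left:
  assumes S_in_V: "S \<in> V" and T_in_V: "T \<in> V"
  shows "re_inner (of_real t *\<^sub>C S) T = t * re_inner S T"
proof -
  have "re_inner (of_real t *\<^sub>C S) T = t * re_inner (of_real 1 *\<^sub>C S) T"
  proof (rule additive_bounded_imp_linear[where f="\<lambda>t. re_inner (of_real t *\<^sub>C S) T"])
    show "re_inner (of_real (s + t) *\<^sub>C S) T
        = re_inner (of_real s *\<^sub>C S) T + re_inner (of_real t *\<^sub>C S) T" for s t
      by (simp add: scale_left_distrib re_inner_add_left scale_V S_in_V T_in_V)
    show "\<bar>re_inner (of_real t *\<^sub>C S) T\<bar> \<le> (N S * N T) * \<bar>t\<bar>" for t
      using re_inner_bound[OF scale_V[OF S_in_V] T_in_V, of "of_real t"]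
      by (simp add: N_scale S_in_V mult_ac)
  qed
  then show ?thesis by simp
qed

lemma re_inner_scale_ii_left:
  assumes S_in_V: "S \<in> V" and T_in_V: "T \<in> V"
  shows "re_inner (\<i> *\<^sub>C S) T = - re_inner S (\<i> *\<^sub>C T)"
proof -
  have "\<i> *\<^sub>C S + T = \<i> *\<^sub>C (S - \<i> *\<^sub>C T)" "\<i> *\<^sub>C S - T = \<i> *\<^sub>C (S + \<i> *\<^sub>C T)"
    by (simp_all add: scale_right_distrib scale_right_diff_distrib scale_minus_left)
  moreover have "N (\<i> *\<^sub>C X) = N X" if "X \<in> V" for X using N_scale[OF that] by simp
  ultimately show ?thesis
    unfolding re_inner_def using S_in_V T_in_V
    by (simp add: add_V diff_V scale_V diff_divide_distrib)
qed

lemma N_add_scale_real_squared: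
  assumes S_in_V: "S \<in> V" and T_in_V: "T \<in> V"
  shows "(N (S + of_real t *\<^sub>C T))\<^sup>2 = (N S)\<^sup>2 + 2 * t * re_inner S T + t\<^sup>2 * (N T)\<^sup>2"
proof -
  let ?X = "of_real t *\<^sub>C T"
  have X_in_V: "?X \<in> V" using T_in_V by (rule scale_V)
  have cross: "re_inner ?X S = t * re_inner S T" "re_inner S ?X = t * re_inner S T"
    using re_inner_scale_real_left[OF T_in_V S_in_V, of t] re_inner_commute[OF S_in_V T_in_V]
      re_inner_commute[OF S_in_V X_in_V] by simp_all
  have "(N (S + ?X))\<^sup>2 = re_inner (S + ?X) (S + ?X)" by (simp add: re_inner_self add_V S_in_V X_in_V)
  also have "\<dots> = (re_inner S S + re_inner S ?X) + (re_inner ?X S + re_inner ?X ?X)"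
    by (simp only: re_inner_add_left[OF S_in_V X_in_V add_V[OF S_in_V X_in_V]]
      re_inner_add_right S_in_V X_in_V)
  also have "\<dots> = (N S)\<^sup>2 + 2 * t * re_inner S T + t\<^sup>2 * (N T)\<^sup>2"
    by (simp add: cross re_inner_self S_in_V X_in_V N_scale T_in_V power_mult_distrib)
  finally show ?thesis .
qed

lemma re_inner_tendsto:
  assumes u_in_V: "\<And>n. u n \<in> V" and S_in_V: "S \<in> V" and T_in_V: "T \<in> V"
    and lim: "(\<lambda>n. N (u n - S)) \<longlonglongrightarrow> 0"
  shows "(\<lambda>n. re_inner (u n) T) \<longlonglongrightarrow> re_inner S T"
proof -
  have "(\<lambda>n. re_inner (u n) T - re_inner S T) \<longlonglongrightarrow> 0"
  proof (rule Lim_null_comparison)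
    show "\<forall>\<^sub>F n in sequentially. norm (re_inner (u n) T - re_inner S T) \<le> N (u n - S) * N T"
      using re_inner_bound[OF diff_V[OF u_in_V S_in_V] T_in_V]
      by (simp add: re_inner_diff_left u_in_V S_in_V T_in_V)
    show "(\<lambda>n. N (u n - S) * N T) \<longlonglongrightarrow> 0" using tendsto_mult_left_zero[OF lim] by simp
  qed
  then show ?thesis by (rule LIM_zero_cancel)
qed

lemma re_inner_right_eq_imp_eq:
  assumes S_in_V: "S \<in> V" and T_in_V: "T \<in> V"
    and inner_eq: "\<And>X. X \<in> V \<Longrightarrow> re_inner X S = re_inner X T"
  shows "S = T"
proof -
  note diff_in_V = diff_V[OF S_in_V T_in_V]
  have "(N (S - T))\<^sup>2 = re_inner S (S - T) - re_inner T (S - T)"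
    by (simp only: re_inner_self[OF diff_in_V, symmetric]
      re_inner_diff_left[OF S_in_V T_in_V diff_in_V])
  also have "\<dots> = 0"
    using inner_eq[OF diff_in_V] re_inner_commute[OF S_in_V diff_in_V]
      re_inner_commute[OF T_in_V diff_in_V] by simp
  finally show ?thesis using N_eq_0[OF diff_in_V] by simp
qed

end

text \<open>Describing the functional by its graph spares proving that it is well defined.\<close>

locale bounded_functional_graph = hilbert_carrier scale V N
  for scale :: "complex \<Rightarrow> 'x::ab_group_add \<Rightarrow> 'x"  (infixr \<open>*\<^sub>C\<close> 75)
    and V :: "'x set" and N :: "'x \<Rightarrow> real" +
  fixes G :: "('x \<times> real) set" and M :: real
  assumes graph_nonempty: "G \<noteq> {}"
    and graph_V: "(P, a) \<in> G \<Longrightarrow> P \<in> V"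
    and graph_add: "(P, a) \<in> G \<Longrightarrow> (Q, b) \<in> G \<Longrightarrow> (P + Q, a + b) \<in> G"
    and graph_scale: "(P, a) \<in> G \<Longrightarrow> (of_real t *\<^sub>C P, t * a) \<in> G"
    and graph_bound: "(P, a) \<in> G \<Longrightarrow> a \<le> M * N P"
begin

definition energy :: "'x \<times> real \<Rightarrow> real" where
  "energy p = (N (fst p))\<^sup>2 - 2 * snd p"

lemma energy_lower_bound:
  assumes "p \<in> G"
  shows "- M\<^sup>2 \<le> energy p"
proof -
  have "0 \<le> (N (fst p) - M)\<^sup>2" by simp
  then show ?thesis using graph_bound[of "fst p" "snd p"] assms
    unfolding energy_def by (simp add: power2_eq_square algebra_simps)
qed

definition min_energy :: real where
  "min_energy = (INF p\<in>G. energy p)"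

lemma bdd_below_energy: "bdd_below (energy ` G)"
  by (rule bdd_belowI[of _ "- M\<^sup>2"]) (use energy_lower_bound in auto)

lemma min_energy_le: "p \<in> G \<Longrightarrow> min_energy \<le> energy p"
  unfolding min_energy_def by (rule cINF_lower[OF bdd_below_energy])

lemma minimizing_sequence_exists:
  obtains u :: "nat \<Rightarrow> 'x \<times> real" where "\<And>n. u n \<in> G"
    "\<And>n. energy (u n) < min_energy + inverse (Suc n)"
proof -
  have "\<exists>p\<in>G. energy p < min_energy + inverse (Suc n)" for n
    using cINF_less_iff[OF graph_nonempty bdd_below_energy, of "min_energy + inverse (Suc n)"]
    by (simp add: min_energy_def)
  then show ?thesis using that by metis
qed

lemma N_diff_le_energy_excess:
  assumes p_in_G: "p \<in> G" and q_in_G: "q \<in> G"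
  shows "(N (fst p - fst q))\<^sup>2 \<le> 2 * (energy p - min_energy) + 2 * (energy q - min_energy)"
proof -
  obtain P a Q b where pq: "p = (P, a)" "q = (Q, b)" by (metis surj_pair)
  note P_in_V = graph_V[OF p_in_G[unfolded pq]] and Q_in_V = graph_V[OF q_in_G[unfolded pq]]
  let ?mid = "(of_real (1 / 2) *\<^sub>C (P + Q), 1 / 2 * (a + b))"
  have "N (of_real (1 / 2) *\<^sub>C (P + Q)) = N (P + Q) / 2"
    by (simp only: N_scale[OF add_V[OF P_in_V Q_in_V]]) simp
  then have mid_energy: "4 * energy ?mid = (N (P + Q))\<^sup>2 - 4 * (a + b)"
    by (simp only: energy_def fst_conv snd_conv) (simp add: power_divide field_simps)
  have "?mid \<in> G" using p_in_G q_in_G unfolding pq by (intro graph_scale graph_add)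
  then have "4 * min_energy \<le> (N (P + Q))\<^sup>2 - 4 * (a + b)"
    unfolding mid_energy[symmetric] using min_energy_le by simp
  then show ?thesis using parallelogram[OF P_in_V Q_in_V] by (simp add: pq energy_def)
qed

lemma minimizing_sequence_Cauchy:
  assumes u_in_G: "\<And>n. u n \<in> G" and u_minimizing: "\<And>n. energy (u n) < min_energy + inverse (Suc n)"
    and "e > 0"
  shows "\<exists>K. \<forall>m\<ge>K. \<forall>n\<ge>K. N (fst (u m) - fst (u n)) < e"
proof -
  obtain K where K_bound: "inverse (real (Suc K)) < e\<^sup>2 / 4"
    using reals_Archimedean[of "e\<^sup>2 / 4"] \<open>e > 0\<close> by auto
  have "N (fst (u m) - fst (u n)) < e" if "m \<ge> K" "n \<ge> K" for m n
  proof -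
    have "energy (u k) - min_energy < e\<^sup>2 / 4" if "k \<ge> K" for k
    proof -
      have "inverse (real (Suc k)) \<le> inverse (real (Suc K))" using that by simp
      then show ?thesis using u_minimizing[of k] K_bound by linarith
    qed
    from this[OF that(1)] this[OF that(2)] have "(N (fst (u m) - fst (u n)))\<^sup>2 < e\<^sup>2"
      using N_diff_le_energy_excess[OF u_in_G u_in_G, of m n] by simp
    then show ?thesis by (rule power2_less_imp_less) (use \<open>e > 0\<close> in simp)
  qed
  then show ?thesis by blast
qed

lemma minimizing_limit_represents:
  assumes u_in_G: "\<And>n. u n \<in> G" and u_minimizing: "\<And>n. energy (u n) < min_energy + inverse (Suc n)"
    and S_in_V: "S \<in> V" and lim: "(\<lambda>n. N (fst (u n) - S)) \<longlonglongrightarrow> 0" and Pa_in_G: "(P, a) \<in> G"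
  shows "re_inner S P = a"
proof -
  note P_in_V = graph_V[OF Pa_in_G]
  have u_in_V: "fst (u n) \<in> V" for n using graph_V[of "fst (u n)" "snd (u n)"] u_in_G by simp
  have "0 \<le> t * (2 * (re_inner S P - a)) + t\<^sup>2 * (N P)\<^sup>2" for t
  proof -
    have "- inverse (real (Suc n)) \<le> t * (2 * (re_inner (fst (u n)) P - a)) + t\<^sup>2 * (N P)\<^sup>2" for n
    proof -
      have "(fst (u n) + of_real t *\<^sub>C P, snd (u n) + t * a) \<in> G"
        using u_in_G by (intro graph_add graph_scale Pa_in_G) simp
      then have "min_energy \<le> energy (fst (u n) + of_real t *\<^sub>C P, snd (u n) + t * a)"
        by (rule min_energy_le)
      then show ?thesis using u_minimizing[of n] N_add_scale_real_squared[OF u_in_V P_in_V, of n t]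
        by (simp add: energy_def algebra_simps)
    qed
    moreover have "(\<lambda>n. - inverse (real (Suc n))) \<longlonglongrightarrow> - 0"
      by (intro tendsto_minus LIMSEQ_inverse_real_of_nat)
    moreover have "(\<lambda>n. t * (2 * (re_inner (fst (u n)) P - a)) + t\<^sup>2 * (N P)\<^sup>2)
        \<longlonglongrightarrow> t * (2 * (re_inner S P - a)) + t\<^sup>2 * (N P)\<^sup>2"
      by (intro tendsto_intros re_inner_tendsto u_in_V S_in_V P_in_V lim)
    ultimately show ?thesis using LIMSEQ_le[of "\<lambda>n. - inverse (real (Suc n))" "- 0"] by auto
  qed
  from linear_plus_quadratic_nonneg_imp_0[OF this] show ?thesis by simp
qed

lemma riesz_representation:
  obtains S u where "S \<in> V" "\<And>n::nat. u n \<in> fst ` G" "(\<lambda>n. N (u n - S)) \<longlonglongrightarrow> 0"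
    "\<And>P a. (P, a) \<in> G \<Longrightarrow> re_inner S P = a"
proof -
  obtain u :: "nat \<Rightarrow> 'x \<times> real" where u_in_G: "\<And>n. u n \<in> G"
    and u_minimizing: "\<And>n. energy (u n) < min_energy + inverse (Suc n)"
    using minimizing_sequence_exists by blast
  have "fst (u n) \<in> V" for n using graph_V[of "fst (u n)" "snd (u n)"] u_in_G by simp
  then obtain S where "S \<in> V" "(\<lambda>n. N (fst (u n) - S)) \<longlonglongrightarrow> 0"
    using N_complete[of "\<lambda>n. fst (u n)"] minimizing_sequence_Cauchy[OF u_in_G u_minimizing] by blast
  with minimizing_limit_represents[OF u_in_G u_minimizing] u_in_G show ?thesis
    by (intro that[of S "\<lambda>n. fst (u n)"]) auto
qed

end

section \<open>Schwartz functions\<close>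

abbreviation weight :: "'a::real_normed_vector \<Rightarrow> real" where
  "weight x \<equiv> 1 + norm x"

lemma weight_power_pos: "0 < weight x ^ k"
  by (intro zero_less_power) (simp add: add_pos_nonneg)

lemma weight_power_mult_le_iff: "weight x ^ k * a \<le> C \<longleftrightarrow> a \<le> C * inverse (weight x ^ k)"
  using weight_power_pos[of x k]
  by (simp add: divide_inverse[symmetric] pos_le_divide_eq mult.commute)

lemma norm_le_of_weighted_le:
  assumes "weight x ^ k * norm a \<le> C" shows "norm a \<le> C"
proof -
  have "1 * norm a \<le> weight x ^ k * norm a" by (intro mult_right_mono one_le_power) auto
  with assms show ?thesis by simp
qed

lemma weight_add_power_le: "weight (x + y) ^ k \<le> weight x ^ k * weight y ^ k"
proof -
  have "norm (x + y) \<le> norm x + norm y + norm x * norm y"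
    using norm_triangle_ineq[of x y] by (rule order_trans) simp
  then have "weight (x + y) \<le> weight x * weight y" by (simp add: algebra_simps)
  then show ?thesis unfolding power_mult_distrib[symmetric] by (intro power_mono) auto
qed

lemma weighted_translate_le:
  assumes "weight (y - x) ^ k * a \<le> C" and "0 \<le> a"
  shows "weight y ^ k * a \<le> weight x ^ k * C"
proof -
  have "weight y ^ k * a \<le> (weight (y - x) ^ k * weight x ^ k) * a"
    using weight_add_power_le[of "y - x" x k] \<open>0 \<le> a\<close> by (intro mult_right_mono) simp_all
  also have "\<dots> = weight x ^ k * (weight (y - x) ^ k * a)" by simp
  also have "\<dots> \<le> weight x ^ k * C" by (intro mult_left_mono assms) simp
  finally show ?thesis .
qed

definition rapidly_decreasing :: "('a::real_normed_vector \<Rightarrow> 'b::real_normed_vector) \<Rightarrow> bool" where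
  "rapidly_decreasing f \<longleftrightarrow> (\<forall>k. \<exists>C. \<forall>x. weight x ^ k * norm (f x) \<le> C)"

lemma rapidly_decreasingE:
  assumes "rapidly_decreasing f"
  obtains C where "0 \<le> C" "\<And>x. weight x ^ k * norm (f x) \<le> C"
proof -
  obtain C where C_bound: "\<And>x. weight x ^ k * norm (f x) \<le> C"
    using assms unfolding rapidly_decreasing_def by blast
  moreover have "0 \<le> C" using norm_ge_zero norm_le_of_weighted_le[OF C_bound] by (rule order_trans)
  ultimately show ?thesis using that by blast
qed

lemma rapidly_decreasing_dominated:
  assumes "rapidly_decreasing f" and dominated: "\<And>x. norm (g x) \<le> norm (f x)"
  shows "rapidly_decreasing g"
  unfolding rapidly_decreasing_def
proof
  fix k
  obtain C where C_bound: "\<And>x. weight x ^ k * norm (f x) \<le> C"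
    using assms(1) by (metis rapidly_decreasingE)
  have "weight x ^ k * norm (g x) \<le> C" for x
    by (rule order_trans[OF mult_left_mono[OF dominated] C_bound]) simp
  then show "\<exists>C. \<forall>x. weight x ^ k * norm (g x) \<le> C" by blast
qed

lemma rapidly_decreasing_add:
  assumes "rapidly_decreasing f" "rapidly_decreasing g"
  shows "rapidly_decreasing (\<lambda>x. f x + g x)"
  unfolding rapidly_decreasing_def
proof
  fix k
  obtain C D where "\<And>x. weight x ^ k * norm (f x) \<le> C" "\<And>x. weight x ^ k * norm (g x) \<le> D"
    using assms by (metis rapidly_decreasingE)
  moreover have "weight x ^ k * norm (f x + g x)
      \<le> weight x ^ k * norm (f x) + weight x ^ k * norm (g x)" for x
    unfolding distrib_left[symmetric] by (intro mult_left_mono norm_triangle_ineq) auto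
  ultimately have "weight x ^ k * norm (f x + g x) \<le> C + D" for x by (meson add_mono order_trans)
  then show "\<exists>C. \<forall>x. weight x ^ k * norm (f x + g x) \<le> C" by blast
qed

lemma rapidly_decreasing_cmult:
  fixes c :: "'b::real_normed_div_algebra"
  assumes "rapidly_decreasing f"
  shows "rapidly_decreasing (\<lambda>x. c * f x)"
  unfolding rapidly_decreasing_def
proof
  fix k
  obtain C where C_bound: "\<And>x. weight x ^ k * norm (f x) \<le> C"
    using assms by (metis rapidly_decreasingE)
  have "weight x ^ k * norm (c * f x) \<le> norm c * C" for x
    using mult_left_mono[OF C_bound[of x], of "norm c"] by (simp add: norm_mult mult_ac)
  then show "\<exists>C. \<forall>x. weight x ^ k * norm (c * f x) \<le> C" by blast
qed

lemma rapidly_decreasing_translate: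
  assumes "rapidly_decreasing f"
  shows "rapidly_decreasing (\<lambda>y. f (y + x))"
  unfolding rapidly_decreasing_def
proof
  fix k
  obtain C where "\<And>y. weight y ^ k * norm (f y) \<le> C" using assms by (metis rapidly_decreasingE)
  then have "weight y ^ k * norm (f (y + x)) \<le> weight (- x) ^ k * C" for y
    by (intro weighted_translate_le) simp_all
  then show "\<exists>C. \<forall>y. weight y ^ k * norm (f (y + x)) \<le> C" by blast
qed

definition has_dirderiv ::
  "'a::real_normed_vector \<Rightarrow> ('a \<Rightarrow> 'b::real_normed_vector) \<Rightarrow> ('a \<Rightarrow> 'b) \<Rightarrow> bool" where
  "has_dirderiv b f f' \<longleftrightarrow> (\<forall>x. ((\<lambda>t::real. f (x + t *\<^sub>R b)) has_vector_derivative f' x) (at 0))"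

lemma has_dirderiv_imp_dirderiv_eq: "has_dirderiv b f f' \<Longrightarrow> dirderiv b f = f'"
  unfolding has_dirderiv_def dirderiv_def by (auto intro!: vector_derivative_at)

lemma has_dirderiv_add:
  "has_dirderiv b f f' \<Longrightarrow> has_dirderiv b g g' \<Longrightarrow> has_dirderiv b (\<lambda>x. f x + g x) (\<lambda>x. f' x + g' x)"
  unfolding has_dirderiv_def by (auto intro: has_vector_derivative_add)

lemma has_dirderiv_cmult:
  fixes c :: "'b::real_normed_algebra"
  shows "has_dirderiv b f f' \<Longrightarrow> has_dirderiv b (\<lambda>x. c * f x) (\<lambda>x. c * f' x)"
  unfolding has_dirderiv_def by (auto intro: has_vector_derivative_mult_right)

lemma has_dirderiv_mult:
  fixes f g :: "'a::real_normed_vector \<Rightarrow> 'b::real_normed_algebra"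
  shows "has_dirderiv b f f' \<Longrightarrow> has_dirderiv b g g' \<Longrightarrow>
    has_dirderiv b (\<lambda>x. f x * g x) (\<lambda>x. f x * g' x + f' x * g x)"
  unfolding has_dirderiv_def
  by (auto intro!: has_vector_derivative_eq_rhs[OF has_vector_derivative_mult])

lemma has_dirderiv_of_real:
  fixes f :: "'a::real_normed_vector \<Rightarrow> real"
  shows "has_dirderiv b f f' \<Longrightarrow>
    has_dirderiv b (\<lambda>x. of_real (f x) :: 'b::real_normed_algebra_1) (\<lambda>x. of_real (f' x))"
  unfolding has_dirderiv_def has_real_derivative_iff_has_vector_derivative[symmetric]
  by (auto intro: has_vector_derivative_of_real)

lemma has_dirderiv_translate:
  assumes "has_dirderiv b f f'"
  shows "has_dirderiv b (\<lambda>y. f (y + x)) (\<lambda>y. f' (y + x))"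
proof -
  have "((\<lambda>t. f (y + x + t *\<^sub>R b)) has_vector_derivative f' (y + x)) (at 0)" for y
    using assms unfolding has_dirderiv_def by blast
  then show ?thesis unfolding has_dirderiv_def by (simp add: add_ac)
qed

lemma has_dirderiv_at:
  assumes "has_dirderiv b f f'"
  shows "((\<lambda>t. f (x + t *\<^sub>R b)) has_vector_derivative f' (x + s *\<^sub>R b)) (at s)"
proof -
  let ?g = "\<lambda>t. f ((x + s *\<^sub>R b) + t *\<^sub>R b)"
  have "(?g has_vector_derivative f' (x + s *\<^sub>R b)) (at (- s + s))"
    using assms unfolding has_dirderiv_def by simp
  then have "((?g \<circ> (\<lambda>t. t - s)) has_vector_derivative 1 *\<^sub>R f' (x + s *\<^sub>R b)) (at s)"
    by (intro vector_diff_chain_at) (auto intro!: derivative_eq_intros)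
  moreover have "?g \<circ> (\<lambda>t. t - s) = (\<lambda>t. f (x + t *\<^sub>R b))"
    by (simp add: fun_eq_iff scaleR_left_diff_distrib)
  ultimately show ?thesis by simp
qed

lemma has_dirderiv_increment_bound:
  assumes f_dirderiv: "has_dirderiv b f f'" and bound: "\<And>t. \<bar>t\<bar> \<le> \<bar>r\<bar> \<Longrightarrow> norm (f' (x + t *\<^sub>R b)) \<le> B"
  shows "norm (f (x + r *\<^sub>R b) - f x) \<le> B * \<bar>r\<bar>"
proof -
  let ?g = "\<lambda>t. f (x + t *\<^sub>R b)"
  have "norm (?g r - ?g 0) \<le> B * norm (r - 0)"
  proof (rule differentiable_bound[of "cball 0 \<bar>r\<bar>"])
    show "(?g has_derivative (\<lambda>h. h *\<^sub>R f' (x + t *\<^sub>R b))) (at t within cball 0 \<bar>r\<bar>)" for t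
      using has_vector_derivative_at_within[OF has_dirderiv_at[OF f_dirderiv]]
      unfolding has_vector_derivative_def .
    show "onorm (\<lambda>h. h *\<^sub>R f' (x + t *\<^sub>R b)) \<le> B" if "t \<in> cball 0 \<bar>r\<bar>" for t
      using bound[of t] that by (simp add: onorm_scaleR_left onorm_id[where 'a=real])
  qed auto
  then show ?thesis by simp
qed

lemma has_vector_derivative_iff_quotient:
  fixes f :: "real \<Rightarrow> 'b::real_normed_vector"
  shows "(f has_vector_derivative D) (at 0) \<longleftrightarrow> ((\<lambda>t. (f t - f 0) /\<^sub>R t) \<longlongrightarrow> D) (at 0)"
proof -
  have quotient_eq: "norm (f t - f 0 - t *\<^sub>R D) / \<bar>t\<bar> = norm ((f t - f 0) /\<^sub>R t - D)" if "t \<noteq> 0" for t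
  proof -
    have "(f t - f 0) /\<^sub>R t - D = (f t - f 0 - t *\<^sub>R D) /\<^sub>R t"
      using that by (simp add: scaleR_diff_right)
    then show ?thesis by (simp add: divide_inverse mult.commute)
  qed
  have "(f has_vector_derivative D) (at 0) \<longleftrightarrow> ((\<lambda>t. norm (f t - f 0 - t *\<^sub>R D) / \<bar>t\<bar>) \<longlongrightarrow> 0) (at 0)"
    unfolding has_vector_derivative_def has_derivative_iff_norm
    by (simp add: bounded_linear_scaleR_left)
  also have "\<dots> \<longleftrightarrow> ((\<lambda>t. norm ((f t - f 0) /\<^sub>R t - D)) \<longlongrightarrow> 0) (at 0)"
    by (rule Lim_cong_within) (auto simp: quotient_eq)
  also have "\<dots> \<longleftrightarrow> ((\<lambda>t. (f t - f 0) /\<^sub>R t) \<longlongrightarrow> D) (at 0)"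
    by (simp only: tendsto_norm_zero_iff LIM_zero_iff)
  finally show ?thesis .
qed

lemma has_dirderiv_iff_sequential:
  "has_dirderiv b f f' \<longleftrightarrow> (\<forall>x X. (\<forall>n. X n \<noteq> 0) \<longrightarrow> X \<longlonglongrightarrow> 0 \<longrightarrow>
    (\<lambda>n. (f (x + X n *\<^sub>R b) - f x) /\<^sub>R X n) \<longlonglongrightarrow> f' x)"
  unfolding has_dirderiv_def has_vector_derivative_iff_quotient tendsto_at_iff_sequentially
  by (auto simp: o_def)

lemma pderivs_append: "pderivs (bs @ cs) f = pderivs bs (pderivs cs f)"
  by (induction bs) auto

lemma
  assumes D_Nil: "D [] = f"
    and D_Cons: "\<And>b bs. b \<in> Basis \<Longrightarrow> bs \<in> lists Basis \<Longrightarrow> has_dirderiv b (D bs) (D (b # bs))"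
  shows pderivs_eqI: "bs \<in> lists Basis \<Longrightarrow> pderivs bs f = D bs"
    and schwartzI: "(\<And>bs. bs \<in> lists Basis \<Longrightarrow> continuous_on UNIV (D bs)) \<Longrightarrow>
      (\<And>bs. bs \<in> lists Basis \<Longrightarrow> rapidly_decreasing (D bs)) \<Longrightarrow> schwartz f"
proof -
  show pderivs_eq: "pderivs bs f = D bs" if "bs \<in> lists Basis" for bs
    using that by (induction bs) (auto simp: D_Nil intro!: has_dirderiv_imp_dirderiv_eq D_Cons)
  assume cont: "\<And>bs. bs \<in> lists Basis \<Longrightarrow> continuous_on UNIV (D bs)"
    and decay: "\<And>bs. bs \<in> lists Basis \<Longrightarrow> rapidly_decreasing (D bs)"
  have "bounded (range (\<lambda>x. weight x ^ k * norm (D bs x)))" if bs: "bs \<in> lists Basis" for k bs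
  proof -
    obtain C where "\<And>x. weight x ^ k * norm (D bs x) \<le> C"
      using decay[OF bs] by (metis rapidly_decreasingE)
    then show ?thesis by (auto intro!: boundedI[of _ C])
  qed
  moreover have "(\<lambda>t::real. D bs (x + t *\<^sub>R b)) differentiable (at 0)"
    if "bs \<in> lists Basis" "b \<in> Basis" for bs b x
    using D_Cons[OF that(2,1)] unfolding has_dirderiv_def by (blast intro: differentiableI_vector)
  ultimately show "schwartz f" unfolding schwartz_def smooth_fun_def by (simp add: pderivs_eq cont)
qed

lemma schwartz_coinduct:
  assumes "Q i"
    and cont: "\<And>i. Q i \<Longrightarrow> continuous_on UNIV (F i)"
    and decay: "\<And>i. Q i \<Longrightarrow> rapidly_decreasing (F i)"
    and step: "\<And>i b. Q i \<Longrightarrow> b \<in> Basis \<Longrightarrow> \<exists>j. Q j \<and> has_dirderiv b (F i) (F j)"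
  shows "schwartz (F i)"
proof -
  have closed: "\<exists>j. Q j \<and> pderivs bs (F i) = F j" if "bs \<in> lists Basis" for bs
    using that
  proof (induction bs)
    case (Cons b bs)
    then obtain j where "Q j" "pderivs bs (F i) = F j" "b \<in> Basis" by auto
    then show ?case using step has_dirderiv_imp_dirderiv_eq by fastforce
  qed (use \<open>Q i\<close> in auto)
  show ?thesis
  proof (rule schwartzI[where D="\<lambda>bs. pderivs bs (F i)"])
    show "has_dirderiv b (pderivs bs (F i)) (pderivs (b # bs) (F i))"
      if "b \<in> Basis" "bs \<in> lists Basis" for b bs
      using closed[OF that(2)] step[OF _ that(1)] has_dirderiv_imp_dirderiv_eq by fastforce
  qed (use closed cont decay in fastforce)+
qed

lemma schwartz_pderivs:
  assumes f_schwartz: "schwartz f" and bs: "bs \<in> lists Basis"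
  shows "schwartz (pderivs bs f)"
proof -
  have "cs @ bs \<in> lists Basis" if "cs \<in> lists Basis" for cs using that bs by simp
  then show ?thesis
    using f_schwartz unfolding schwartz_def smooth_fun_def pderivs_append[symmetric] by blast
qed

lemma schwartz_dirderiv: "schwartz f \<Longrightarrow> b \<in> Basis \<Longrightarrow> schwartz (dirderiv b f)"
  using schwartz_pderivs[of f "[b]"] by simp

lemma schwartz_has_dirderiv:
  assumes "schwartz f" "b \<in> Basis"
  shows "has_dirderiv b f (dirderiv b f)"
proof -
  have "(\<lambda>t::real. pderivs [] f (x + t *\<^sub>R b)) differentiable (at 0)" for x
    using assms unfolding schwartz_def smooth_fun_def by blast
  then show ?thesis unfolding has_dirderiv_def dirderiv_def by (simp add: vector_derivative_works)
qed

lemma schwartz_pderivs_has_dirderiv: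
  "schwartz f \<Longrightarrow> b \<in> Basis \<Longrightarrow> bs \<in> lists Basis \<Longrightarrow>
    has_dirderiv b (pderivs bs f) (pderivs (b # bs) f)"
  using schwartz_has_dirderiv[OF schwartz_pderivs] by simp

lemma schwartz_continuous: "schwartz f \<Longrightarrow> continuous_on UNIV f"
  unfolding schwartz_def smooth_fun_def by (metis lists.Nil pderivs.simps(1))

lemma schwartz_measurable: "schwartz f \<Longrightarrow> f \<in> borel_measurable borel"
  by (intro borel_measurable_continuous_onI schwartz_continuous)

lemma schwartz_rapidly_decreasing:
  assumes "schwartz f" shows "rapidly_decreasing f"
  unfolding rapidly_decreasing_def
proof
  fix k
  have "bounded (range (\<lambda>x. weight x ^ k * norm (pderivs [] f x)))"
    using assms unfolding schwartz_def by blast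
  then obtain C where "\<And>x. norm (weight x ^ k * norm (f x)) \<le> C" by (auto simp: bounded_iff)
  then show "\<exists>C. \<forall>x. weight x ^ k * norm (f x) \<le> C" by (intro exI[of _ C]) simp
qed

lemma schwartz_decay:
  assumes "schwartz f"
  obtains C where "0 \<le> C" "\<And>x. weight x ^ k * norm (f x) \<le> C"
  using rapidly_decreasingE[OF schwartz_rapidly_decreasing[OF assms]] by blast

lemma schwartz_pderivs_continuous:
  "schwartz f \<Longrightarrow> bs \<in> lists Basis \<Longrightarrow> continuous_on UNIV (pderivs bs f)"
  by (intro schwartz_continuous schwartz_pderivs)

lemma schwartz_pderivs_rapidly_decreasing:
  "schwartz f \<Longrightarrow> bs \<in> lists Basis \<Longrightarrow> rapidly_decreasing (pderivs bs f)"
  by (intro schwartz_rapidly_decreasing schwartz_pderivs)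

lemma schwartz_add:
  assumes f_schwartz: "schwartz f" and g_schwartz: "schwartz g"
  shows "schwartz (\<lambda>x. f x + g x)"
  by (rule schwartzI[where D="\<lambda>bs x. pderivs bs f x + pderivs bs g x"])
    (auto intro!: has_dirderiv_add schwartz_pderivs_has_dirderiv continuous_on_add
      schwartz_pderivs_continuous rapidly_decreasing_add schwartz_pderivs_rapidly_decreasing
      f_schwartz g_schwartz simp del: pderivs.simps(2))

lemma schwartz_cmult:
  assumes f_schwartz: "schwartz f"
  shows "schwartz (\<lambda>x. c * f x)"
  by (rule schwartzI[where D="\<lambda>bs x. c * pderivs bs f x"])
    (auto intro!: has_dirderiv_cmult schwartz_pderivs_has_dirderiv continuous_on_mult_left
      schwartz_pderivs_continuous rapidly_decreasing_cmult schwartz_pderivs_rapidly_decreasing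
      f_schwartz simp del: pderivs.simps(2))

lemma schwartz_diff: "schwartz f \<Longrightarrow> schwartz g \<Longrightarrow> schwartz (\<lambda>x. f x - g x)"
  using schwartz_add[of f "\<lambda>x. (-1) * g x"] schwartz_cmult[of g "-1"] by simp

lemma schwartz_zero: "schwartz (\<lambda>x. 0)"
  by (rule schwartzI[where D="\<lambda>_ _. 0"]) (auto simp: has_dirderiv_def rapidly_decreasing_def)

lemma schwartz_sum:
  "finite I \<Longrightarrow> (\<And>i. i \<in> I \<Longrightarrow> schwartz (f i)) \<Longrightarrow> schwartz (\<lambda>x. \<Sum>i\<in>I. f i x)"
  by (induction I rule: finite_induct) (auto simp: schwartz_zero intro!: schwartz_add)

lemma schwartz_translate:
  assumes f_schwartz: "schwartz f"
  shows "schwartz (\<lambda>y. f (y + x))"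
proof (rule schwartzI[where D="\<lambda>bs y. pderivs bs f (y + x)"])
  show "continuous_on UNIV (\<lambda>y. pderivs bs f (y + x))" if "bs \<in> lists Basis" for bs
    by (intro continuous_on_compose2[OF schwartz_pderivs_continuous[OF f_schwartz that]]
      continuous_intros) auto
qed (auto intro!: has_dirderiv_translate schwartz_pderivs_has_dirderiv rapidly_decreasing_translate
    schwartz_pderivs_rapidly_decreasing f_schwartz simp del: pderivs.simps(2))

lemma pderivs_translate: "pderivs bs (\<lambda>y. f (y + x)) = (\<lambda>y. pderivs bs f (y + x))"
  by (induction bs) (auto simp: dirderiv_def fun_eq_iff add_ac)

lemma pderivs_add:
  "bs \<in> lists Basis \<Longrightarrow> schwartz f \<Longrightarrow> schwartz g \<Longrightarrow>
    pderivs bs (\<lambda>x. f x + g x) = (\<lambda>x. pderivs bs f x + pderivs bs g x)"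
  by (rule pderivs_eqI[where D="\<lambda>bs x. pderivs bs f x + pderivs bs g x"])
    (auto intro!: has_dirderiv_add schwartz_pderivs_has_dirderiv simp del: pderivs.simps(2))

lemma pderivs_cmult:
  "bs \<in> lists Basis \<Longrightarrow> schwartz f \<Longrightarrow> pderivs bs (\<lambda>x. c * f x) = (\<lambda>x. c * pderivs bs f x)"
  by (rule pderivs_eqI[where D="\<lambda>bs x. c * pderivs bs f x"])
    (auto intro!: has_dirderiv_cmult schwartz_pderivs_has_dirderiv simp del: pderivs.simps(2))

lemma pderivs_diff:
  "bs \<in> lists Basis \<Longrightarrow> schwartz f \<Longrightarrow> schwartz g \<Longrightarrow>
    pderivs bs (\<lambda>x. f x - g x) = (\<lambda>x. pderivs bs f x - pderivs bs g x)"
  using pderivs_add[OF _ _ schwartz_cmult[of g "-1"]] pderivs_cmult[of bs g "-1"] by simp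

section \<open>Tempered distributions\<close>

lemma weighted_pderivs_le_schwartz_seminorm:
  assumes "schwartz f" "bs \<in> lists Basis"
  shows "weight x ^ k * norm (pderivs bs f x) \<le> schwartz_seminorm k bs f"
proof -
  have "bdd_above (range (\<lambda>x. weight x ^ k * norm (pderivs bs f x)))"
    using assms unfolding schwartz_def by (intro bounded_imp_bdd_above) blast
  then show ?thesis unfolding schwartz_seminorm_def by (rule cSUP_upper[OF UNIV_I])
qed

lemma schwartz_seminorm_nonneg:
  assumes "schwartz f" "bs \<in> lists Basis"
  shows "0 \<le> schwartz_seminorm k bs f"
proof -
  have "0 \<le> weight (0::'a) ^ k * norm (pderivs bs f 0)" by simp
  also have "\<dots> \<le> schwartz_seminorm k bs f" by (rule weighted_pderivs_le_schwartz_seminorm[OF assms])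
  finally show ?thesis .
qed

definition multi_indices :: "nat \<Rightarrow> 'a::euclidean_space list set" where
  "multi_indices M = {bs. set bs \<subseteq> Basis \<and> length bs \<le> M}"

lemma finite_multi_indices: "finite (multi_indices M)"
  unfolding multi_indices_def by (rule finite_lists_length_le) simp

lemma multi_indices_subset: "bs \<in> multi_indices M \<Longrightarrow> bs \<in> lists Basis"
  by (auto simp: multi_indices_def)

definition schwartz_norm :: "nat \<Rightarrow> ('a::euclidean_space \<Rightarrow> complex) \<Rightarrow> real" where
  "schwartz_norm M f = (\<Sum>k\<le>M. \<Sum>bs\<in>multi_indices M. schwartz_seminorm k bs f)"

lemma schwartz_seminorm_le_schwartz_norm:
  assumes f_schwartz: "schwartz f" and k_le: "k \<le> M" and bs: "bs \<in> multi_indices M"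
  shows "schwartz_seminorm k bs f \<le> schwartz_norm M f"
proof -
  note nonneg = schwartz_seminorm_nonneg[OF f_schwartz multi_indices_subset]
  have "schwartz_seminorm k bs f \<le> (\<Sum>bs\<in>multi_indices M. schwartz_seminorm k bs f)"
    using bs by (intro member_le_sum finite_multi_indices nonneg) auto
  also have "\<dots> \<le> schwartz_norm M f"
    unfolding schwartz_norm_def using k_le
    by (intro member_le_sum[of k _ "\<lambda>k. \<Sum>bs\<in>multi_indices M. schwartz_seminorm k bs f"]
      sum_nonneg nonneg) auto
  finally show ?thesis .
qed

lemma schwartz_norm_nonneg: "schwartz f \<Longrightarrow> 0 \<le> schwartz_norm M f"
  unfolding schwartz_norm_def
  by (intro sum_nonneg schwartz_seminorm_nonneg) (auto dest: multi_indices_subset)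

definition num_seminorms :: "'a::euclidean_space itself \<Rightarrow> nat \<Rightarrow> real" where
  "num_seminorms _ M = real (Suc M) * real (card (multi_indices M :: 'a list set))"

lemma schwartz_norm_le:
  fixes f :: "'a::euclidean_space \<Rightarrow> complex"
  assumes bound: "\<And>bs y. bs \<in> multi_indices M \<Longrightarrow> weight y ^ M * norm (pderivs bs f y) \<le> B"
  shows "schwartz_norm M f \<le> num_seminorms TYPE('a) M * B"
proof -
  have "schwartz_seminorm k bs f \<le> B" if "k \<le> M" "bs \<in> multi_indices M" for k bs
    unfolding schwartz_seminorm_def
  proof (intro cSUP_least)
    fix y :: 'a
    have "weight y ^ k * norm (pderivs bs f y) \<le> weight y ^ M * norm (pderivs bs f y)"
      using \<open>k \<le> M\<close> by (intro mult_right_mono power_increasing) auto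
    then show "weight y ^ k * norm (pderivs bs f y) \<le> B"
      using bound[OF that(2)] by (rule order_trans)
  qed simp
  then have "schwartz_norm M f \<le> (\<Sum>k\<le>M. \<Sum>bs\<in>(multi_indices M :: 'a list set). B)"
    unfolding schwartz_norm_def by (intro sum_mono) simp
  then show ?thesis by (simp add: num_seminorms_def mult.assoc)
qed

lemma num_seminorms_nonneg: "0 \<le> num_seminorms TYPE('a::euclidean_space) M"
  by (simp add: num_seminorms_def)

lemma tempered_add: "tempered T \<Longrightarrow> schwartz f \<Longrightarrow> schwartz g \<Longrightarrow> T (\<lambda>x. f x + g x) = T f + T g"
  and tempered_cmult: "tempered T \<Longrightarrow> schwartz f \<Longrightarrow> T (\<lambda>x. c * f x) = c * T f"
  and tempered_outside: "tempered T \<Longrightarrow> \<not> schwartz f \<Longrightarrow> T f = 0"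
  unfolding tempered_def by blast+

lemma temperedI:
  assumes "\<And>f g. schwartz f \<Longrightarrow> schwartz g \<Longrightarrow> T (\<lambda>x. f x + g x) = T f + T g"
    and "\<And>c f. schwartz f \<Longrightarrow> T (\<lambda>x. c * f x) = c * T f"
    and "\<And>f. \<not> schwartz f \<Longrightarrow> T f = 0"
    and "\<And>f. schwartz f \<Longrightarrow> norm (T f) \<le> C * schwartz_norm M f"
  shows "tempered T"
  using assms unfolding tempered_def schwartz_norm_def multi_indices_def by blast

lemma tempered_bound:
  assumes "tempered T"
  obtains C M where "0 \<le> C" "\<And>f. schwartz f \<Longrightarrow> norm (T f) \<le> C * schwartz_norm M f"
proof -
  obtain C M where C_bound: "\<And>f. schwartz f \<Longrightarrow> norm (T f) \<le> C * schwartz_norm M f"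
    using assms unfolding tempered_def schwartz_norm_def multi_indices_def by blast
  have "norm (T f) \<le> \<bar>C\<bar> * schwartz_norm M f" if "schwartz f" for f
    using C_bound[OF that] mult_right_mono[OF abs_ge_self schwartz_norm_nonneg[OF that]]
    by (rule order_trans)
  then show ?thesis using that[of "\<bar>C\<bar>" M] by simp
qed

lemma tempered_zero: "tempered T \<Longrightarrow> T (\<lambda>x. 0) = 0"
  using tempered_cmult[of T "\<lambda>x. 0" 0] schwartz_zero by simp

lemma tempered_diff:
  assumes "tempered T" "schwartz f" "schwartz g"
  shows "T (\<lambda>x. f x - g x) = T f - T g"
  using tempered_add[OF assms(1,2) schwartz_cmult[OF assms(3), of "-1"]]
    tempered_cmult[OF assms(1,3), of "-1"] by simp

lemma tempered_sum:
  assumes T_tempered: "tempered T" and "finite I" "\<And>i. i \<in> I \<Longrightarrow> schwartz (f i)"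
  shows "T (\<lambda>x. \<Sum>i\<in>I. f i x) = (\<Sum>i\<in>I. T (f i))"
  using assms(2,3)
  by (induction I rule: finite_induct)
    (auto simp: tempered_zero[OF T_tempered] tempered_add[OF T_tempered] schwartz_sum)

lemma tempered_eqI:
  assumes "tempered S" "tempered T" "\<And>\<phi>. schwartz \<phi> \<Longrightarrow> S \<phi> = T \<phi>"
  shows "S = T"
  using assms tempered_outside by (metis ext)

lemma tempered_eqI_Re:
  assumes S_tempered: "tempered S" and T_tempered: "tempered T"
    and Re_eq: "\<And>\<phi>. schwartz \<phi> \<Longrightarrow> Re (S \<phi>) = Re (T \<phi>)"
  shows "S = T"
proof (rule tempered_eqI[OF S_tempered T_tempered])
  fix \<phi> :: "'a \<Rightarrow> complex" assume \<phi>_schwartz: "schwartz \<phi>"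
  show "S \<phi> = T \<phi>"
    using Re_eq[OF \<phi>_schwartz] Re_eq[OF schwartz_cmult[OF \<phi>_schwartz, of \<i>]]
      tempered_cmult[OF S_tempered \<phi>_schwartz, of \<i>] tempered_cmult[OF T_tempered \<phi>_schwartz, of \<i>]
    by (simp add: complex_eq_iff)
qed

section \<open>Integrals of families of Schwartz functions\<close>

definition dominated_family ::
  "'c measure \<Rightarrow> ('c \<Rightarrow> 'a::real_normed_vector \<Rightarrow> 'b::{banach, second_countable_topology}) \<Rightarrow> bool"
    where
  "dominated_family M G \<longleftrightarrow> (\<forall>y. (\<lambda>z. G z y) \<in> borel_measurable M) \<and>
    (\<forall>k. \<exists>H. integrable M H \<and> (\<forall>z y. weight y ^ k * norm (G z y) \<le> H z))"

lemma dominated_family_measurable: "dominated_family M G \<Longrightarrow> (\<lambda>z. G z y) \<in> borel_measurable M"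
  by (simp add: dominated_family_def)

lemma dominated_familyE:
  assumes "dominated_family M G"
  obtains H where "integrable M H" "\<And>z y. weight y ^ k * norm (G z y) \<le> H z"
  using assms unfolding dominated_family_def by blast

lemma dominated_family_bound:
  assumes "dominated_family M G"
  obtains H where "integrable M H" "\<And>z y. norm (G z y) \<le> H z"
  using dominated_familyE[OF assms, of 0] by auto

lemma dominated_family_integrable:
  assumes "dominated_family M G"
  shows "integrable M (\<lambda>z. G z y)"
proof -
  obtain H where "integrable M H" "\<And>z y. norm (G z y) \<le> H z"
    using dominated_family_bound[OF assms] by blast
  then show ?thesis
    by (intro Bochner_Integration.integrable_bound[OF _ dominated_family_measurable[OF assms],
      of H]) (auto intro!: AE_I2 order_trans[OF _ abs_ge_self])
qed

lemma weighted_norm_integral_le: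
  fixes g :: "'c \<Rightarrow> 'b::{banach, second_countable_topology}"
  assumes H_integrable: "integrable M H" and g_integrable: "integrable M g"
    and weighted_le: "\<And>z. weight y ^ k * norm (g z) \<le> H z"
  shows "weight y ^ k * norm (\<integral>z. g z \<partial>M) \<le> (\<integral>z. H z \<partial>M)"
proof -
  have "weight y ^ k * norm (\<integral>z. g z \<partial>M) \<le> weight y ^ k * (\<integral>z. norm (g z) \<partial>M)"
    by (intro mult_left_mono integral_norm_bound) auto
  also have "\<dots> = (\<integral>z. weight y ^ k * norm (g z) \<partial>M)" by simp
  also have "\<dots> \<le> (\<integral>z. H z \<partial>M)"
    using H_integrable g_integrable weighted_le by (intro integral_mono) auto
  finally show ?thesis .
qed

lemma rapidly_decreasing_integral:
  assumes "dominated_family M G"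
  shows "rapidly_decreasing (\<lambda>y. \<integral>z. G z y \<partial>M)"
  unfolding rapidly_decreasing_def
  using weighted_norm_integral_le[OF _ dominated_family_integrable[OF assms]]
    dominated_familyE[OF assms] by metis

lemma continuous_integral:
  assumes G_dominated: "dominated_family M G" and cont: "\<And>z. continuous_on UNIV (G z)"
  shows "continuous_on UNIV (\<lambda>y. \<integral>z. G z y \<partial>M)"
proof -
  obtain H where H_integrable: "integrable M H" "\<And>z y. norm (G z y) \<le> H z"
    using dominated_family_bound[OF G_dominated] by blast
  have "isCont (\<lambda>y. \<integral>z. G z y \<partial>M) a" for a
  proof (rule continuous_at_sequentiallyI)
    fix u assume u_lim: "u \<longlonglongrightarrow> a"
    show "(\<lambda>n. \<integral>z. G z (u n) \<partial>M) \<longlonglongrightarrow> (\<integral>z. G z a \<partial>M)"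
    proof (rule integral_dominated_convergence[where w=H])
      show "AE z in M. (\<lambda>n. G z (u n)) \<longlonglongrightarrow> G z a"
        using cont u_lim
        by (auto intro!: AE_I2 simp: continuous_on_eq_continuous_at isCont_tendsto_compose)
    qed (use H_integrable dominated_family_measurable[OF G_dominated] in auto)
  qed
  then show ?thesis by (simp add: continuous_on_eq_continuous_at)
qed

lemma has_dirderiv_integral:
  assumes G_dominated: "dominated_family M G" and G'_dominated: "dominated_family M G'"
    and deriv: "\<And>z. has_dirderiv b (G z) (G' z)"
  shows "has_dirderiv b (\<lambda>y. \<integral>z. G z y \<partial>M) (\<lambda>y. \<integral>z. G' z y \<partial>M)"
  unfolding has_dirderiv_iff_sequential
proof (intro allI impI)
  fix x and X :: "nat \<Rightarrow> real" assume X_lim: "\<forall>n. X n \<noteq> 0" "X \<longlonglongrightarrow> 0"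
  obtain H where H_integrable: "integrable M H" "\<And>z y. norm (G' z y) \<le> H z"
    using dominated_family_bound[OF G'_dominated] by blast
  have "(\<lambda>n. \<integral>z. (G z (x + X n *\<^sub>R b) - G z x) /\<^sub>R X n \<partial>M) \<longlonglongrightarrow> (\<integral>z. G' z x \<partial>M)"
  proof (rule integral_dominated_convergence[where w=H])
    show "(\<lambda>z. (G z (x + X n *\<^sub>R b) - G z x) /\<^sub>R X n) \<in> borel_measurable M" for n
      using dominated_family_measurable[OF G_dominated] by measurable
    show "AE z in M. (\<lambda>n. (G z (x + X n *\<^sub>R b) - G z x) /\<^sub>R X n) \<longlonglongrightarrow> G' z x"
      using deriv X_lim unfolding has_dirderiv_iff_sequential by (intro AE_I2) blast
    show "AE z in M. norm ((G z (x + X n *\<^sub>R b) - G z x) /\<^sub>R X n) \<le> H z" for n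
    proof (rule AE_I2)
      fix z
      have "norm (G z (x + X n *\<^sub>R b) - G z x) \<le> H z * \<bar>X n\<bar>"
        by (rule has_dirderiv_increment_bound[OF deriv H_integrable(2)])
      then show "norm ((G z (x + X n *\<^sub>R b) - G z x) /\<^sub>R X n) \<le> H z"
        using X_lim
        by (simp add: divide_inverse[symmetric] mult.commute[of "inverse _"] pos_divide_le_eq)
    qed
  qed (simp_all add: H_integrable dominated_family_measurable[OF G'_dominated])
  then show "(\<lambda>n. ((\<integral>z. G z (x + X n *\<^sub>R b) \<partial>M) - (\<integral>z. G z x \<partial>M)) /\<^sub>R X n) \<longlonglongrightarrow> (\<integral>z. G' z x \<partial>M)"
    using dominated_family_integrable[OF G_dominated] by simp
qed

definition integrable_family :: "'c measure \<Rightarrow> ('c \<Rightarrow> 'a::euclidean_space \<Rightarrow> complex) \<Rightarrow> bool" where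
  "integrable_family M G \<longleftrightarrow>
    (\<forall>z. schwartz (G z)) \<and> (\<forall>bs\<in>lists Basis. dominated_family M (\<lambda>z. pderivs bs (G z)))"

lemma integrable_family_pderivs_integrable:
  assumes "integrable_family M G" "bs \<in> lists Basis"
  shows "integrable M (\<lambda>z. pderivs bs (G z) y)"
  using assms dominated_family_integrable[of M "\<lambda>z. pderivs bs (G z)"]
  unfolding integrable_family_def by blast

lemma
  assumes "integrable_family M G"
  shows schwartz_integral: "schwartz (\<lambda>y. \<integral>z. G z y \<partial>M)"
    and pderivs_integral:
      "bs \<in> lists Basis \<Longrightarrow> pderivs bs (\<lambda>y. \<integral>z. G z y \<partial>M) = (\<lambda>y. \<integral>z. pderivs bs (G z) y \<partial>M)"
proof -
  have schwartz: "schwartz (G z)" for z using assms by (simp add: integrable_family_def)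
  have dominated: "dominated_family M (\<lambda>z. pderivs bs (G z))" if "bs \<in> lists Basis" for bs
    using assms that by (simp add: integrable_family_def)
  let ?D = "\<lambda>bs y. \<integral>z. pderivs bs (G z) y \<partial>M"
  have step: "has_dirderiv b (?D bs) (?D (b # bs))" if "b \<in> Basis" "bs \<in> lists Basis" for b bs
    using that
    by (intro has_dirderiv_integral dominated schwartz_pderivs_has_dirderiv schwartz) auto
  show "bs \<in> lists Basis \<Longrightarrow> pderivs bs (\<lambda>y. \<integral>z. G z y \<partial>M) = ?D bs"
    by (rule pderivs_eqI[where D="?D", OF _ step]) simp_all
  show "schwartz (\<lambda>y. \<integral>z. G z y \<partial>M)"
    by (rule schwartzI[where D="?D", OF _ step])
      (simp_all add: continuous_integral dominated schwartz_pderivs_continuous schwartz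
        rapidly_decreasing_integral del: in_lists_conv_set)
qed

lemma integrable_inverse_1_plus_square_real: "integrable lborel (\<lambda>x::real. inverse (1 + x\<^sup>2))"
  using integrable_inverse_1_plus_square by (simp add: set_integrable_def einterval_eq(4))

lemma inverse_weight_le_prod:
  fixes x :: "'a::euclidean_space"
  shows "inverse (weight x ^ (2 * DIM('a))) \<le> (\<Prod>b\<in>Basis. inverse (1 + (x \<bullet> b)\<^sup>2))"
proof -
  have "(\<Prod>b\<in>(Basis::'a set). 1 + (x \<bullet> b)\<^sup>2) \<le> (\<Prod>b\<in>(Basis::'a set). (weight x)\<^sup>2)"
  proof (rule prod_mono, safe)
    fix b :: 'a assume b_Basis: "b \<in> Basis"
    have "(x \<bullet> b)\<^sup>2 \<le> (norm x)\<^sup>2"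
      using Basis_le_norm[OF b_Basis, of x] by (metis abs_le_square_iff abs_norm_cancel)
    then show "1 + (x \<bullet> b)\<^sup>2 \<le> (weight x)\<^sup>2" by (simp add: power2_sum add_increasing2)
  qed simp
  moreover have "0 < (\<Prod>b\<in>(Basis::'a set). 1 + (x \<bullet> b)\<^sup>2)"
    by (intro prod_pos) (simp add: add_pos_nonneg)
  ultimately have "inverse (weight x ^ (2 * DIM('a))) \<le> inverse (\<Prod>b\<in>(Basis::'a set). 1 + (x \<bullet> b)\<^sup>2)"
    by (intro le_imp_inverse_le) (simp_all add: power_mult)
  then show ?thesis by (simp add: prod_inversef[symmetric] o_def)
qed

lemma integrable_inverse_weight:
  "integrable lborel (\<lambda>x::'a::euclidean_space. inverse (weight x ^ (2 * DIM('a))))"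
proof (rule integrableI_bounded)
  show "(\<lambda>x::'a. inverse (weight x ^ (2 * DIM('a)))) \<in> borel_measurable lborel" by measurable
  have "(\<integral>\<^sup>+x. ennreal (norm (inverse (weight x ^ (2 * DIM('a))))) \<partial>(lborel::'a measure))
      \<le> (\<integral>\<^sup>+x. ennreal (\<Prod>b\<in>Basis. inverse (1 + (x \<bullet> b)\<^sup>2)) \<partial>(lborel::'a measure))"
    using inverse_weight_le_prod by (intro nn_integral_mono ennreal_leI) simp
  also have "\<dots> = (\<integral>\<^sup>+x. (\<Prod>b\<in>Basis. ennreal (inverse (1 + (x \<bullet> b)\<^sup>2))) \<partial>(lborel::'a measure))"
    by (intro nn_integral_cong) (simp add: prod_ennreal add_nonneg_nonneg)
  also have "\<dots> = (\<Prod>b\<in>(Basis::'a set). \<integral>\<^sup>+x. ennreal (inverse (1 + x\<^sup>2)) \<partial>lborel)"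
    by (rule nn_integral_lborel_prod) auto
  also have "\<dots> < \<infinity>"
    using integrable_inverse_1_plus_square_real
    by (simp add: integrable_iff_bounded less_top[symmetric] power_eq_top_ennreal add_nonneg_nonneg
      abs_of_nonneg)
  finally show
    "(\<integral>\<^sup>+x. ennreal (norm (inverse (weight x ^ (2 * DIM('a))))) \<partial>(lborel::'a measure)) < \<infinity>" .
qed

definition rapidly_integrable :: "('b::euclidean_space \<Rightarrow> complex) \<Rightarrow> bool" where
  "rapidly_integrable w \<longleftrightarrow>
    w \<in> borel_measurable borel \<and> (\<forall>K. integrable lborel (\<lambda>z. weight z ^ K * norm (w z)))"

lemma rapidly_integrable_measurable: "rapidly_integrable w \<Longrightarrow> w \<in> borel_measurable borel"
  and rapidly_integrable_weight: "rapidly_integrable w \<Longrightarrow>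
      integrable lborel (\<lambda>z. weight z ^ K * norm (w z))"
  by (auto simp: rapidly_integrable_def)

lemma rapidly_integrable_mult:
  assumes w_rapid: "rapidly_integrable w" and g_measurable: "g \<in> borel_measurable borel"
    and growth: "\<And>z. norm (g z) \<le> C * weight z ^ K"
  shows "integrable lborel (\<lambda>z. w z * g z)"
proof (rule Bochner_Integration.integrable_bound)
  show "integrable lborel (\<lambda>z. C * (weight z ^ K * norm (w z)))"
    by (intro integrable_mult_right rapidly_integrable_weight w_rapid)
  show "(\<lambda>z. w z * g z) \<in> borel_measurable lborel"
    using g_measurable rapidly_integrable_measurable[OF w_rapid]
    by (auto intro!: borel_measurable_times)
  have "norm (w z * g z) \<le> C * (weight z ^ K * norm (w z))" for z
    using mult_left_mono[OF growth, of "norm (w z)" z] by (simp add: norm_mult mult_ac)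
  then show "AE z in lborel. norm (w z * g z) \<le> norm (C * (weight z ^ K * norm (w z)))"
    by (intro AE_I2) (metis abs_ge_self order_trans real_norm_def)
qed

lemma rapidly_integrable_integrable: "rapidly_integrable w \<Longrightarrow> integrable lborel w"
  using rapidly_integrable_mult[of w "\<lambda>_. 1" 1 0] by simp

lemma rapidly_decreasing_rapidly_integrable:
  fixes f :: "'a::euclidean_space \<Rightarrow> complex"
  assumes f_measurable: "f \<in> borel_measurable borel" and decay: "rapidly_decreasing f"
  shows "rapidly_integrable f"
  unfolding rapidly_integrable_def
proof (intro conjI allI f_measurable)
  fix K
  obtain C where C_bound: "\<And>x. weight x ^ (2 * DIM('a) + K) * norm (f x) \<le> C"
    using decay by (metis rapidly_decreasingE)
  show "integrable lborel (\<lambda>x. weight x ^ K * norm (f x))"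
  proof (rule Bochner_Integration.integrable_bound)
    show "integrable lborel (\<lambda>x::'a. C * inverse (weight x ^ (2 * DIM('a))))"
      by (intro integrable_mult_right integrable_inverse_weight)
    have "weight x ^ K * norm (f x) \<le> C * inverse (weight x ^ (2 * DIM('a)))" for x
      using C_bound[of x] unfolding weight_power_mult_le_iff[symmetric]
      by (simp add: power_add mult_ac)
    then show "AE x in lborel. norm (weight x ^ K * norm (f x))
        \<le> norm (C * inverse (weight x ^ (2 * DIM('a))))"
      by (intro AE_I2) (auto intro: order_trans[OF _ abs_ge_self])
  qed (use f_measurable in measurable)
qed

lemma schwartz_rapidly_integrable: "schwartz f \<Longrightarrow> rapidly_integrable f"
  by (intro rapidly_decreasing_rapidly_integrable schwartz_measurable schwartz_rapidly_decreasing)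

text \<open>The weighted supremum over \<open>y\<close> is a Schwartz seminorm, so this bounds the size and the local
  Lipschitz constant of \<open>z \<mapsto> F z\<close>, as a map into the Schwartz space, polynomially in \<open>z\<close>.\<close>

definition poly_lipschitz_bound ::
  "nat \<Rightarrow> real \<Rightarrow> nat \<Rightarrow> ('b::real_normed_vector \<Rightarrow> 'a::real_normed_vector \<Rightarrow> complex) \<Rightarrow> bool" where
  "poly_lipschitz_bound k C K F \<longleftrightarrow> 0 \<le> C \<and>
    (\<forall>z y. weight y ^ k * norm (F z y) \<le> C * weight z ^ K) \<and>
    (\<forall>z v y. weight y ^ k * norm (F z y - F v y) \<le> C * norm (z - v) * (1 + norm z + norm v) ^ K)"

definition poly_lipschitz ::
  "('b::real_normed_vector \<Rightarrow> 'a::real_normed_vector \<Rightarrow> complex) \<Rightarrow> bool" where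
  "poly_lipschitz F \<longleftrightarrow> (\<forall>k. \<exists>C K. poly_lipschitz_bound k C K F)"

lemma
  assumes "poly_lipschitz_bound k C K F"
  shows poly_lipschitz_bound_nonneg: "0 \<le> C"
    and poly_lipschitz_bound_growth: "weight y ^ k * norm (F z y) \<le> C * weight z ^ K"
    and poly_lipschitz_bound_diff:
      "weight y ^ k * norm (F z y - F v y) \<le> C * norm (z - v) * (1 + norm z + norm v) ^ K"
  using assms unfolding poly_lipschitz_bound_def by auto

lemma poly_lipschitz_bound_mono:
  assumes F_lipschitz: "poly_lipschitz_bound k C K F" and mono: "C \<le> C'" "K \<le> K'"
  shows "poly_lipschitz_bound k C' K' F"
  unfolding poly_lipschitz_bound_def
proof (intro conjI allI)
  note C_nonneg = poly_lipschitz_bound_nonneg[OF F_lipschitz]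
  show "0 \<le> C'" using C_nonneg mono by simp
  show "weight y ^ k * norm (F z y) \<le> C' * weight z ^ K'" for z y
    using C_nonneg mono
    by (intro order_trans[OF poly_lipschitz_bound_growth[OF F_lipschitz]] mult_mono
      power_increasing) auto
  show "weight y ^ k * norm (F z y - F v y) \<le> C' * norm (z - v) * (1 + norm z + norm v) ^ K'"
    for z v y
    using C_nonneg mono
    by (intro order_trans[OF poly_lipschitz_bound_diff[OF F_lipschitz]] mult_mono power_increasing)
      auto
qed

lemma poly_lipschitz_common_bound:
  assumes "finite I" "\<And>i. i \<in> I \<Longrightarrow> poly_lipschitz (F i)"
  shows "\<exists>C K. 0 \<le> C \<and> (\<forall>i\<in>I. poly_lipschitz_bound k C K (F i))"
  using assms
proof (induction I rule: finite_induct)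
  case (insert i I)
  then obtain C K D L where I_bound: "0 \<le> C" "\<forall>i\<in>I. poly_lipschitz_bound k C K (F i)"
    and i_bound: "poly_lipschitz_bound k D L (F i)"
    unfolding poly_lipschitz_def by (metis insertI1 insertI2)
  have "poly_lipschitz_bound k (max C D) (max K L) (F j)" if "j \<in> insert i I" for j
    using that I_bound(2) i_bound by (auto intro: poly_lipschitz_bound_mono)
  then show ?case using I_bound(1) by (intro exI[of _ "max C D"] exI[of _ "max K L"]) auto
qed (auto intro: exI[of _ 0])

lemma poly_lipschitz_imp_continuous:
  assumes lip: "\<And>z v. norm (g z - g v) \<le> C * norm (z - v) * (1 + norm z + norm v) ^ K"
  shows "continuous_on UNIV g"
proof -
  have "isCont g a" for a
  proof (rule continuous_at_sequentiallyI)
    fix u assume u_lim: "u \<longlonglongrightarrow> a"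
    have "(\<lambda>n. C * norm (u n - a) * (1 + norm (u n) + norm a) ^ K)
        \<longlonglongrightarrow> C * norm (a - a) * (1 + norm a + norm a) ^ K"
      by (intro tendsto_intros u_lim)
    then have "(\<lambda>n. C * norm (u n - a) * (1 + norm (u n) + norm a) ^ K) \<longlonglongrightarrow> 0" by simp
    from Lim_null_comparison[OF always_eventually[OF allI[OF lip]] this]
    have "(\<lambda>n. g (u n) - g a) \<longlonglongrightarrow> 0" .
    then show "(\<lambda>n. g (u n)) \<longlonglongrightarrow> g a" by (rule LIM_zero_cancel)
  qed
  then show ?thesis by (simp add: continuous_on_eq_continuous_at)
qed

lemma poly_lipschitz_continuous:
  assumes "poly_lipschitz F"
  shows "continuous_on UNIV (\<lambda>z. F z y)"
proof -
  obtain C K where "poly_lipschitz_bound 0 C K F" using assms unfolding poly_lipschitz_def by blast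
  from poly_lipschitz_bound_diff[OF this, of y] show ?thesis
    by (intro poly_lipschitz_imp_continuous) simp
qed

definition schwartz_family ::
  "('b::real_normed_vector \<Rightarrow> 'a::euclidean_space \<Rightarrow> complex) \<Rightarrow> bool" where
  "schwartz_family F \<longleftrightarrow>
    (\<forall>z. schwartz (F z)) \<and> (\<forall>bs\<in>lists Basis. poly_lipschitz (\<lambda>z. pderivs bs (F z)))"

lemma schwartz_family_schwartz: "schwartz_family F \<Longrightarrow> schwartz (F z)"
  and schwartz_family_pderivs: "schwartz_family F \<Longrightarrow> bs \<in> lists Basis \<Longrightarrow>
      poly_lipschitz (\<lambda>z. pderivs bs (F z))"
  by (simp_all add: schwartz_family_def)

lemma schwartz_family_common_bound:
  assumes "schwartz_family F"
  obtains C K where "0 \<le> C"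
    "\<And>bs. bs \<in> multi_indices M \<Longrightarrow> poly_lipschitz_bound k C K (\<lambda>z. pderivs bs (F z))"
  using poly_lipschitz_common_bound[OF finite_multi_indices, of M "\<lambda>bs z. pderivs bs (F z)" k]
    schwartz_family_pderivs[OF assms multi_indices_subset] by blast

lemma tempered_family_bounds:
  fixes F :: "'b::real_normed_vector \<Rightarrow> 'a::euclidean_space \<Rightarrow> complex"
  assumes T_tempered: "tempered T" and F_family: "schwartz_family F"
  obtains C K where "0 \<le> C" "\<And>z. norm (T (F z)) \<le> C * weight z ^ K"
    "\<And>z v. norm (T (F z) - T (F v)) \<le> C * norm (z - v) * (1 + norm z + norm v) ^ K"
proof -
  note F_schwartz = schwartz_family_schwartz[OF F_family]
  obtain D M where D_bound: "0 \<le> D" "\<And>f. schwartz f \<Longrightarrow> norm (T f) \<le> D * schwartz_norm M f"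
    using tempered_bound[OF T_tempered] by blast
  obtain C K where C_nonneg: "0 \<le> C"
    and bound: "\<And>bs. bs \<in> multi_indices M \<Longrightarrow> poly_lipschitz_bound M C K (\<lambda>z. pderivs bs (F z))"
    using schwartz_family_common_bound[OF F_family] by blast
  let ?c = "num_seminorms TYPE('a) M"
  show ?thesis
  proof
    show "0 \<le> D * ?c * C" by (intro mult_nonneg_nonneg C_nonneg D_bound num_seminorms_nonneg)
    show "norm (T (F z)) \<le> D * ?c * C * weight z ^ K" for z
    proof -
      have "schwartz_norm M (F z) \<le> ?c * (C * weight z ^ K)"
        by (rule schwartz_norm_le) (rule poly_lipschitz_bound_growth[OF bound])
      from order_trans[OF D_bound(2)[OF F_schwartz] mult_left_mono[OF this D_bound(1)]] show ?thesis
        by (simp add: mult.assoc)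
    qed
    show "norm (T (F z) - T (F v)) \<le> D * ?c * C * norm (z - v) * (1 + norm z + norm v) ^ K" for z v
    proof -
      have "schwartz_norm M (\<lambda>y. F z y - F v y)
          \<le> ?c * (C * norm (z - v) * (1 + norm z + norm v) ^ K)"
        by (rule schwartz_norm_le)
          (use poly_lipschitz_bound_diff[OF bound] in
            \<open>simp add: pderivs_diff[OF multi_indices_subset F_schwartz F_schwartz]\<close>)
      from order_trans[OF D_bound(2)[OF schwartz_diff[OF F_schwartz F_schwartz]]
        mult_left_mono[OF this D_bound(1)]]
      show ?thesis by (simp add: tempered_diff[OF T_tempered F_schwartz F_schwartz] mult.assoc)
    qed
  qed
qed

lemma tempered_family_continuous:
  assumes "tempered T" "schwartz_family F"
  shows "continuous_on UNIV (\<lambda>z. T (F z))"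
  using tempered_family_bounds[OF assms] poly_lipschitz_imp_continuous[of "\<lambda>z. T (F z)"] by metis

lemma tempered_family_measurable:
  fixes F :: "'b::euclidean_space \<Rightarrow> 'a::euclidean_space \<Rightarrow> complex"
  assumes "tempered T" "schwartz_family F"
  shows "(\<lambda>z. T (F z)) \<in> borel_measurable borel"
  by (intro borel_measurable_continuous_onI tempered_family_continuous assms)

text \<open>The bound on \<open>s\<close> is the one available for simple functions approximating the identity.\<close>

lemma integrable_family_reparametrised:
  fixes F :: "'b::euclidean_space \<Rightarrow> 'a::euclidean_space \<Rightarrow> complex"
  assumes w_rapid: "rapidly_integrable w" and F_family: "schwartz_family F"
    and s_measurable: "s \<in> borel_measurable borel" and s_le: "\<And>z. norm (s z) \<le> 2 * norm z"
  shows "integrable_family lborel (\<lambda>z y. w z * F (s z) y)"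
  unfolding integrable_family_def dominated_family_def
proof (intro conjI ballI allI)
  note F_schwartz = schwartz_family_schwartz[OF F_family]
  show "schwartz (\<lambda>y. w z * F (s z) y)" for z by (intro schwartz_cmult F_schwartz)
  fix bs :: "'a list" assume bs: "bs \<in> lists Basis"
  note pderivs_lipschitz = schwartz_family_pderivs[OF F_family bs]
  show "(\<lambda>z. pderivs bs (\<lambda>y. w z * F (s z) y) y) \<in> borel_measurable lborel" for y
    using measurable_compose[OF s_measurable
      borel_measurable_continuous_onI[OF poly_lipschitz_continuous[OF pderivs_lipschitz, of y]]]
      rapidly_integrable_measurable[OF w_rapid]
    unfolding pderivs_cmult[OF bs F_schwartz] by simp
  fix k
  obtain C K where bound: "poly_lipschitz_bound k C K (\<lambda>z. pderivs bs (F z))"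
    using pderivs_lipschitz unfolding poly_lipschitz_def by blast
  have "weight y ^ k * norm (w z * pderivs bs (F (s z)) y)
      \<le> (C * 2 ^ K) * (weight z ^ K * norm (w z))" for z y
  proof -
    have "weight y ^ k * norm (pderivs bs (F (s z)) y) \<le> C * weight (s z) ^ K"
      by (rule poly_lipschitz_bound_growth[OF bound])
    also have "\<dots> \<le> C * (2 * weight z) ^ K"
      using s_le[of z] poly_lipschitz_bound_nonneg[OF bound]
      by (intro mult_left_mono power_mono) auto
    finally have "norm (w z) * (weight y ^ k * norm (pderivs bs (F (s z)) y))
        \<le> norm (w z) * (C * (2 * weight z) ^ K)"
      by (intro mult_left_mono) auto
    then show ?thesis unfolding power_mult_distrib by (simp add: norm_mult mult_ac)
  qed
  moreover have "integrable lborel (\<lambda>z. (C * 2 ^ K) * (weight z ^ K * norm (w z)))"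
    by (intro integrable_mult_right rapidly_integrable_weight w_rapid)
  ultimately show "\<exists>H. integrable lborel H \<and>
      (\<forall>z y. weight y ^ k * norm (pderivs bs (\<lambda>y. w z * F (s z) y) y) \<le> H z)"
    unfolding pderivs_cmult[OF bs F_schwartz] by blast
qed

lemma integrable_family_weighted:
  fixes F :: "'b::euclidean_space \<Rightarrow> 'a::euclidean_space \<Rightarrow> complex"
  assumes "rapidly_integrable w" "schwartz_family F"
  shows "integrable_family lborel (\<lambda>z y. w z * F z y)"
  using integrable_family_reparametrised[OF assms, of "\<lambda>z. z"] by simp

lemma schwartz_weighted_integral:
  fixes F :: "'b::euclidean_space \<Rightarrow> 'a::euclidean_space \<Rightarrow> complex"
  assumes "rapidly_integrable w" "schwartz_family F"
  shows "schwartz (\<lambda>y. \<integral>z. w z * F z y \<partial>lborel)"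
  by (intro schwartz_integral integrable_family_weighted assms)

lemma integral_mult_simple_function:
  fixes w :: "'b \<Rightarrow> complex"
  assumes w_integrable: "integrable M w" and s_simple: "simple_function M s"
    and space_UNIV: "space M = UNIV"
  shows "(\<integral>z. w z * g (s z) \<partial>M) = (\<Sum>v\<in>range s. (\<integral>z. indicator (s -` {v}) z * w z \<partial>M) * g v)"
proof -
  have finite_range: "finite (range s)" using s_simple space_UNIV by (simp add: simple_function_def)
  have "integrable M (\<lambda>z. indicator (s -` {v}) z *\<^sub>R w z)" for v
    using simple_functionD(2)[OF s_simple, of "{v}"] space_UNIV
    by (intro integrable_mult_indicator w_integrable) simp
  then have "integrable M (\<lambda>z. indicator (s -` {v}) z * w z)" for v
    by (rule Bochner_Integration.integrable_cong[THEN iffD1, rotated -1]) (auto simp: indicator_def)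
  moreover have "w z * g (s z) = (\<Sum>v\<in>range s. (indicator (s -` {v}) z * w z) * g v)" for z
  proof -
    have "(\<Sum>v\<in>range s. (indicator (s -` {v}) z * w z) * g v)
        = (\<Sum>v\<in>range s. if v = s z then w z * g v else 0)"
      by (intro sum.cong) auto
    then show ?thesis using finite_range by simp
  qed
  ultimately show ?thesis by simp
qed

lemma tempered_integral_simple_function:
  assumes T_tempered: "tempered T" and F_schwartz: "\<And>v. schwartz (F v)"
    and w_integrable: "integrable M w" and s_simple: "simple_function M s"
    and space_UNIV: "space M = UNIV"
  shows "T (\<lambda>y. \<integral>z. w z * F (s z) y \<partial>M) = (\<integral>z. w z * T (F (s z)) \<partial>M)"
proof -
  let ?c = "\<lambda>v. \<integral>z. indicator (s -` {v}) z * w z \<partial>M"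
  have finite_range: "finite (range s)" using s_simple space_UNIV by (simp add: simple_function_def)
  have "T (\<lambda>y. \<integral>z. w z * F (s z) y \<partial>M) = T (\<lambda>y. \<Sum>v\<in>range s. ?c v * F v y)"
    by (subst integral_mult_simple_function[OF w_integrable s_simple space_UNIV]) (rule refl)
  also have "\<dots> = (\<Sum>v\<in>range s. ?c v * T (F v))"
    by (simp add: tempered_sum[OF T_tempered finite_range] schwartz_cmult F_schwartz
      tempered_cmult[OF T_tempered])
  also have "\<dots> = (\<integral>z. w z * T (F (s z)) \<partial>M)"
    by (rule integral_mult_simple_function[OF w_integrable s_simple space_UNIV, symmetric])
  finally show ?thesis .
qed

definition lipschitz_error :: "('b::euclidean_space \<Rightarrow> complex) \<Rightarrow> nat \<Rightarrow> ('b \<Rightarrow> 'b) \<Rightarrow> 'b \<Rightarrow> real" where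
  "lipschitz_error w K s z = norm (w z) * (norm (s z - z) * (1 + norm (s z) + norm z) ^ K)"

lemma lipschitz_error_measurable [measurable]:
  assumes [measurable]: "w \<in> borel_measurable borel" "s \<in> borel_measurable borel"
  shows "lipschitz_error w K s \<in> borel_measurable borel"
  unfolding lipschitz_error_def[abs_def] by measurable

lemma lipschitz_error_le:
  assumes s_le: "\<And>z. norm (s z) \<le> 2 * norm z"
  shows "norm (lipschitz_error w K s z) \<le> 3 ^ Suc K * (weight z ^ Suc K * norm (w z))"
proof -
  have "norm (s z - z) \<le> 3 * weight z"
    using norm_triangle_ineq4[of "s z" z] s_le[of z] norm_ge_zero[of z]
    unfolding distrib_left by simp
  moreover have "(1 + norm (s z) + norm z) ^ K \<le> (3 * weight z) ^ K"
    using s_le[of z] by (intro power_mono) auto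
  ultimately have "lipschitz_error w K s z \<le> norm (w z) * (3 * weight z * (3 * weight z) ^ K)"
    unfolding lipschitz_error_def by (intro mult_left_mono mult_mono) auto
  also have "\<dots> = 3 ^ Suc K * (weight z ^ Suc K * norm (w z))"
    by (simp only: power_mult_distrib power_Suc mult_ac)
  finally show ?thesis by (simp add: lipschitz_error_def)
qed

lemma lipschitz_error_integrable:
  assumes w_rapid: "rapidly_integrable w" and s_measurable: "s \<in> borel_measurable borel"
    and s_le: "\<And>z. norm (s z) \<le> 2 * norm z"
  shows "integrable lborel (lipschitz_error w K s)"
proof (rule Bochner_Integration.integrable_bound)
  show "integrable lborel (\<lambda>z. 3 ^ Suc K * (weight z ^ Suc K * norm (w z)))"
    by (intro integrable_mult_right rapidly_integrable_weight w_rapid)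
  show "lipschitz_error w K s \<in> borel_measurable lborel"
    using s_measurable rapidly_integrable_measurable[OF w_rapid] by simp
qed (use lipschitz_error_le[OF s_le] in \<open>auto intro!: AE_I2 order_trans[OF _ abs_ge_self]\<close>)

lemma weighted_reparametrised_diff_le:
  assumes "poly_lipschitz_bound k C K F"
  shows "weight y ^ k * norm (w z * F (s z) y - w z * F z y) \<le> C * lipschitz_error w K s z"
proof -
  have "weight y ^ k * norm (w z * F (s z) y - w z * F z y)
      = norm (w z) * (weight y ^ k * norm (F (s z) y - F z y))"
    unfolding right_diff_distrib[symmetric] norm_mult by (simp add: mult_ac)
  also have "\<dots> \<le> norm (w z) * (C * norm (s z - z) * (1 + norm (s z) + norm z) ^ K)"
    by (intro mult_left_mono poly_lipschitz_bound_diff[OF assms]) simp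
  finally show ?thesis by (simp add: lipschitz_error_def mult_ac)
qed

lemma integral_lipschitz_error_tendsto_0:
  assumes w_rapid: "rapidly_integrable w" and s_measurable: "\<And>n. s n \<in> borel_measurable borel"
    and s_le: "\<And>n z. norm (s n z) \<le> 2 * norm z" and lim: "\<And>z. (\<lambda>n. s n z) \<longlonglongrightarrow> z"
  shows "(\<lambda>n. \<integral>z. lipschitz_error w K (s n) z \<partial>lborel) \<longlonglongrightarrow> 0"
proof -
  have "(\<lambda>n. \<integral>z. lipschitz_error w K (s n) z \<partial>lborel) \<longlonglongrightarrow> (\<integral>z. 0 \<partial>(lborel :: 'a measure))"
  proof (rule integral_dominated_convergence[
      where w="\<lambda>z. 3 ^ Suc K * (weight z ^ Suc K * norm (w z))"])
    show "integrable lborel (\<lambda>z. 3 ^ Suc K * (weight z ^ Suc K * norm (w z)))"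
      by (intro integrable_mult_right rapidly_integrable_weight w_rapid)
    show "AE z in lborel. (\<lambda>n. lipschitz_error w K (s n) z) \<longlonglongrightarrow> 0"
    proof (rule AE_I2)
      fix z :: 'a
      have "(\<lambda>n. lipschitz_error w K (s n) z)
          \<longlonglongrightarrow> norm (w z) * (norm (z - z) * (1 + norm z + norm z) ^ K)"
        unfolding lipschitz_error_def by (intro tendsto_intros lim)
      then show "(\<lambda>n. lipschitz_error w K (s n) z) \<longlonglongrightarrow> 0" by simp
    qed
    show "AE z in lborel. norm (lipschitz_error w K (s n) z)
        \<le> 3 ^ Suc K * (weight z ^ Suc K * norm (w z))" for n
      by (rule AE_I2) (rule lipschitz_error_le[OF s_le])
  qed (use s_measurable rapidly_integrable_measurable[OF w_rapid] in simp_all)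
  then show ?thesis by simp
qed

lemma schwartz_norm_reparametrised_diff_le:
  fixes F :: "'b::euclidean_space \<Rightarrow> 'a::euclidean_space \<Rightarrow> complex"
  assumes w_rapid: "rapidly_integrable w" and F_family: "schwartz_family F"
    and s_bounded: "s \<in> borel_measurable borel" "\<And>z. norm (s z) \<le> 2 * norm z"
    and bound: "\<And>bs. bs \<in> multi_indices M \<Longrightarrow> poly_lipschitz_bound M C K (\<lambda>z. pderivs bs (F z))"
  shows "schwartz_norm M (\<lambda>y. (\<integral>z. w z * F (s z) y \<partial>lborel) - (\<integral>z. w z * F z y \<partial>lborel))
    \<le> num_seminorms TYPE('a) M * (C * (\<integral>z. lipschitz_error w K s z \<partial>lborel))"
proof (rule schwartz_norm_le)
  fix bs :: "'a list" and y :: 'a assume bs_M: "bs \<in> multi_indices M"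
  then have bs: "bs \<in> lists Basis" by (rule multi_indices_subset)
  note F_schwartz = schwartz_family_schwartz[OF F_family]
  note families = integrable_family_reparametrised[OF w_rapid F_family s_bounded]
    integrable_family_weighted[OF w_rapid F_family]
  let ?f = "\<lambda>z. w z * pderivs bs (F (s z)) y"
  let ?g = "\<lambda>z. w z * pderivs bs (F z) y"
  have integrable: "integrable lborel ?f" "integrable lborel ?g"
    using integrable_family_pderivs_integrable[OF families(1) bs, of y]
      integrable_family_pderivs_integrable[OF families(2) bs, of y]
    by (simp_all only: pderivs_cmult[OF bs F_schwartz])
  have "pderivs bs (\<lambda>y. (\<integral>z. w z * F (s z) y \<partial>lborel) - (\<integral>z. w z * F z y \<partial>lborel)) y
      = (\<integral>z. ?f z - ?g z \<partial>lborel)"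
    using integrable
    by (simp only: pderivs_diff[OF bs schwartz_integral schwartz_integral, OF families]
      pderivs_integral[OF families(1) bs] pderivs_integral[OF families(2) bs]
      pderivs_cmult[OF bs F_schwartz] Bochner_Integration.integral_diff)
  moreover have "weight y ^ M * norm (\<integral>z. ?f z - ?g z \<partial>lborel)
      \<le> (\<integral>z. C * lipschitz_error w K s z \<partial>lborel)"
  proof (rule weighted_norm_integral_le)
    show "weight y ^ M * norm (?f z - ?g z) \<le> C * lipschitz_error w K s z" for z
      by (rule weighted_reparametrised_diff_le[OF bound[OF bs_M]])
    show "integrable lborel (\<lambda>z. C * lipschitz_error w K s z)"
      by (intro integrable_mult_right lipschitz_error_integrable w_rapid s_bounded)
  qed (use integrable in simp)
  ultimately show "weight y ^ M
      * norm (pderivs bs (\<lambda>y. (\<integral>z. w z * F (s z) y \<partial>lborel) - (\<integral>z. w z * F z y \<partial>lborel)) y)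
      \<le> C * (\<integral>z. lipschitz_error w K s z \<partial>lborel)"
    by simp
qed

lemma tempered_reparametrised_tendsto:
  fixes F :: "'b::euclidean_space \<Rightarrow> 'a::euclidean_space \<Rightarrow> complex"
  assumes T_tempered: "tempered T" and w_rapid: "rapidly_integrable w"
    and F_family: "schwartz_family F"
    and s_approx: "\<And>n. s n \<in> borel_measurable borel" "\<And>n z. norm (s n z) \<le> 2 * norm z"
      "\<And>z. (\<lambda>n. s n z) \<longlonglongrightarrow> z"
  shows "(\<lambda>n. T (\<lambda>y. \<integral>z. w z * F (s n z) y \<partial>lborel)) \<longlonglongrightarrow> T (\<lambda>y. \<integral>z. w z * F z y \<partial>lborel)"
proof -
  let ?u = "\<lambda>n y. \<integral>z. w z * F (s n z) y \<partial>lborel" and ?f = "\<lambda>y. \<integral>z. w z * F z y \<partial>lborel"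
  have integrals_schwartz: "schwartz (?u n)" "schwartz ?f" for n
    by (intro schwartz_integral integrable_family_reparametrised integrable_family_weighted w_rapid
      F_family s_approx)+
  obtain D M where D_bound: "0 \<le> D" "\<And>f. schwartz f \<Longrightarrow> norm (T f) \<le> D * schwartz_norm M f"
    using tempered_bound[OF T_tempered] by blast
  obtain C K where bound: "\<And>bs. bs \<in> multi_indices M \<Longrightarrow>
      poly_lipschitz_bound M C K (\<lambda>z. pderivs bs (F z))"
    using schwartz_family_common_bound[OF F_family] by blast
  have "(\<lambda>n. T (?u n) - T ?f) \<longlonglongrightarrow> 0"
  proof (rule Lim_null_comparison[OF always_eventually[OF allI]])
    show "norm (T (?u n) - T ?f)
        \<le> D * (num_seminorms TYPE('a) M * (C * (\<integral>z. lipschitz_error w K (s n) z \<partial>lborel)))" for n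
      unfolding tempered_diff[OF T_tempered integrals_schwartz, symmetric]
      by (intro order_trans[OF D_bound(2)[OF schwartz_diff[OF integrals_schwartz]]]
        mult_left_mono schwartz_norm_reparametrised_diff_le D_bound(1) w_rapid F_family s_approx
        bound)
    show "(\<lambda>n. D * (num_seminorms TYPE('a) M *
        (C * (\<integral>z. lipschitz_error w K (s n) z \<partial>lborel)))) \<longlonglongrightarrow> 0"
      by (intro tendsto_mult_right_zero integral_lipschitz_error_tendsto_0 w_rapid s_approx)
  qed
  then show ?thesis by (rule LIM_zero_cancel)
qed

lemma integral_reparametrised_tendsto:
  assumes w_rapid: "rapidly_integrable w" and g_measurable: "g \<in> borel_measurable borel"
    and growth: "\<And>z. norm (g z) \<le> C * weight z ^ K"
    and lip: "\<And>z v. norm (g z - g v) \<le> C * norm (z - v) * (1 + norm z + norm v) ^ K"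
    and s_approx: "\<And>n. s n \<in> borel_measurable borel" "\<And>n z. norm (s n z) \<le> 2 * norm z"
      "\<And>z. (\<lambda>n. s n z) \<longlonglongrightarrow> z"
  shows "(\<lambda>n. \<integral>z. w z * g (s n z) \<partial>lborel) \<longlonglongrightarrow> (\<integral>z. w z * g z \<partial>lborel)"
proof -
  have bound: "norm (w z * (g (s n z) - g z)) \<le> C * lipschitz_error w K (s n) z" for n z
    using mult_left_mono[OF lip[of "s n z" z], of "norm (w z)"]
    by (simp add: norm_mult lipschitz_error_def mult_ac)
  have error_integrable: "integrable lborel (\<lambda>z. C * lipschitz_error w K (s n) z)" for n
    by (intro integrable_mult_right lipschitz_error_integrable w_rapid s_approx)
  have diff_integrable: "integrable lborel (\<lambda>z. w z * (g (s n z) - g z))" for n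
  proof (rule Bochner_Integration.integrable_bound[OF error_integrable])
    show "(\<lambda>z. w z * (g (s n z) - g z)) \<in> borel_measurable lborel"
      using measurable_compose[OF s_approx(1) g_measurable] g_measurable
        rapidly_integrable_measurable[OF w_rapid] by simp
  qed (use bound in \<open>auto intro!: AE_I2 order_trans[OF _ abs_ge_self]\<close>)
  have "(\<lambda>n. \<integral>z. w z * (g (s n z) - g z) \<partial>lborel) \<longlonglongrightarrow> 0"
  proof (rule Lim_null_comparison[OF always_eventually[OF allI]])
    show "norm (\<integral>z. w z * (g (s n z) - g z) \<partial>lborel)
        \<le> C * (\<integral>z. lipschitz_error w K (s n) z \<partial>lborel)" for n
      using Bochner_Integration.integral_norm_bound_integral[OF diff_integrable error_integrable bound]
      by simp
    show "(\<lambda>n. C * (\<integral>z. lipschitz_error w K (s n) z \<partial>lborel)) \<longlonglongrightarrow> 0"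
      by (intro tendsto_mult_right_zero integral_lipschitz_error_tendsto_0 w_rapid s_approx)
  qed
  from tendsto_add[OF this tendsto_const] show ?thesis
    using Bochner_Integration.integral_add[OF diff_integrable
      rapidly_integrable_mult[OF w_rapid g_measurable growth]]
    by (simp add: right_diff_distrib)
qed

lemma tempered_integral_exchange:
  fixes F :: "'b::euclidean_space \<Rightarrow> 'a::euclidean_space \<Rightarrow> complex"
  assumes T_tempered: "tempered T" and w_rapid: "rapidly_integrable w"
    and F_family: "schwartz_family F"
  shows "T (\<lambda>y. \<integral>z. w z * F z y \<partial>lborel) = (\<integral>z. w z * T (F z) \<partial>lborel)"
proof -
  obtain s :: "nat \<Rightarrow> 'b \<Rightarrow> 'b" where simple: "\<And>n. simple_function lborel (s n)"
    and lim: "\<And>z. (\<lambda>n. s n z) \<longlonglongrightarrow> z" and s_le: "\<And>n z. norm (s n z) \<le> 2 * norm z"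
    using borel_measurable_implies_sequence_metric[of "\<lambda>z::'b. z" lborel 0] by auto
  have s_measurable: "s n \<in> borel_measurable borel" for n
    using borel_measurable_simple_function[OF simple[of n]] by simp
  obtain C K where "0 \<le> C" and growth: "\<And>z. norm (T (F z)) \<le> C * weight z ^ K"
    and lip: "\<And>z v. norm (T (F z) - T (F v)) \<le> C * norm (z - v) * (1 + norm z + norm v) ^ K"
    using tempered_family_bounds[OF T_tempered F_family] by metis
  have "(\<lambda>n. \<integral>z. w z * T (F (s n z)) \<partial>lborel) \<longlonglongrightarrow> (\<integral>z. w z * T (F z) \<partial>lborel)"
    by (rule integral_reparametrised_tendsto[OF w_rapid
      tempered_family_measurable[OF T_tempered F_family] growth lip s_measurable s_le lim])
  moreover have "T (\<lambda>y. \<integral>z. w z * F (s n z) y \<partial>lborel) = (\<integral>z. w z * T (F (s n z)) \<partial>lborel)" for n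
    by (intro tempered_integral_simple_function T_tempered schwartz_family_schwartz[OF F_family]
      rapidly_integrable_integrable w_rapid simple) simp
  ultimately show ?thesis
    using tempered_reparametrised_tendsto[OF T_tempered w_rapid F_family s_measurable s_le lim]
      LIMSEQ_unique by simp
qed

section \<open>Families of translates and modulates\<close>

lemma poly_lipschitzI:
  assumes growth: "\<And>k. \<exists>C K. \<forall>z y. weight y ^ k * norm (F z y) \<le> C * weight z ^ K"
    and diff: "\<And>k. \<exists>C K. \<forall>z v y.
      weight y ^ k * norm (F z y - F v y) \<le> C * norm (z - v) * (1 + norm z + norm v) ^ K"
  shows "poly_lipschitz F"
  unfolding poly_lipschitz_def
proof
  fix k
  obtain C K where C_bound: "\<And>z y. weight y ^ k * norm (F z y) \<le> C * weight z ^ K"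
    using growth by blast
  obtain D L where D_bound:
    "\<And>z v y. weight y ^ k * norm (F z y - F v y) \<le> D * norm (z - v) * (1 + norm z + norm v) ^ L"
    using diff by blast
  have "weight y ^ k * norm (F z y) \<le> (\<bar>C\<bar> + \<bar>D\<bar>) * weight z ^ (K + L)" for z y
    by (rule order_trans[OF C_bound]) (intro mult_mono power_increasing; simp)
  moreover have "weight y ^ k * norm (F z y - F v y)
      \<le> (\<bar>C\<bar> + \<bar>D\<bar>) * norm (z - v) * (1 + norm z + norm v) ^ (K + L)" for z v y
    by (rule order_trans[OF D_bound]) (intro mult_mono power_increasing; simp)
  ultimately have "poly_lipschitz_bound k (\<bar>C\<bar> + \<bar>D\<bar>) (K + L) F"
    unfolding poly_lipschitz_bound_def by simp
  then show "\<exists>C K. poly_lipschitz_bound k C K F" by blast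
qed

lemma poly_lipschitz_add:
  assumes "poly_lipschitz F" "poly_lipschitz G"
  shows "poly_lipschitz (\<lambda>z y. F z y + G z y)"
proof -
  have common: "\<exists>C K. poly_lipschitz_bound k C K F \<and> poly_lipschitz_bound k C K G" for k
    using poly_lipschitz_common_bound[of "{F, G}" "\<lambda>F. F" k] assms by auto
  have triangle: "weight y ^ k * norm (a + b) \<le> weight y ^ k * norm a + weight y ^ k * norm b"
    for y :: 'b and k and a b :: complex
    unfolding distrib_left[symmetric] by (intro mult_left_mono norm_triangle_ineq) auto
  show ?thesis
  proof (rule poly_lipschitzI)
    fix k
    obtain C K where F_lipschitz: "poly_lipschitz_bound k C K F"
      and G_lipschitz: "poly_lipschitz_bound k C K G"
      using common by blast
    have "weight y ^ k * norm (F z y + G z y) \<le> (2 * C) * weight z ^ K" for z y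
      using triangle[of y k "F z y" "G z y"] poly_lipschitz_bound_growth[OF F_lipschitz, of y z]
        poly_lipschitz_bound_growth[OF G_lipschitz, of y z] by (simp only: mult_2 distrib_right)
    then show "\<exists>C K. \<forall>z y. weight y ^ k * norm (F z y + G z y) \<le> C * weight z ^ K" by blast
    have "weight y ^ k * norm (F z y + G z y - (F v y + G v y))
        \<le> (2 * C) * norm (z - v) * (1 + norm z + norm v) ^ K" for z v y
      using triangle[of y k "F z y - F v y" "G z y - G v y"]
        poly_lipschitz_bound_diff[OF F_lipschitz, of y z v]
        poly_lipschitz_bound_diff[OF G_lipschitz, of y z v] by (simp add: add_diff_add)
    then show "\<exists>C K. \<forall>z v y. weight y ^ k * norm (F z y + G z y - (F v y + G v y))
        \<le> C * norm (z - v) * (1 + norm z + norm v) ^ K" by blast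
  qed
qed

lemma
  assumes bound: "poly_lipschitz_bound k C K F"
    and nonexpansive: "\<And>z v. norm (g z - g v) \<le> norm (z - v)" and "g 0 = 0"
  shows poly_lipschitz_bound_mult_growth:
      "weight y ^ k * norm (g z * F z y) \<le> C * weight z ^ Suc K"
    and poly_lipschitz_bound_mult_diff:
      "weight y ^ k * norm (g z * F z y - g v * F v y)
        \<le> C * norm (z - v) * (1 + norm z + norm v) ^ Suc K"
proof -
  note C_nonneg = poly_lipschitz_bound_nonneg[OF bound]
  have norm_g_le: "norm (g z) \<le> norm z" for z using nonexpansive[of z 0] \<open>g 0 = 0\<close> by simp
  have "norm (g z) * (weight y ^ k * norm (F z y)) \<le> weight z * (C * weight z ^ K)"
    using norm_g_le[of z] by (intro mult_mono poly_lipschitz_bound_growth[OF bound]) auto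
  then show "weight y ^ k * norm (g z * F z y) \<le> C * weight z ^ Suc K"
    by (simp add: norm_mult mult_ac)
  let ?r = "1 + norm z + norm v"
  have growth: "weight y ^ k * norm (F z y) \<le> C * ?r ^ K"
    using C_nonneg
    by (intro order_trans[OF poly_lipschitz_bound_growth[OF bound]] mult_left_mono power_mono) auto
  have "g z * F z y - g v * F v y = (g z - g v) * F z y + g v * (F z y - F v y)"
    by (simp add: algebra_simps)
  then have "norm (g z * F z y - g v * F v y)
      \<le> norm (g z - g v) * norm (F z y) + norm (g v) * norm (F z y - F v y)"
    using norm_triangle_ineq[of "(g z - g v) * F z y" "g v * (F z y - F v y)"]
    by (simp add: norm_mult)
  then have "weight y ^ k * norm (g z * F z y - g v * F v y)
      \<le> weight y ^ k * (norm (g z - g v) * norm (F z y) + norm (g v) * norm (F z y - F v y))"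
    by (intro mult_left_mono) auto
  also have "\<dots> = norm (g z - g v) * (weight y ^ k * norm (F z y))
      + norm (g v) * (weight y ^ k * norm (F z y - F v y))"
    by (simp add: algebra_simps)
  also have "\<dots> \<le> norm (z - v) * (C * ?r ^ K) + norm v * (C * norm (z - v) * ?r ^ K)"
    by (intro add_mono mult_mono[OF nonexpansive growth]
      mult_mono[OF norm_g_le poly_lipschitz_bound_diff[OF bound]]) auto
  also have "\<dots> = C * norm (z - v) * ?r ^ K * weight v" by (simp add: algebra_simps)
  also have "\<dots> \<le> C * norm (z - v) * ?r ^ K * ?r" using C_nonneg by (intro mult_left_mono) auto
  finally show "weight y ^ k * norm (g z * F z y - g v * F v y) \<le> C * norm (z - v) * ?r ^ Suc K"
    by (simp add: mult_ac)
qed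

lemma poly_lipschitz_mult_nonexpansive:
  assumes F_lipschitz: "poly_lipschitz F"
    and nonexpansive: "\<And>z v. norm (g z - g v) \<le> norm (z - v)" and "g 0 = 0"
  shows "poly_lipschitz (\<lambda>z y. g z * F z y)"
proof (rule poly_lipschitzI)
  fix k
  obtain C K where "poly_lipschitz_bound k C K F"
    using F_lipschitz unfolding poly_lipschitz_def by blast
  note bounds = poly_lipschitz_bound_mult_growth[OF this nonexpansive \<open>g 0 = 0\<close>]
    poly_lipschitz_bound_mult_diff[OF this nonexpansive \<open>g 0 = 0\<close>]
  show "\<exists>C K. \<forall>z y. weight y ^ k * norm (g z * F z y) \<le> C * weight z ^ K"
    using bounds(1) by (intro exI allI)
  show "\<exists>C K. \<forall>z v y. weight y ^ k * norm (g z * F z y - g v * F v y)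
      \<le> C * norm (z - v) * (1 + norm z + norm v) ^ K"
    using bounds(2) by (intro exI allI)
qed

lemma increment_bound_along_basis:
  fixes f :: "'a::euclidean_space \<Rightarrow> 'b::real_normed_vector"
  assumes A_Basis: "finite A" "A \<subseteq> Basis" and deriv: "\<And>b. b \<in> Basis \<Longrightarrow> has_dirderiv b f (f' b)"
    and bound: "\<And>b w. b \<in> Basis \<Longrightarrow> norm w \<le> R \<Longrightarrow> norm (f' b (x + w)) \<le> B"
    and sum_le_R: "(\<Sum>b\<in>A. \<bar>h \<bullet> b\<bar>) \<le> R"
  shows "norm (f (x + (\<Sum>b\<in>A. (h \<bullet> b) *\<^sub>R b)) - f x) \<le> B * (\<Sum>b\<in>A. \<bar>h \<bullet> b\<bar>)"
  using A_Basis sum_le_R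
proof (induction A rule: finite_induct)
  case (insert c A)
  let ?v = "\<Sum>b\<in>A. (h \<bullet> b) *\<^sub>R b"
  have c_Basis: "c \<in> Basis" using insert by simp
  have sum_le_R: "(\<Sum>b\<in>A. \<bar>h \<bullet> b\<bar>) + \<bar>h \<bullet> c\<bar> \<le> R" using insert by simp
  have norm_v_le: "norm ?v \<le> (\<Sum>b\<in>A. \<bar>h \<bullet> b\<bar>)"
    by (rule order_trans[OF norm_sum]) (use insert in \<open>auto intro!: sum_mono\<close>)
  have "norm (f (x + ?v + (h \<bullet> c) *\<^sub>R c) - f (x + ?v)) \<le> B * \<bar>h \<bullet> c\<bar>"
  proof (rule has_dirderiv_increment_bound[OF deriv[OF c_Basis]])
    fix t assume t_le: "\<bar>t\<bar> \<le> \<bar>h \<bullet> c\<bar>"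
    have "norm (?v + t *\<^sub>R c) \<le> norm ?v + \<bar>t\<bar>"
      using norm_triangle_ineq[of ?v "t *\<^sub>R c"] c_Basis by simp
    then have "norm (?v + t *\<^sub>R c) \<le> R" using norm_v_le sum_le_R t_le by linarith
    then show "norm (f' c (x + ?v + t *\<^sub>R c)) \<le> B" using bound[OF c_Basis] by (simp add: add.assoc)
  qed
  moreover have "norm (f (x + ?v) - f x) \<le> B * (\<Sum>b\<in>A. \<bar>h \<bullet> b\<bar>)"
    using insert by (intro insert.IH) auto
  moreover have point_eq: "x + (\<Sum>b\<in>insert c A. (h \<bullet> b) *\<^sub>R b) = x + ?v + (h \<bullet> c) *\<^sub>R c"
    and sum_eq: "(\<Sum>b\<in>insert c A. \<bar>h \<bullet> b\<bar>) = \<bar>h \<bullet> c\<bar> + (\<Sum>b\<in>A. \<bar>h \<bullet> b\<bar>)"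
    using insert by (simp_all add: add_ac)
  ultimately show ?case unfolding point_eq sum_eq
    using norm_triangle_ineq[of "f (x + ?v + (h \<bullet> c) *\<^sub>R c) - f (x + ?v)" "f (x + ?v) - f x"]
    by (simp add: distrib_left)
qed simp

lemma increment_bound:
  fixes f :: "'a::euclidean_space \<Rightarrow> 'b::real_normed_vector"
  assumes deriv: "\<And>b. b \<in> Basis \<Longrightarrow> has_dirderiv b f (f' b)" and "0 \<le> B"
    and bound: "\<And>b w. b \<in> Basis \<Longrightarrow> norm w \<le> real DIM('a) * norm h \<Longrightarrow> norm (f' b (x + w)) \<le> B"
  shows "norm (f (x + h) - f x) \<le> B * (real DIM('a) * norm h)"
proof -
  have sum_le: "(\<Sum>b\<in>Basis. \<bar>h \<bullet> b\<bar>) \<le> real DIM('a) * norm h"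
    using sum_bounded_above[of Basis "\<lambda>b. \<bar>h \<bullet> b\<bar>" "norm h"] Basis_le_norm by auto
  have "norm (f (x + (\<Sum>b\<in>Basis. (h \<bullet> b) *\<^sub>R b)) - f x) \<le> B * (\<Sum>b\<in>Basis. \<bar>h \<bullet> b\<bar>)"
    by (rule increment_bound_along_basis[OF finite_Basis subset_refl deriv bound sum_le])
  also have "\<dots> \<le> B * (real DIM('a) * norm h)" by (intro mult_left_mono sum_le \<open>0 \<le> B\<close>)
  finally show ?thesis by (simp only: euclidean_representation)
qed

lemma schwartz_weighted_increment:
  fixes f :: "'a::euclidean_space \<Rightarrow> complex"
  assumes f_schwartz: "schwartz f"
  obtains C where "0 \<le> C" "\<And>x h. weight x ^ k * norm (f (x + h) - f x) \<le> C * norm h * weight h ^ k"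
proof -
  define d where "d = real DIM('a)"
  have d_nonneg: "0 \<le> d" by (simp add: d_def)
  have "\<forall>b\<in>Basis. \<exists>D. 0 \<le> D \<and> (\<forall>x. weight x ^ k * norm (dirderiv b f x) \<le> D)"
    using schwartz_decay[OF schwartz_dirderiv[OF f_schwartz]] by metis
  then obtain D where D_nonneg: "\<And>b. b \<in> Basis \<Longrightarrow> 0 \<le> D b"
    and D_bound: "\<And>b x. b \<in> Basis \<Longrightarrow> weight x ^ k * norm (dirderiv b f x) \<le> D b" by metis
  define M where "M = (\<Sum>b\<in>Basis. D b)"
  have M_nonneg: "0 \<le> M" unfolding M_def by (intro sum_nonneg D_nonneg)
  have M_bound: "weight x ^ k * norm (dirderiv b f x) \<le> M" if "b \<in> Basis" for b x
    using D_bound[OF that, of x] member_le_sum[OF that, of D] D_nonneg unfolding M_def by fastforce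
  have increment: "norm (f (x + h) - f x)
      \<le> M * ((1 + d) * weight h) ^ k * inverse (weight x ^ k) * (d * norm h)"
    for x h
    unfolding d_def
  proof (rule increment_bound[OF schwartz_has_dirderiv[OF f_schwartz]], unfold d_def[symmetric])
    show "0 \<le> M * ((1 + d) * weight h) ^ k * inverse (weight x ^ k)" using M_nonneg d_nonneg by simp
    fix b w :: 'a assume b_Basis: "b \<in> Basis" and norm_w_le: "norm w \<le> d * norm h"
    have "weight x ^ k * norm (dirderiv b f (x + w)) \<le> weight (- w) ^ k * M"
      by (rule weighted_translate_le) (use M_bound[OF b_Basis] in simp_all)
    also have "\<dots> \<le> ((1 + d) * weight h) ^ k * M"
    proof (intro mult_right_mono power_mono M_nonneg)
      have "1 + d * norm h \<le> (1 + d) * weight h" using d_nonneg by (simp add: algebra_simps)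
      then show "weight (- w) \<le> (1 + d) * weight h" using norm_w_le by simp
    qed simp
    finally show
      "norm (dirderiv b f (x + w)) \<le> M * ((1 + d) * weight h) ^ k * inverse (weight x ^ k)"
      unfolding weight_power_mult_le_iff by (simp add: mult_ac)
  qed
  have "weight x ^ k * norm (f (x + h) - f x) \<le> (M * (1 + d) ^ k * d) * norm h * weight h ^ k"
    for x h
    unfolding weight_power_mult_le_iff using increment[of x h] unfolding power_mult_distrib
    by (simp add: mult_ac)
  then show ?thesis using M_nonneg d_nonneg by (intro that[of "M * (1 + d) ^ k * d"]) auto
qed

lemma poly_lipschitz_translate:
  fixes f :: "'a::euclidean_space \<Rightarrow> complex"
  assumes f_schwartz: "schwartz f"
  shows "poly_lipschitz (\<lambda>x y. f (y - x))"
proof (rule poly_lipschitzI)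
  fix k
  obtain C where "\<And>x. weight x ^ k * norm (f x) \<le> C" using schwartz_decay[OF f_schwartz] by blast
  then have "weight y ^ k * norm (f (y - x)) \<le> C * weight x ^ k" for x y
    by (subst mult.commute[of C]) (rule weighted_translate_le, simp_all)
  then show "\<exists>C K. \<forall>x y. weight y ^ k * norm (f (y - x)) \<le> C * weight x ^ K" by blast
  obtain D where D_bound: "0 \<le> D"
    "\<And>x h. weight x ^ k * norm (f (x + h) - f x) \<le> D * norm h * weight h ^ k"
    using schwartz_weighted_increment[OF f_schwartz] by blast
  have "weight y ^ k * norm (f (y - x) - f (y - v))
      \<le> D * norm (x - v) * (1 + norm x + norm v) ^ (k + k)" for x v y
  proof -
    let ?r = "1 + norm x + norm v"
    have "weight (y - x) ^ k * norm (f (y - x) - f (y - v)) \<le> D * norm (x - v) * weight (x - v) ^ k"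
      using D_bound(2)[of "y - x" "x - v"] by (simp add: norm_minus_commute)
    then have "weight y ^ k * norm (f (y - x) - f (y - v))
        \<le> weight x ^ k * (D * norm (x - v) * weight (x - v) ^ k)"
      by (rule weighted_translate_le) simp
    also have "\<dots> \<le> ?r ^ k * (D * norm (x - v) * ?r ^ k)"
      using D_bound(1) norm_triangle_ineq4[of x v] by (intro mult_mono power_mono) auto
    finally show ?thesis by (simp add: power_add mult_ac)
  qed
  then show "\<exists>C K. \<forall>x v y. weight y ^ k * norm (f (y - x) - f (y - v))
      \<le> C * norm (x - v) * (1 + norm x + norm v) ^ K" by blast
qed

lemma schwartz_family_translate:
  assumes f_schwartz: "schwartz f"
  shows "schwartz_family (\<lambda>x y. f (y - x))"
proof -
  have "pderivs bs (\<lambda>y. f (y - x)) = (\<lambda>y. pderivs bs f (y - x))" for bs x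
    using pderivs_translate[of bs f "- x"] by simp
  then show ?thesis
    using schwartz_translate[OF f_schwartz, of "- _"]
      poly_lipschitz_translate[OF schwartz_pderivs[OF f_schwartz]]
    by (simp add: schwartz_family_def)
qed

lemma norm_iexp_diff_le: "norm (iexp s - iexp t) \<le> \<bar>s - t\<bar>"
proof -
  have "iexp s = iexp t * iexp (s - t)" unfolding exp_add[symmetric] by (simp add: algebra_simps)
  then have "norm (iexp s - iexp t) = norm (iexp t * (iexp (s - t) - 1))"
    by (simp add: right_diff_distrib)
  also have "\<dots> = norm (iexp (s - t) - 1)" by (simp add: norm_mult)
  also have "\<dots> \<le> \<bar>s - t\<bar>" using iexp_approx1[of "s - t" 0] by simp
  finally show ?thesis .
qed

lemma poly_lipschitz_modulate:
  fixes f :: "'a::euclidean_space \<Rightarrow> complex"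
  assumes f_schwartz: "schwartz f"
  shows "poly_lipschitz (\<lambda>z y. iexp (y \<bullet> z) * f y)"
proof (rule poly_lipschitzI)
  fix k
  obtain C where "\<And>y. weight y ^ k * norm (f y) \<le> C" using schwartz_decay[OF f_schwartz] by blast
  then have "weight y ^ k * norm (iexp (y \<bullet> z) * f y) \<le> C * weight z ^ 0" for z y
    by (simp add: norm_mult)
  then show "\<exists>C K. \<forall>z y. weight y ^ k * norm (iexp (y \<bullet> z) * f y) \<le> C * weight z ^ K" by blast
  obtain D where D_bound: "\<And>y. weight y ^ Suc k * norm (f y) \<le> D"
    using schwartz_decay[OF f_schwartz] by blast
  have "weight y ^ k * norm (iexp (y \<bullet> z) * f y - iexp (y \<bullet> v) * f y)
      \<le> D * norm (z - v) * (1 + norm z + norm v) ^ 0" for z v y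
  proof -
    have "norm (iexp (y \<bullet> z) - iexp (y \<bullet> v)) \<le> \<bar>y \<bullet> (z - v)\<bar>"
      using norm_iexp_diff_le[of "y \<bullet> z" "y \<bullet> v"] by (simp add: inner_diff_right)
    also have "\<dots> \<le> norm y * norm (z - v)" by (rule Cauchy_Schwarz_ineq2)
    also have "\<dots> \<le> weight y * norm (z - v)" by (intro mult_right_mono) auto
    finally have "(weight y ^ k * norm (f y)) * norm (iexp (y \<bullet> z) - iexp (y \<bullet> v))
        \<le> (weight y ^ k * norm (f y)) * (weight y * norm (z - v))"
      by (intro mult_left_mono) auto
    also have "\<dots> = (weight y ^ Suc k * norm (f y)) * norm (z - v)" by simp
    also have "\<dots> \<le> D * norm (z - v)" by (intro mult_right_mono D_bound) auto
    finally show ?thesis unfolding left_diff_distrib[symmetric] norm_mult by (simp add: mult_ac)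
  qed
  then show "\<exists>C K. \<forall>z v y. weight y ^ k * norm (iexp (y \<bullet> z) * f y - iexp (y \<bullet> v) * f y)
      \<le> C * norm (z - v) * (1 + norm z + norm v) ^ K" by blast
qed

text \<open>Differentiating a modulate in \<open>y\<close> produces terms of the shapes \<open>coord\<close> and \<open>add\<close>.\<close>

inductive modulated_family :: "('a::euclidean_space \<Rightarrow> 'a \<Rightarrow> complex) \<Rightarrow> bool" where
  modulate: "schwartz f \<Longrightarrow> modulated_family (\<lambda>z y. iexp (y \<bullet> z) * f y)"
| coord: "modulated_family F \<Longrightarrow> b \<in> Basis \<Longrightarrow> modulated_family (\<lambda>z y. (\<i> * of_real (z \<bullet> b)) * F z y)"
| add: "modulated_family F \<Longrightarrow> modulated_family G \<Longrightarrow> modulated_family (\<lambda>z y. F z y + G z y)"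

lemma modulated_family_poly_lipschitz: "modulated_family F \<Longrightarrow> poly_lipschitz F"
proof (induction rule: modulated_family.induct)
  case (coord F b)
  have "norm (\<i> * of_real (z \<bullet> b) - \<i> * of_real (v \<bullet> b)) \<le> norm (z - v)" for z v
    unfolding right_diff_distrib[symmetric] of_real_diff[symmetric] inner_diff_left[symmetric]
      norm_mult
    using Basis_le_norm[OF coord(2), of "z - v"] by simp
  then show ?case using coord by (intro poly_lipschitz_mult_nonexpansive) auto
qed (auto intro: poly_lipschitz_modulate poly_lipschitz_add)

lemma modulated_family_continuous: "modulated_family F \<Longrightarrow> continuous_on UNIV (F z)"
  by (induction rule: modulated_family.induct)
    (auto intro!: continuous_intros dest: schwartz_continuous)

lemma modulated_family_rapidly_decreasing:
  assumes "modulated_family F" shows "rapidly_decreasing (F z)"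
  unfolding rapidly_decreasing_def
proof
  fix k
  obtain C K where "poly_lipschitz_bound k C K F"
    using modulated_family_poly_lipschitz[OF assms] unfolding poly_lipschitz_def by blast
  then show "\<exists>C. \<forall>y. weight y ^ k * norm (F z y) \<le> C" using poly_lipschitz_bound_growth by blast
qed

lemma has_dirderiv_iexp_inner:
  "has_dirderiv b (\<lambda>y. iexp (y \<bullet> z)) (\<lambda>y. (\<i> * of_real (z \<bullet> b)) * iexp (y \<bullet> z))"
  unfolding has_dirderiv_def
proof
  fix x
  have "((\<lambda>u::complex. exp (\<i> * (of_real (x \<bullet> z) + u * of_real (z \<bullet> b)))) has_field_derivative
      (\<i> * of_real (z \<bullet> b)) * exp (\<i> * (of_real (x \<bullet> z) + of_real 0 * of_real (z \<bullet> b))))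
        (at (of_real 0))"
    by (auto intro!: derivative_eq_intros)
  from has_vector_derivative_real_field[OF this]
  show "((\<lambda>t. iexp ((x + t *\<^sub>R b) \<bullet> z)) has_vector_derivative
      (\<i> * of_real (z \<bullet> b)) * iexp (x \<bullet> z)) (at 0)"
    by (simp add: inner_add_left inner_commute[of z b])
qed

lemma modulated_family_has_dirderiv:
  assumes "modulated_family F" and b_Basis: "b \<in> Basis"
  shows "\<exists>F'. modulated_family F' \<and> (\<forall>z. has_dirderiv b (F z) (F' z))"
  using assms(1)
proof (induction rule: modulated_family.induct)
  case (modulate f)
  let ?F' = "\<lambda>z y. iexp (y \<bullet> z) * dirderiv b f y + (\<i> * of_real (z \<bullet> b)) * (iexp (y \<bullet> z) * f y)"
  have "modulated_family ?F'" by (intro modulated_family.intros modulate schwartz_dirderiv b_Basis)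
  moreover have "has_dirderiv b (\<lambda>y. iexp (y \<bullet> z) * f y) (?F' z)" for z
    using has_dirderiv_mult[OF has_dirderiv_iexp_inner schwartz_has_dirderiv[OF modulate b_Basis]]
    by (simp add: mult.assoc)
  ultimately show ?case by blast
next
  case (coord F c)
  then obtain F' where F'_dirderiv: "modulated_family F'" "\<And>z. has_dirderiv b (F z) (F' z)" by blast
  then have "modulated_family (\<lambda>z y. (\<i> * of_real (z \<bullet> c)) * F' z y)"
    using coord by (intro modulated_family.coord)
  then show ?case using has_dirderiv_cmult[OF F'_dirderiv(2)] by blast
next
  case (add F G)
  then obtain F' G' where "modulated_family F'" "\<And>z. has_dirderiv b (F z) (F' z)"
    and "modulated_family G'" "\<And>z. has_dirderiv b (G z) (G' z)" by blast
  then show ?case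
    by (intro exI[of _ "\<lambda>z y. F' z y + G' z y"]) (auto intro: modulated_family.add has_dirderiv_add)
qed

lemma modulated_family_schwartz:
  assumes "modulated_family F" shows "schwartz (F z)"
  by (rule schwartz_coinduct[where F="\<lambda>F. F z" and Q=modulated_family])
    (use assms modulated_family_continuous modulated_family_rapidly_decreasing
      modulated_family_has_dirderiv in blast)+

lemma modulated_family_pderivs:
  assumes "modulated_family F" "bs \<in> lists Basis"
  shows "modulated_family (\<lambda>z. pderivs bs (F z))"
  using assms(2)
proof (induction bs)
  case (Cons b bs)
  then obtain G where G_dirderiv: "modulated_family G" "\<And>z. has_dirderiv b (pderivs bs (F z)) (G z)"
    using modulated_family_has_dirderiv[of "\<lambda>z. pderivs bs (F z)" b] by auto
  then show ?case using has_dirderiv_imp_dirderiv_eq[OF G_dirderiv(2)] by simp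
qed (use assms(1) in simp)

lemma schwartz_family_modulate:
  assumes "schwartz f"
  shows "schwartz_family (\<lambda>z y. iexp (y \<bullet> z) * f y)"
  unfolding schwartz_family_def
  using modulated_family.modulate[OF assms] modulated_family_schwartz modulated_family_pderivs
    modulated_family_poly_lipschitz by blast

lemma schwartz_modulate: "schwartz f \<Longrightarrow> schwartz (\<lambda>y. iexp (y \<bullet> z) * f y)"
  by (rule schwartz_family_schwartz[OF schwartz_family_modulate])

section \<open>Gaussians\<close>

definition gauss :: "real \<Rightarrow> 'a::euclidean_space \<Rightarrow> 'a \<Rightarrow> complex" where
  "gauss s b x = of_real (exp (- s * (x \<bullet> x) + b \<bullet> x))"

lemma gauss_mult: "gauss s b x * gauss t c x = gauss (s + t) (b + c) x"
  unfolding gauss_def of_real_mult[symmetric] exp_add[symmetric]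
  by (simp add: algebra_simps inner_add_left)

lemma gauss_0_eq: "gauss s 0 x = of_real (exp (- s * (x \<bullet> x)))"
  by (simp add: gauss_def)

lemma gauss_measurable [measurable]: "gauss s b \<in> borel_measurable borel"
  unfolding gauss_def by measurable

lemma gauss_translate:
  "gauss s b (y - x) = of_real (exp (- s * (x \<bullet> x) - b \<bullet> x)) * gauss s (b + (2 * s) *\<^sub>R x) y"
  unfolding gauss_def of_real_mult[symmetric] exp_add[symmetric]
  by (simp add: inner_diff_left inner_diff_right inner_add_left inner_commute algebra_simps)

lemma gauss_complete_square:
  assumes "s \<noteq> 0"
  shows "gauss s b x = of_real (exp ((b \<bullet> b) / (4 * s))) * gauss s 0 (x - (1 / (2 * s)) *\<^sub>R b)"
  using gauss_translate[of s 0 x "(1 / (2 * s)) *\<^sub>R b"] assms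
  by (simp add: of_real_mult[symmetric] exp_minus power2_eq_square del: of_real_mult)

lemma power_le_fact_mult_exp:
  fixes t :: real
  assumes "0 \<le> t" shows "t ^ k \<le> fact k * exp t"
proof -
  have "t ^ k / fact k \<le> exp t"
    using sum_le_suminf[OF summable_exp_generic[of t], of "{k}"] assms
    by (simp add: exp_def divide_inverse mult.commute)
  then show ?thesis by (simp add: field_simps)
qed

lemma gauss_rapidly_decreasing:
  fixes b :: "'a::euclidean_space"
  assumes s_pos: "s > 0"
  shows "rapidly_decreasing (gauss s b)"
  unfolding rapidly_decreasing_def
proof
  fix k
  have "weight x ^ k * norm (gauss s b x) \<le> fact k * exp (1 + (weight b)\<^sup>2 / (4 * s))" for x
  proof -
    have "weight x ^ k * norm (gauss s b x)
        \<le> (fact k * exp (weight x)) * exp (- s * (x \<bullet> x) + b \<bullet> x)"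
      unfolding gauss_def using power_le_fact_mult_exp[of "weight x" k]
      by (simp add: mult_right_mono)
    also have "\<dots> = fact k * exp (weight x - s * (x \<bullet> x) + b \<bullet> x)"
      by (simp add: exp_add[symmetric] algebra_simps)
    also have "weight x - s * (x \<bullet> x) + b \<bullet> x \<le> 1 + (weight b)\<^sup>2 / (4 * s)"
    proof -
      have "0 \<le> (2 * s * norm x - weight b)\<^sup>2" by simp
      then have "weight b * norm x - s * (norm x)\<^sup>2 \<le> (weight b)\<^sup>2 / (4 * s)"
        using s_pos by (simp add: field_simps power2_eq_square)
      moreover have "b \<bullet> x \<le> norm b * norm x" by (rule norm_cauchy_schwarz)
      ultimately show ?thesis by (simp add: algebra_simps power2_norm_eq_inner)
    qed
    finally show ?thesis by simp
  qed
  then show "\<exists>C. \<forall>x. weight x ^ k * norm (gauss s b x) \<le> C" by blast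
qed

lemma rapidly_decreasing_mult_growth:
  fixes p f :: "'a::real_normed_vector \<Rightarrow> 'b::real_normed_div_algebra"
  assumes f_decreasing: "rapidly_decreasing f" and growth: "\<And>x. norm (p x) \<le> C * weight x ^ K"
    and "0 \<le> C"
  shows "rapidly_decreasing (\<lambda>x. p x * f x)"
  unfolding rapidly_decreasing_def
proof
  fix k
  obtain D where D_bound: "\<And>x. weight x ^ (k + K) * norm (f x) \<le> D"
    using f_decreasing by (metis rapidly_decreasingE)
  have "weight x ^ k * norm (p x * f x) \<le> C * D" for x
  proof -
    have "weight x ^ k * norm (p x * f x) \<le> weight x ^ k * ((C * weight x ^ K) * norm (f x))"
      unfolding norm_mult by (intro mult_left_mono mult_right_mono growth) auto
    also have "\<dots> = C * (weight x ^ (k + K) * norm (f x))" by (simp add: power_add mult_ac)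
    also have "\<dots> \<le> C * D" by (intro mult_left_mono D_bound \<open>0 \<le> C\<close>)
    finally show ?thesis .
  qed
  then show "\<exists>C. \<forall>x. weight x ^ k * norm (p x * f x) \<le> C" by blast
qed

lemma real_polynomial_growth:
  "real_polynomial_function p \<Longrightarrow> \<exists>C K. 0 \<le> C \<and> (\<forall>x. \<bar>p x\<bar> \<le> C * weight x ^ K)"
proof (induction rule: real_polynomial_function.induct)
  case (linear f)
  then obtain C where C_bound: "\<And>x. norm (f x) \<le> norm x * C" "C > 0"
    using bounded_linear.pos_bounded by blast
  have "\<bar>f x\<bar> \<le> C * weight x ^ 1" for x
    using C_bound(1)[of x] C_bound(2) by (simp add: algebra_simps)
  then show ?case using C_bound(2) less_imp_le by blast
next
  case (const c)
  have "\<bar>c\<bar> \<le> \<bar>c\<bar> * weight x ^ 0" for x :: 'a by simp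
  then show ?case using abs_ge_zero by blast
next
  case (add f g)
  then obtain C K D L where C_bound: "0 \<le> C" "\<And>x. \<bar>f x\<bar> \<le> C * weight x ^ K"
    and D_bound: "0 \<le> D" "\<And>x. \<bar>g x\<bar> \<le> D * weight x ^ L" by blast
  have "\<bar>f x + g x\<bar> \<le> (C + D) * weight x ^ (K + L)" for x
  proof -
    have "C * weight x ^ K \<le> C * weight x ^ (K + L)" "D * weight x ^ L \<le> D * weight x ^ (K + L)"
      using C_bound(1) D_bound(1) by (auto intro!: mult_left_mono power_increasing)
    then show ?thesis using C_bound(2)[of x] D_bound(2)[of x] unfolding distrib_right by linarith
  qed
  then show ?case using C_bound(1) D_bound(1) add_nonneg_nonneg by blast
next
  case (mult f g)
  then obtain C K D L where C_bound: "0 \<le> C" "\<And>x. \<bar>f x\<bar> \<le> C * weight x ^ K"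
    and D_bound: "0 \<le> D" "\<And>x. \<bar>g x\<bar> \<le> D * weight x ^ L" by blast
  have "\<bar>f x * g x\<bar> \<le> (C * D) * weight x ^ (K + L)" for x
  proof -
    have "\<bar>f x * g x\<bar> \<le> (C * weight x ^ K) * (D * weight x ^ L)"
      unfolding abs_mult using C_bound D_bound by (intro mult_mono) auto
    then show ?thesis by (simp add: power_add mult_ac)
  qed
  then show ?case using C_bound(1) D_bound(1) mult_nonneg_nonneg by blast
qed

lemma real_polynomial_has_dirderiv:
  "real_polynomial_function p \<Longrightarrow> \<exists>q. real_polynomial_function q \<and> has_dirderiv b p q"
proof (induction rule: real_polynomial_function.induct)
  case (linear f)
  then interpret bounded_linear f .
  have "has_dirderiv b f (\<lambda>_. f b)"
    unfolding has_dirderiv_def add scaleR has_real_derivative_iff_has_vector_derivative[symmetric]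
    by (auto intro!: derivative_eq_intros)
  then show ?case by (intro exI[of _ "\<lambda>_. f b"]) auto
next
  case (const c)
  have "has_dirderiv b (\<lambda>_. c) (\<lambda>_. 0)" by (simp add: has_dirderiv_def)
  then show ?case by (intro exI[of _ "\<lambda>_. 0"]) auto
next
  case (add f g)
  then obtain f' g' where "real_polynomial_function f'" "has_dirderiv b f f'"
    "real_polynomial_function g'" "has_dirderiv b g g'" by blast
  then show ?case
    by (intro exI[of _ "\<lambda>x. f' x + g' x"] conjI has_dirderiv_add real_polynomial_function.intros(3))
next
  case (mult f g)
  then obtain f' g' where "real_polynomial_function f'" "has_dirderiv b f f'"
    "real_polynomial_function g'" "has_dirderiv b g g'" by blast
  with mult.hyps show ?case
    by (intro exI[of _ "\<lambda>x. f x * g' x + f' x * g x"] conjI has_dirderiv_mult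
      real_polynomial_function.intros(3,4))
qed

lemma has_dirderiv_gauss:
  "has_dirderiv b (gauss s c) (\<lambda>x. of_real (c \<bullet> b + (-2 * s) * (x \<bullet> b)) * gauss s c x)"
proof -
  let ?e = "\<lambda>x. exp (- s * (x \<bullet> x) + c \<bullet> x)"
  have "has_dirderiv b ?e (\<lambda>x. (c \<bullet> b + (-2 * s) * (x \<bullet> b)) * ?e x)"
    unfolding has_dirderiv_def has_real_derivative_iff_has_vector_derivative[symmetric]
    by (auto intro!: derivative_eq_intros
      simp: inner_add_left inner_add_right inner_commute algebra_simps)
  from has_dirderiv_of_real[OF this] show ?thesis by (simp only: gauss_def[abs_def] of_real_mult)
qed

text \<open>Polynomial multiples of a Gaussian are closed under differentiation.\<close>

lemma schwartz_gauss:
  fixes c :: "'a::euclidean_space"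
  assumes s_pos: "s > 0"
  shows "schwartz (gauss s c)"
proof -
  have "schwartz (\<lambda>x. of_real 1 * gauss s c x)"
  proof (rule schwartz_coinduct[where F="\<lambda>p x. of_real (p x) * gauss s c x" and i="\<lambda>_. 1"])
    fix p :: "'a \<Rightarrow> real" assume p_poly: "real_polynomial_function p"
    show "continuous_on UNIV (\<lambda>x. of_real (p x) * gauss s c x)"
      unfolding gauss_def
      by (intro continuous_intros continuous_on_polymonial_function)
        (use p_poly in \<open>auto simp: real_polynomial_function_eq\<close>)
    obtain C K where "0 \<le> C" "\<And>x. \<bar>p x\<bar> \<le> C * weight x ^ K"
      using real_polynomial_growth[OF p_poly] by blast
    then show "rapidly_decreasing (\<lambda>x. of_real (p x) * gauss s c x)"
      by (intro rapidly_decreasing_mult_growth[where C=C and K=K] gauss_rapidly_decreasing s_pos)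
        auto
    fix b :: 'a
    obtain q where q_dirderiv: "real_polynomial_function q" "has_dirderiv b p q"
      using real_polynomial_has_dirderiv[OF p_poly] by blast
    let ?r = "\<lambda>x. p x * (c \<bullet> b + (-2 * s) * (x \<bullet> b)) + q x"
    have "real_polynomial_function ?r"
      by (intro real_polynomial_function.intros q_dirderiv p_poly bounded_linear_inner_left)
    moreover have
      "has_dirderiv b (\<lambda>x. of_real (p x) * gauss s c x) (\<lambda>x. of_real (?r x) * gauss s c x)"
      using has_dirderiv_mult[OF has_dirderiv_of_real[OF q_dirderiv(2)] has_dirderiv_gauss]
      by (simp only: of_real_add of_real_mult distrib_right mult.assoc)
    ultimately show "\<exists>r. real_polynomial_function r \<and>
        has_dirderiv b (\<lambda>x. of_real (p x) * gauss s c x) (\<lambda>x. of_real (r x) * gauss s c x)" by blast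
  qed (rule real_polynomial_function.intros(2))
  then show ?thesis by simp
qed

lemma lborel_integral_affine:
  fixes f :: "'a::euclidean_space \<Rightarrow> 'b::{banach, second_countable_topology}"
  assumes f_measurable: "f \<in> borel_measurable borel" and c_nonzero: "c \<noteq> 0"
  shows "(\<integral>x. f x \<partial>lborel) = \<bar>c\<bar> ^ DIM('a) *\<^sub>R (\<integral>x. f (t + c *\<^sub>R x) \<partial>lborel)"
proof -
  have "(\<integral>x. f x \<partial>lborel)
      = (\<integral>x. f x \<partial>density (distr lborel borel (\<lambda>x. t + c *\<^sub>R x)) (\<lambda>_. ennreal (\<bar>c\<bar> ^ DIM('a))))"
    using lborel_affine[OF c_nonzero, of t] by (simp add: ennreal_power)
  also have "\<dots> = (\<integral>x. \<bar>c\<bar> ^ DIM('a) *\<^sub>R f x \<partial>distr lborel borel (\<lambda>x. t + c *\<^sub>R x))"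
    using f_measurable by (subst integral_density) auto
  also have "\<dots> = (\<integral>x. \<bar>c\<bar> ^ DIM('a) *\<^sub>R f (t + c *\<^sub>R x) \<partial>lborel)"
    using f_measurable by (subst integral_distr) auto
  finally show ?thesis by simp
qed

lemma lborel_integral_translate:
  fixes f :: "'a::euclidean_space \<Rightarrow> 'b::{banach, second_countable_topology}"
  shows "f \<in> borel_measurable borel \<Longrightarrow> (\<integral>x. f (x - t) \<partial>lborel) = (\<integral>x. f x \<partial>lborel)"
  using lborel_integral_affine[of f 1 "- t"] by simp

lemma lborel_integral_reflect:
  fixes f :: "'a::euclidean_space \<Rightarrow> 'b::{banach, second_countable_topology}"
  shows "f \<in> borel_measurable borel \<Longrightarrow> (\<integral>x. f (t - x) \<partial>lborel) = (\<integral>x. f x \<partial>lborel)"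
  using lborel_integral_affine[of f "-1" t] by simp

lemma lborel_integral_scale:
  fixes f :: "'a::euclidean_space \<Rightarrow> 'b::{banach, second_countable_topology}"
  assumes "f \<in> borel_measurable borel" "c > 0"
  shows "(\<integral>x. f (c *\<^sub>R x) \<partial>lborel) = (1 / c) ^ DIM('a) *\<^sub>R (\<integral>x. f x \<partial>lborel)"
  using lborel_integral_affine[OF assms(1), of c 0] assms(2) by (simp add: power_one_over)

lemma lborel_integral_prod:
  fixes f ::
    "'a::euclidean_space \<Rightarrow> real \<Rightarrow> 'b::{real_normed_field, banach, second_countable_topology}"
  assumes f_integrable: "\<And>b. b \<in> Basis \<Longrightarrow> integrable lborel (f b)"
  shows "(\<integral>x. (\<Prod>b\<in>Basis. f b (x \<bullet> b)) \<partial>lborel) = (\<Prod>b\<in>Basis. \<integral>x. f b x \<partial>lborel)"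
proof -
  interpret product_sigma_finite "\<lambda>b::'a. lborel :: real measure" by standard
  have [measurable]: "b \<in> Basis \<Longrightarrow> f b \<in> borel_measurable borel" for b
    using borel_measurable_integrable[OF f_integrable] by simp
  have "(\<integral>x. (\<Prod>b\<in>Basis. f b (x \<bullet> b)) \<partial>lborel)
      = (\<integral>x. (\<Prod>b\<in>Basis. f b (x \<bullet> b)) \<partial>distr (\<Pi>\<^sub>M b\<in>(Basis::'a set). lborel) borel
        (\<lambda>g. \<Sum>b\<in>Basis. g b *\<^sub>R b))"
    by (rule arg_cong[OF lborel_eq, where f="\<lambda>M. \<integral>x. (\<Prod>b\<in>Basis. f b (x \<bullet> b)) \<partial>M"])
  also have "\<dots> = (\<integral>g. (\<Prod>b\<in>Basis. f b ((\<Sum>c\<in>Basis. g c *\<^sub>R c) \<bullet> b)) \<partial>(\<Pi>\<^sub>M b\<in>(Basis::'a set). lborel))"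
    by (rule integral_distr) measurable
  also have "\<dots> = (\<integral>g. (\<Prod>b\<in>Basis. f b (g b)) \<partial>(\<Pi>\<^sub>M b\<in>(Basis::'a set). lborel))"
    by (intro Bochner_Integration.integral_cong prod.cong refl) (simp add: inner_sum_left_Basis)
  also have "\<dots> = (\<Prod>b\<in>Basis. \<integral>x. f b x \<partial>lborel)"
    by (rule product_integral_prod[OF finite_Basis f_integrable])
  finally show ?thesis .
qed

lemma standard_gauss_fourier_real:
  shows "integrable lborel (\<lambda>x::real. of_real (exp (- x\<^sup>2 / 2)) * iexp (t * x))"
    and "(\<integral>x. of_real (exp (- x\<^sup>2 / 2)) * iexp (t * x) \<partial>lborel)
        = of_real (sqrt (2 * pi)) * of_real (exp (- t\<^sup>2 / 2))"
proof -
  have integrand_eq: "of_real (exp (- x\<^sup>2 / 2)) * iexp (t * x)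
      = of_real (sqrt (2 * pi)) * (std_normal_density x *\<^sub>R iexp (t * x))" for x
    by (simp add: std_normal_density_def scaleR_conv_of_real)
  have "integrable lborel (\<lambda>x. std_normal_density x *\<^sub>R iexp (t * x))"
    by (rule Bochner_Integration.integrable_bound[of _ std_normal_density]) auto
  then show "integrable lborel (\<lambda>x::real. of_real (exp (- x\<^sup>2 / 2)) * iexp (t * x))"
    unfolding integrand_eq by (intro integrable_mult_right)
  have "char std_normal_distribution t = (\<integral>x. std_normal_density x *\<^sub>R iexp (t * x) \<partial>lborel)"
    unfolding char_def by (subst integral_density) auto
  then have "(\<integral>x. std_normal_density x *\<^sub>R iexp (t * x) \<partial>lborel) = of_real (exp (- t\<^sup>2 / 2))"
    by (simp add: char_std_normal_distribution)
  then show "(\<integral>x. of_real (exp (- x\<^sup>2 / 2)) * iexp (t * x) \<partial>lborel)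
      = of_real (sqrt (2 * pi)) * of_real (exp (- t\<^sup>2 / 2))"
    by (simp only: integrand_eq integral_mult_right_zero)
qed

lemma standard_gauss_fourier:
  fixes y :: "'a::euclidean_space"
  shows "(\<integral>x. gauss (1/2) 0 x * iexp (y \<bullet> x) \<partial>lborel)
      = of_real (sqrt (2 * pi) ^ DIM('a)) * gauss (1/2) 0 y"
proof -
  have gauss_prod: "gauss (1/2) 0 x = (\<Prod>b\<in>Basis. of_real (exp (- (x \<bullet> b)\<^sup>2 / 2)))" for x :: 'a
    unfolding gauss_def of_real_prod[symmetric] exp_sum[OF finite_Basis, symmetric]
    by (subst euclidean_inner) (simp add: sum_negf sum_divide_distrib power2_eq_square)
  have iexp_prod: "iexp (y \<bullet> x) = (\<Prod>b\<in>Basis. iexp ((y \<bullet> b) * (x \<bullet> b)))" for x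
    unfolding exp_sum[OF finite_Basis, symmetric]
    by (subst euclidean_inner) (simp add: sum_distrib_left)
  have "(\<integral>x. gauss (1/2) 0 x * iexp (y \<bullet> x) \<partial>lborel)
      = (\<integral>x. (\<Prod>b\<in>Basis. of_real (exp (- (x \<bullet> b)\<^sup>2 / 2)) * iexp ((y \<bullet> b) * (x \<bullet> b))) \<partial>lborel)"
    unfolding gauss_prod iexp_prod prod.distrib ..
  also have "\<dots> = (\<Prod>b\<in>(Basis::'a set). of_real (sqrt (2 * pi)) * of_real (exp (- (y \<bullet> b)\<^sup>2 / 2)))"
    unfolding standard_gauss_fourier_real(2)[symmetric]
    by (rule lborel_integral_prod) (rule standard_gauss_fourier_real(1))
  also have "\<dots> = of_real (sqrt (2 * pi) ^ DIM('a)) * gauss (1/2) 0 y"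
    unfolding prod.distrib gauss_prod by simp
  finally show ?thesis .
qed

lemma gauss_fourier:
  fixes y :: "'a::euclidean_space"
  assumes s_pos: "s > 0"
  shows "(\<integral>x. gauss s 0 x * iexp (y \<bullet> x) \<partial>lborel)
      = of_real (sqrt (pi / s) ^ DIM('a)) * gauss (1 / (4 * s)) 0 y"
proof -
  define r where "r = sqrt (2 * s)"
  have r_sqrt: "r > 0" "r * r = 2 * s" using s_pos by (auto simp: r_def)
  have "(\<integral>x. gauss s 0 x * iexp (y \<bullet> x) \<partial>lborel)
      = (\<integral>x. gauss (1/2) 0 (r *\<^sub>R x) * iexp (((1 / r) *\<^sub>R y) \<bullet> (r *\<^sub>R x)) \<partial>lborel)"
    using r_sqrt
    by (intro Bochner_Integration.integral_cong refl) (simp add: gauss_def mult.assoc[symmetric])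
  also have "\<dots> = (1 / r) ^ DIM('a) *\<^sub>R (\<integral>x. gauss (1/2) 0 x * iexp (((1 / r) *\<^sub>R y) \<bullet> x) \<partial>lborel)"
    using r_sqrt by (intro lborel_integral_scale) auto
  also have
    "\<dots> = of_real ((1 / r) ^ DIM('a) * sqrt (2 * pi) ^ DIM('a)) * gauss (1/2) 0 ((1 / r) *\<^sub>R y)"
    unfolding standard_gauss_fourier by (simp add: scaleR_conv_of_real)
  also have "(1 / r) ^ DIM('a) * sqrt (2 * pi) ^ DIM('a) = sqrt (pi / s) ^ DIM('a)"
    unfolding power_mult_distrib[symmetric] r_def using s_pos
    by (simp add: real_sqrt_divide[symmetric])
  also have "gauss (1/2) 0 ((1 / r) *\<^sub>R y) = gauss (1 / (4 * s)) 0 y"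
    using r_sqrt(2) by (simp add: gauss_def)
  finally show ?thesis .
qed

lemma gauss_integral_0:
  assumes "s > 0"
  shows "(\<integral>x. gauss s 0 x \<partial>(lborel :: 'a::euclidean_space measure))
      = of_real (sqrt (pi / s) ^ DIM('a))"
  using gauss_fourier[OF assms, of "0::'a"] by (simp add: gauss_0_eq)

lemma gauss_integral:
  fixes b :: "'a::euclidean_space"
  assumes s_pos: "s > 0"
  shows "(\<integral>x. gauss s b x \<partial>lborel) = of_real (exp ((b \<bullet> b) / (4 * s)) * sqrt (pi / s) ^ DIM('a))"
proof -
  have "(\<integral>x. gauss s b x \<partial>lborel)
      = (\<integral>x. of_real (exp ((b \<bullet> b) / (4 * s))) * gauss s 0 (x - (1 / (2 * s)) *\<^sub>R b) \<partial>lborel)"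
    using s_pos by (intro Bochner_Integration.integral_cong refl gauss_complete_square) simp
  also have "\<dots> = of_real (exp ((b \<bullet> b) / (4 * s))) * (\<integral>x. gauss s 0 x \<partial>(lborel :: 'a measure))"
    by (simp add: lborel_integral_translate[of "gauss s 0"])
  finally show ?thesis by (simp add: gauss_integral_0[OF s_pos])
qed

lemma gauss_superposition:
  fixes b :: "'a::euclidean_space"
  assumes s_pos: "s > 0"
  obtains w :: "'a \<Rightarrow> complex" where "rapidly_integrable w"
    "\<And>x. gauss s b x = (\<integral>z. w z * iexp (x \<bullet> z) \<partial>lborel)"
    "\<And>z. w (- z) = cnj (w z)"
proof -
  define t where "t = (1 / (2 * s)) *\<^sub>R b"
  define m where "m = sqrt (pi / (1 / (4 * s))) ^ DIM('a)"
  have m_nonzero: "m \<noteq> 0" using s_pos by (simp add: m_def)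
  define a where "a = complex_of_real (exp ((b \<bullet> b) / (4 * s)) / m)"
  define w where "w z = a * (iexp (z \<bullet> (- t)) * gauss (1 / (4 * s)) 0 z)" for z
  show ?thesis
  proof
    show "rapidly_integrable w" unfolding w_def
      using s_pos
      by (intro schwartz_rapidly_integrable schwartz_cmult schwartz_modulate schwartz_gauss) simp
    show "w (- z) = cnj (w z)" for z by (simp add: w_def a_def gauss_def exp_cnj)
    fix x
    have shift: "iexp (z \<bullet> (- t)) * iexp (x \<bullet> z) = iexp ((x - t) \<bullet> z)" for z
      unfolding exp_add[symmetric]
      by (simp add: inner_diff_left inner_commute[of z] right_diff_distrib)
    have "(\<integral>z. w z * iexp (x \<bullet> z) \<partial>lborel)
        = (\<integral>z. a * (gauss (1 / (4 * s)) 0 z * iexp ((x - t) \<bullet> z)) \<partial>lborel)"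
      unfolding w_def by (simp only: shift[symmetric] mult_ac)
    also have "\<dots> = a * (of_real m * gauss s 0 (x - t))"
      unfolding integral_mult_right_zero m_def using s_pos by (subst gauss_fourier) simp_all
    also have "\<dots> = gauss s b x"
      using s_pos m_nonzero gauss_complete_square[of s b x] by (simp add: a_def t_def)
    finally show "gauss s b x = (\<integral>z. w z * iexp (x \<bullet> z) \<partial>lborel)" by simp
  qed
qed

lemma schwartz_gauss_mult:
  assumes "s > 0" and \<phi>_schwartz: "schwartz \<phi>"
  shows "schwartz (\<lambda>y. gauss s b y * \<phi> y)"
proof -
  obtain w where w_superposition: "rapidly_integrable w"
    "\<And>x. gauss s b x = (\<integral>z. w z * iexp (x \<bullet> z) \<partial>lborel)"
    using gauss_superposition[OF \<open>s > 0\<close>] by metis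
  have "(\<lambda>y. \<integral>z. w z * (iexp (y \<bullet> z) * \<phi> y) \<partial>lborel) = (\<lambda>y. gauss s b y * \<phi> y)"
    unfolding w_superposition(2) by (simp add: mult.assoc[symmetric])
  with schwartz_weighted_integral[OF w_superposition(1) schwartz_family_modulate[OF \<phi>_schwartz]]
  show ?thesis by simp
qed

section \<open>Square-integrable functions\<close>

lemma square_integrable_measurable: "square_integrable f \<Longrightarrow> f \<in> borel_measurable lebesgue"
  and square_integrable_norm_squared: "square_integrable f \<Longrightarrow>
      integrable lebesgue (\<lambda>x. (cmod (f x))\<^sup>2)"
  by (simp_all add: square_integrable_def)

lemma square_integrableI_bound:
  assumes f_measurable: "f \<in> borel_measurable lebesgue" and g_integrable: "integrable lebesgue g"
    and norm_squared_le: "\<And>x. (cmod (f x))\<^sup>2 \<le> g x"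
  shows "square_integrable f"
  unfolding square_integrable_def
proof
  have "(\<lambda>x. (cmod (f x))\<^sup>2) \<in> borel_measurable lebesgue" using f_measurable by measurable
  from Bochner_Integration.integrable_bound[OF g_integrable this]
  show "integrable lebesgue (\<lambda>x. (cmod (f x))\<^sup>2)"
    using norm_squared_le by (auto intro!: AE_I2 order_trans[OF norm_squared_le abs_ge_self])
qed (rule f_measurable)

lemma square_integrable_add:
  assumes f_L2: "square_integrable f" and g_L2: "square_integrable g"
  shows "square_integrable (\<lambda>x. f x + g x)"
proof (rule square_integrableI_bound)
  show "integrable lebesgue (\<lambda>x. 2 * (cmod (f x))\<^sup>2 + 2 * (cmod (g x))\<^sup>2)"
    using f_L2 g_L2 by (auto simp: square_integrable_def)
  show "(\<lambda>x. f x + g x) \<in> borel_measurable lebesgue"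
    using f_L2 g_L2 by (auto simp: square_integrable_def)
  show "(cmod (f x + g x))\<^sup>2 \<le> 2 * (cmod (f x))\<^sup>2 + 2 * (cmod (g x))\<^sup>2" for x
    using power_mono[OF norm_triangle_ineq[of "f x" "g x"], of 2]
      sum_squares_bound[of "cmod (f x)" "cmod (g x)"]
    by (simp add: power2_sum)
qed

lemma square_integrable_cmult: "square_integrable f \<Longrightarrow> square_integrable (\<lambda>x. c * f x)"
  by (auto simp: square_integrable_def norm_mult power_mult_distrib)

lemma square_integrable_diff:
  "square_integrable f \<Longrightarrow> square_integrable g \<Longrightarrow> square_integrable (\<lambda>x. f x - g x)"
  using square_integrable_add[of f "\<lambda>x. (-1) * g x"] square_integrable_cmult[of g "-1"] by simp

lemma square_integrable_cnj: "square_integrable f \<Longrightarrow> square_integrable (\<lambda>x. cnj (f x))"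
  unfolding square_integrable_def complex_mod_cnj
  by (auto intro!: borel_measurable_continuous_on[of cnj] continuous_intros)

lemma square_integrable_mult:
  assumes f_L2: "square_integrable f" and g_L2: "square_integrable g"
  shows "integrable lebesgue (\<lambda>x. f x * g x)"
proof (rule Bochner_Integration.integrable_bound)
  show "integrable lebesgue (\<lambda>x. (cmod (f x))\<^sup>2 + (cmod (g x))\<^sup>2)"
    using f_L2 g_L2 by (auto simp: square_integrable_def)
  show "(\<lambda>x. f x * g x) \<in> borel_measurable lebesgue"
    using f_L2 g_L2 by (auto simp: square_integrable_def)
  have "norm (f x * g x) \<le> norm ((cmod (f x))\<^sup>2 + (cmod (g x))\<^sup>2)" for x
  proof -
    have "norm (f x * g x) \<le> 2 * cmod (f x) * cmod (g x)" by (simp add: norm_mult)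
    also have "\<dots> \<le> (cmod (f x))\<^sup>2 + (cmod (g x))\<^sup>2" by (rule sum_squares_bound)
    finally show ?thesis by simp
  qed
  then show "AE x in lebesgue. norm (f x * g x) \<le> norm ((cmod (f x))\<^sup>2 + (cmod (g x))\<^sup>2)" by simp
qed

lemma L2_norm_fun_nonneg: "0 \<le> L2_norm_fun f"
  by (simp add: L2_norm_fun_def)

lemma L2_norm_fun_squared: "(L2_norm_fun f)\<^sup>2 = (\<integral>x. (cmod (f x))\<^sup>2 \<partial>lebesgue)"
  by (simp add: L2_norm_fun_def)

lemma L2_norm_fun_cmult: "L2_norm_fun (\<lambda>x. c * f x) = cmod c * L2_norm_fun f"
  by (simp add: L2_norm_fun_def norm_mult power_mult_distrib real_sqrt_mult)

lemma L2_norm_fun_minus_commute: "L2_norm_fun (\<lambda>x. f x - g x) = L2_norm_fun (\<lambda>x. g x - f x)"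
  by (simp add: L2_norm_fun_def norm_minus_commute)

lemma L2_norm_fun_cnj: "L2_norm_fun (\<lambda>x. cnj (f x)) = L2_norm_fun f"
  by (simp add: L2_norm_fun_def)

lemma L2_norm_fun_cong_AE:
  assumes "square_integrable f" "square_integrable g" "AE x in lebesgue. f x = g x"
  shows "L2_norm_fun f = L2_norm_fun g"
  unfolding L2_norm_fun_def
  using assms by (intro arg_cong[where f=sqrt] integral_cong_AE) (auto simp: square_integrable_def)

lemma
  assumes f_measurable: "f \<in> borel_measurable lebesgue" and g_L2: "square_integrable g"
    and norm_le: "\<And>x. cmod (f x) \<le> cmod (g x)"
  shows square_integrable_dominated: "square_integrable f"
    and L2_norm_fun_mono: "L2_norm_fun f \<le> L2_norm_fun g"
proof -
  have squares: "(cmod (f x))\<^sup>2 \<le> (cmod (g x))\<^sup>2" for x by (intro power_mono norm_le) simp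
  show f_L2: "square_integrable f"
    by (rule square_integrableI_bound[OF f_measurable square_integrable_norm_squared[OF g_L2]
      squares])
  show "L2_norm_fun f \<le> L2_norm_fun g"
    unfolding L2_norm_fun_def
    by (intro real_sqrt_le_mono integral_mono square_integrable_norm_squared f_L2 g_L2 squares)
qed

lemma nn_integral_norm_squared:
  assumes "square_integrable f"
  shows "(\<integral>\<^sup>+x. ennreal ((cmod (f x))\<^sup>2) \<partial>lebesgue) = ennreal ((L2_norm_fun f)\<^sup>2)"
  unfolding L2_norm_fun_squared using square_integrable_norm_squared[OF assms]
  by (intro nn_integral_eq_integral) auto

lemma
  assumes f_measurable: "f \<in> borel_measurable lebesgue"
    and nn_integral_le: "(\<integral>\<^sup>+x. ennreal ((cmod (f x))\<^sup>2) \<partial>lebesgue) \<le> ennreal (e\<^sup>2)" and "0 \<le> e"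
  shows square_integrable_of_nn_integral_le: "square_integrable f"
    and L2_norm_fun_le_of_nn_integral_le: "L2_norm_fun f \<le> e"
proof -
  have "(\<lambda>x. (cmod (f x))\<^sup>2) \<in> borel_measurable lebesgue" using f_measurable by measurable
  moreover have "(\<integral>\<^sup>+x. ennreal (norm ((cmod (f x))\<^sup>2)) \<partial>lebesgue) < \<infinity>"
    using order_le_less_trans[OF nn_integral_le ennreal_less_top] by simp
  ultimately have "integrable lebesgue (\<lambda>x. (cmod (f x))\<^sup>2)" by (rule integrableI_bounded)
  with f_measurable show f_L2: "square_integrable f" by (simp add: square_integrable_def)
  have "(L2_norm_fun f)\<^sup>2 \<le> e\<^sup>2" using nn_integral_le by (simp add: nn_integral_norm_squared[OF f_L2])
  then show "L2_norm_fun f \<le> e" using \<open>0 \<le> e\<close> by (rule power2_le_imp_le)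
qed

lemma integrable_mult_norms:
  assumes "square_integrable f" "square_integrable g"
  shows "integrable lebesgue (\<lambda>x. cmod (f x) * cmod (g x))"
  using integrable_norm[OF square_integrable_mult[OF assms]] by (simp add: norm_mult)

lemma L2_Cauchy_Schwarz:
  assumes f_L2: "square_integrable f" and g_L2: "square_integrable g"
  shows "(\<integral>x. cmod (f x) * cmod (g x) \<partial>lebesgue) \<le> L2_norm_fun f * L2_norm_fun g"
proof -
  let ?c = "\<integral>x. cmod (f x) * cmod (g x) \<partial>lebesgue"
  have [measurable]: "f \<in> borel_measurable lebesgue" "g \<in> borel_measurable lebesgue"
    using f_L2 g_L2 by (auto simp: square_integrable_def)
  have "ennreal ?c = (\<integral>\<^sup>+x. ennreal (cmod (f x)) * ennreal (cmod (g x)) \<partial>lebesgue)"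
    unfolding ennreal_mult[symmetric, OF norm_ge_zero norm_ge_zero]
    by (rule nn_integral_eq_integral[OF integrable_mult_norms[OF f_L2 g_L2], symmetric]) simp
  also have
    "\<dots>\<^sup>2 \<le> (\<integral>\<^sup>+x. ennreal (cmod (f x)) ^ 2 \<partial>lebesgue) * (\<integral>\<^sup>+x. ennreal (cmod (g x)) ^ 2 \<partial>lebesgue)"
    by (rule Cauchy_Schwarz_nn_integral) measurable
  also have "\<dots> = ennreal ((L2_norm_fun f * L2_norm_fun g)\<^sup>2)"
    by (simp add: ennreal_power nn_integral_norm_squared f_L2 g_L2 ennreal_mult power_mult_distrib)
  finally have "?c\<^sup>2 \<le> (L2_norm_fun f * L2_norm_fun g)\<^sup>2" by (simp add: ennreal_power)
  then show ?thesis by (rule power2_le_imp_le) (simp add: L2_norm_fun_nonneg)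
qed

lemma L2_pairing_bound:
  assumes f_L2: "square_integrable f" and g_L2: "square_integrable g"
  shows "cmod (\<integral>x. f x * g x \<partial>lebesgue) \<le> L2_norm_fun f * L2_norm_fun g"
  using integral_norm_bound[of lebesgue "\<lambda>x. f x * g x"] L2_Cauchy_Schwarz[OF f_L2 g_L2]
  by (simp add: norm_mult)

lemma L2_triangle:
  assumes f_L2: "square_integrable f" and g_L2: "square_integrable g"
  shows "L2_norm_fun (\<lambda>x. f x + g x) \<le> L2_norm_fun f + L2_norm_fun g"
proof (rule power2_le_imp_le)
  note integrable = square_integrable_norm_squared[OF f_L2] square_integrable_norm_squared[OF g_L2]
    integrable_mult_norms[OF f_L2 g_L2]
  have "(L2_norm_fun (\<lambda>x. f x + g x))\<^sup>2
      \<le> (\<integral>x. (cmod (f x))\<^sup>2 + (cmod (g x))\<^sup>2 + 2 * (cmod (f x) * cmod (g x)) \<partial>lebesgue)"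
    unfolding L2_norm_fun_squared
  proof (rule integral_mono)
    show "(cmod (f x + g x))\<^sup>2 \<le> (cmod (f x))\<^sup>2 + (cmod (g x))\<^sup>2 + 2 * (cmod (f x) * cmod (g x))" for x
      using power_mono[OF norm_triangle_ineq[of "f x" "g x"] norm_ge_zero, of 2]
      by (simp add: power2_sum mult.assoc)
  qed (use integrable square_integrable_norm_squared[OF square_integrable_add[OF f_L2 g_L2]]
    in auto)
  also have "\<dots> = (L2_norm_fun f)\<^sup>2 + (L2_norm_fun g)\<^sup>2 + 2 * (\<integral>x. cmod (f x) * cmod (g x) \<partial>lebesgue)"
    using integrable by (simp add: L2_norm_fun_squared)
  also have "\<dots> \<le> (L2_norm_fun f + L2_norm_fun g)\<^sup>2"
    using L2_Cauchy_Schwarz[OF f_L2 g_L2] by (simp add: power2_sum)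
  finally show "(L2_norm_fun (\<lambda>x. f x + g x))\<^sup>2 \<le> (L2_norm_fun f + L2_norm_fun g)\<^sup>2" .
qed (simp add: L2_norm_fun_nonneg)

lemma L2_norm_fun_tendsto:
  assumes f_L2: "\<And>n. square_integrable (f n)" and g_L2: "square_integrable g"
    and lim: "(\<lambda>n. L2_norm_fun (\<lambda>x. f n x - g x)) \<longlonglongrightarrow> 0"
  shows "(\<lambda>n. L2_norm_fun (f n)) \<longlonglongrightarrow> L2_norm_fun g"
proof -
  have "(\<lambda>n. L2_norm_fun (f n) - L2_norm_fun g) \<longlonglongrightarrow> 0"
  proof (rule Lim_null_comparison[OF always_eventually[OF allI] lim])
    show "norm (L2_norm_fun (f n) - L2_norm_fun g) \<le> L2_norm_fun (\<lambda>x. f n x - g x)" for n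
      using L2_triangle[OF square_integrable_diff[OF f_L2 g_L2] g_L2, of n]
        L2_triangle[OF square_integrable_diff[OF g_L2 f_L2] f_L2, of n n]
        L2_norm_fun_minus_commute[of "f n" g] by (simp add: abs_le_iff)
  qed
  then show ?thesis by (rule LIM_zero_cancel)
qed

definition L2_Cauchy :: "(nat \<Rightarrow> 'a::euclidean_space \<Rightarrow> complex) \<Rightarrow> bool" where
  "L2_Cauchy f \<longleftrightarrow> (\<forall>e>0. \<exists>M. \<forall>m\<ge>M. \<forall>n\<ge>M. L2_norm_fun (\<lambda>x. f m x - f n x) < e)"

lemma L2_CauchyE:
  assumes "L2_Cauchy f" "e > 0"
  obtains M where "\<And>m n. m \<ge> M \<Longrightarrow> n \<ge> M \<Longrightarrow> L2_norm_fun (\<lambda>x. f m x - f n x) < e"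
  using assms unfolding L2_Cauchy_def by blast

lemma L2_Cauchy_geometric_subsequence:
  assumes "L2_Cauchy f"
  obtains r :: "nat \<Rightarrow> nat" where "\<And>k. k \<le> r k"
    "\<And>k. L2_norm_fun (\<lambda>x. f (r (Suc k)) x - f (r k) x) \<le> (1/2) ^ k"
proof -
  have "\<forall>k. \<exists>M. \<forall>m\<ge>M. \<forall>n\<ge>M. L2_norm_fun (\<lambda>x. f m x - f n x) < (1/2) ^ k"
    using assms unfolding L2_Cauchy_def by simp
  then obtain M where M_bound: "\<And>k m n. m \<ge> M k \<Longrightarrow> n \<ge> M k \<Longrightarrow>
      L2_norm_fun (\<lambda>x. f m x - f n x) < (1/2) ^ k"
    by metis
  define r where "r k = k + (\<Sum>i\<le>k. M i)" for k
  have "M k \<le> r k" for k unfolding r_def by (simp add: trans_le_add2 member_le_sum[of k "{..k}" M])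
  moreover have "r k \<le> r (Suc k)" for k by (simp add: r_def)
  ultimately have "M k \<le> r k" "M k \<le> r (Suc k)" for k using order_trans by blast+
  then show ?thesis using M_bound[THEN less_imp_le] by (intro that[of r]) (auto simp: r_def)
qed

lemma convergent_of_geometric_increments:
  fixes a :: "nat \<Rightarrow> complex"
  assumes "\<And>k. 2 ^ k * (cmod (a (Suc k) - a k))\<^sup>2 \<le> S"
  shows "convergent a"
proof -
  let ?q = "sqrt (1 / 2)"
  have "norm (a (Suc k) - a k) \<le> sqrt S * ?q ^ k" for k
  proof -
    have "(cmod (a (Suc k) - a k))\<^sup>2 \<le> S * (1 / 2) ^ k"
      using assms[of k] by (simp add: field_simps power_one_over)
    then have "cmod (a (Suc k) - a k) \<le> sqrt (S * (1 / 2) ^ k)" by (rule real_le_rsqrt)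
    then show ?thesis by (simp add: real_sqrt_mult real_sqrt_power)
  qed
  moreover have "summable (\<lambda>k. sqrt S * ?q ^ k)"
    by (intro summable_mult summable_geometric) (simp add: real_sqrt_lt_1_iff)
  ultimately have "summable (\<lambda>k. a (Suc k) - a k)"
    using summable_comparison_test[of "\<lambda>k. a (Suc k) - a k" "\<lambda>k. sqrt S * ?q ^ k"] by blast
  then have "convergent (\<lambda>n. a n - a 0)" unfolding summable_iff_convergent sum_lessThan_telescope .
  then show ?thesis using convergent_diff_const_right_iff by blast
qed

lemma AE_summable_of_L2_geometric:
  assumes D_L2: "\<And>k. square_integrable (D k)" and geometric: "\<And>k. L2_norm_fun (D k) \<le> (1/2) ^ k"
  shows "AE x in lebesgue. (\<Sum>k. ennreal (2 ^ k * (cmod (D k x))\<^sup>2)) < \<infinity>"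
proof -
  have [measurable]: "D k \<in> borel_measurable lebesgue" for k
    by (rule square_integrable_measurable[OF D_L2])
  have term_le: "(\<integral>\<^sup>+x. ennreal (2 ^ k * (cmod (D k x))\<^sup>2) \<partial>lebesgue) \<le> ennreal ((1/2) ^ k)" for k
  proof -
    have "(\<integral>\<^sup>+x. ennreal (2 ^ k * (cmod (D k x))\<^sup>2) \<partial>lebesgue)
        = ennreal (2 ^ k) * (\<integral>\<^sup>+x. ennreal ((cmod (D k x))\<^sup>2) \<partial>lebesgue)"
      by (subst nn_integral_cmult[symmetric]) (auto simp: ennreal_mult)
    also have "\<dots> = ennreal (2 ^ k * (L2_norm_fun (D k))\<^sup>2)"
      unfolding nn_integral_norm_squared[OF D_L2] by (rule ennreal_mult[symmetric]) auto
    also have "\<dots> \<le> ennreal (2 ^ k * ((1/2) ^ k)\<^sup>2)"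
      by (intro ennreal_leI mult_left_mono power_mono geometric L2_norm_fun_nonneg) simp
    also have "2 ^ k * ((1/2) ^ k)\<^sup>2 = ((1/2) ^ k :: real)"
      by (simp add: power2_eq_square power_mult_distrib[symmetric] mult.assoc[symmetric])
    finally show ?thesis .
  qed
  have "(\<integral>\<^sup>+x. (\<Sum>k. ennreal (2 ^ k * (cmod (D k x))\<^sup>2)) \<partial>lebesgue)
      = (\<Sum>k. \<integral>\<^sup>+x. ennreal (2 ^ k * (cmod (D k x))\<^sup>2) \<partial>lebesgue)"
    by (rule nn_integral_suminf) measurable
  also have "\<dots> \<le> (\<Sum>k. ennreal ((1/2) ^ k))" by (intro suminf_le summableI term_le)
  also have "\<dots> = ennreal (\<Sum>k. (1/2) ^ k)" by (rule suminf_ennreal2) (auto intro: summable_geometric)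
  finally have "(\<integral>\<^sup>+x. (\<Sum>k. ennreal (2 ^ k * (cmod (D k x))\<^sup>2)) \<partial>lebesgue) < \<infinity>"
    by (rule order_le_less_trans) simp
  then have "AE x in lebesgue. (\<Sum>k. ennreal (2 ^ k * (cmod (D k x))\<^sup>2)) \<noteq> \<infinity>"
    by (intro nn_integral_noteq_infinite) auto
  then show ?thesis by eventually_elim (simp add: less_top)
qed

lemma AE_convergent_of_L2_geometric:
  assumes f_L2: "\<And>k. square_integrable (f k)"
    and geometric: "\<And>k. L2_norm_fun (\<lambda>x. f (Suc k) x - f k x) \<le> (1/2) ^ k"
  shows "AE x in lebesgue. convergent (\<lambda>k. f k x)"
  using AE_summable_of_L2_geometric[OF square_integrable_diff[OF f_L2 f_L2] geometric]
proof eventually_elim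
  case (elim x)
  let ?a = "\<lambda>k. 2 ^ k * (cmod (f (Suc k) x - f k x))\<^sup>2"
  define S where "S = (\<Sum>k. ennreal (?a k))"
  have S_finite: "S < \<infinity>" using elim by (simp add: S_def)
  have "?a k \<le> enn2real S" for k
  proof -
    have "(\<Sum>i\<in>{k}. ennreal (?a i)) \<le> S" unfolding S_def by (rule sum_le_suminf[OF summableI]) auto
    then have "ennreal (?a k) \<le> S"
      by (simp only: sum.insert_if sum.empty finite.emptyI empty_iff if_False add_0_right)
    also have "S = ennreal (enn2real S)" using S_finite by (simp add: ennreal_enn2real)
    finally show ?thesis by (subst (asm) ennreal_le_iff) auto
  qed
  then show ?case by (rule convergent_of_geometric_increments)
qed

lemma
  fixes f :: "nat \<Rightarrow> 'a::euclidean_space \<Rightarrow> complex"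
  assumes f_L2: "\<And>k. square_integrable (f k)"
    and g_measurable [measurable]: "g \<in> borel_measurable lebesgue"
    and lim: "AE x in lebesgue. (\<lambda>k. f k x) \<longlonglongrightarrow> g x"
    and norm_le: "\<forall>\<^sub>F k in sequentially. L2_norm_fun (f k) \<le> e" and "0 \<le> e"
  shows square_integrable_of_AE_limit: "square_integrable g"
    and L2_norm_fun_AE_limit_le: "L2_norm_fun g \<le> e"
proof -
  have [measurable]: "f k \<in> borel_measurable lebesgue" for k
    by (rule square_integrable_measurable[OF f_L2])
  have "(\<integral>\<^sup>+x. ennreal ((cmod (g x))\<^sup>2) \<partial>lebesgue)
      \<le> (\<integral>\<^sup>+x. liminf (\<lambda>k. ennreal ((cmod (f k x))\<^sup>2)) \<partial>lebesgue)"
    using lim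
  proof (intro nn_integral_mono_AE, eventually_elim)
    case (elim x)
    then have "(\<lambda>k. ennreal ((cmod (f k x))\<^sup>2)) \<longlonglongrightarrow> ennreal ((cmod (g x))\<^sup>2)"
      by (intro tendsto_ennrealI tendsto_intros)
    then show ?case using lim_imp_Liminf[OF sequentially_bot] by fastforce
  qed
  also have "\<dots> \<le> liminf (\<lambda>k. \<integral>\<^sup>+x. ennreal ((cmod (f k x))\<^sup>2) \<partial>lebesgue)"
    by (rule nn_integral_liminf) measurable
  also have "\<dots> \<le> ennreal (e\<^sup>2)"
  proof (rule Liminf_le)
    show "\<forall>\<^sub>F k in sequentially. (\<integral>\<^sup>+x. ennreal ((cmod (f k x))\<^sup>2) \<partial>lebesgue) \<le> ennreal (e\<^sup>2)"
      using norm_le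
      by eventually_elim (auto simp: nn_integral_norm_squared[OF f_L2]
        intro!: ennreal_leI power_mono L2_norm_fun_nonneg)
  qed simp
  finally show "square_integrable g" "L2_norm_fun g \<le> e"
    using square_integrable_of_nn_integral_le[OF g_measurable _ \<open>0 \<le> e\<close>]
      L2_norm_fun_le_of_nn_integral_le[OF g_measurable _ \<open>0 \<le> e\<close>] by auto
qed

lemma
  fixes f :: "nat \<Rightarrow> 'a::euclidean_space \<Rightarrow> complex"
  assumes f_L2: "\<And>n. square_integrable (f n)" and g_measurable: "g \<in> borel_measurable lebesgue"
    and r_ge: "\<And>k. k \<le> r k" and lim: "AE x in lebesgue. (\<lambda>k. f (r k) x) \<longlonglongrightarrow> g x"
    and dist_less: "\<And>m n. m \<ge> K \<Longrightarrow> n \<ge> K \<Longrightarrow> L2_norm_fun (\<lambda>x. f m x - f n x) < e"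
    and "e > 0" and n_ge: "n \<ge> K"
  shows square_integrable_diff_AE_limit: "square_integrable (\<lambda>x. f n x - g x)"
    and L2_norm_fun_diff_AE_limit_le: "L2_norm_fun (\<lambda>x. f n x - g x) \<le> e"
proof -
  have diff_measurable: "(\<lambda>x. f n x - g x) \<in> borel_measurable lebesgue"
    by (intro borel_measurable_diff square_integrable_measurable f_L2 g_measurable)
  have diff_lim: "AE x in lebesgue. (\<lambda>k. f n x - f (r k) x) \<longlonglongrightarrow> f n x - g x"
    using lim by eventually_elim (intro tendsto_intros)
  have diff_le: "\<forall>\<^sub>F k in sequentially. L2_norm_fun (\<lambda>x. f n x - f (r k) x) \<le> e"
    using dist_less[OF n_ge] r_ge
    by (intro eventually_sequentiallyI[of K]) (meson less_imp_le order_trans)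
  have "0 \<le> e" using \<open>e > 0\<close> by simp
  note limit = square_integrable_diff[OF f_L2 f_L2] diff_measurable diff_lim diff_le \<open>0 \<le> e\<close>
  show "square_integrable (\<lambda>x. f n x - g x)" by (rule square_integrable_of_AE_limit[OF limit])
  show "L2_norm_fun (\<lambda>x. f n x - g x) \<le> e" by (rule L2_norm_fun_AE_limit_le[OF limit])
qed

lemma L2_complete:
  fixes f :: "nat \<Rightarrow> 'a::euclidean_space \<Rightarrow> complex"
  assumes f_L2: "\<And>n. square_integrable (f n)" and cauchy: "L2_Cauchy f"
  obtains g where "square_integrable g" "(\<lambda>n. L2_norm_fun (\<lambda>x. f n x - g x)) \<longlonglongrightarrow> 0"
proof -
  have [measurable]: "f n \<in> borel_measurable lebesgue" for n
    by (rule square_integrable_measurable[OF f_L2])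
  obtain r where r_geometric: "\<And>k. k \<le> r k"
    "\<And>k. L2_norm_fun (\<lambda>x. f (r (Suc k)) x - f (r k) x) \<le> (1/2) ^ k"
    using L2_Cauchy_geometric_subsequence[OF cauchy] by metis
  define g where "g x = lim (\<lambda>k. f (r k) x)" for x
  have g_measurable: "g \<in> borel_measurable lebesgue" unfolding g_def by measurable
  have lim: "AE x in lebesgue. (\<lambda>k. f (r k) x) \<longlonglongrightarrow> g x"
    using AE_convergent_of_L2_geometric[of "\<lambda>k. f (r k)", OF f_L2 r_geometric(2)]
    by eventually_elim (simp add: g_def convergent_LIMSEQ_iff)
  obtain K where "\<And>m n. m \<ge> K \<Longrightarrow> n \<ge> K \<Longrightarrow> L2_norm_fun (\<lambda>x. f m x - f n x) < 1"
    using L2_CauchyE[OF cauchy zero_less_one] by metis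
  from square_integrable_diff_AE_limit[OF f_L2 g_measurable r_geometric(1) lim this]
  have "square_integrable (\<lambda>x. f K x - g x)" by simp
  from square_integrable_diff[OF f_L2[of K] this] have "square_integrable g" by simp
  moreover have "(\<lambda>n. L2_norm_fun (\<lambda>x. f n x - g x)) \<longlonglongrightarrow> 0"
  proof (rule LIMSEQ_I)
    fix e :: real assume "e > 0"
    then obtain K where "\<And>m n. m \<ge> K \<Longrightarrow> n \<ge> K \<Longrightarrow> L2_norm_fun (\<lambda>x. f m x - f n x) < e / 2"
      using L2_CauchyE[OF cauchy half_gt_zero] by metis
    from L2_norm_fun_diff_AE_limit_le[OF f_L2 g_measurable r_geometric(1) lim this]
    have "L2_norm_fun (\<lambda>x. f n x - g x) \<le> e / 2" if "n \<ge> K" for n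
      using that \<open>e > 0\<close> by simp
    then show "\<exists>K. \<forall>n\<ge>K. norm (L2_norm_fun (\<lambda>x. f n x - g x) - 0) < e"
      using \<open>e > 0\<close> by (intro exI[of _ K]) (force simp: L2_norm_fun_nonneg)
  qed
  ultimately show ?thesis by (rule that)
qed

section \<open>Gaussian mollification\<close>

definition mollify :: "nat \<Rightarrow> ('a::euclidean_space \<Rightarrow> complex) \<Rightarrow> 'a \<Rightarrow> complex" where
  "mollify n h y = of_real ((real (Suc n) / sqrt pi) ^ DIM('a)) *
    (\<integral>x. gauss ((real (Suc n))\<^sup>2) 0 x * h (y - x) \<partial>lborel)"

lemma mollify_eq_rescaled:
  fixes h :: "'a::euclidean_space \<Rightarrow> complex"
  assumes [measurable]: "h \<in> borel_measurable borel"
  shows "mollify n h y = of_real ((1 / sqrt pi) ^ DIM('a)) *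
    (\<integral>x. gauss 1 0 x * h (y - (1 / real (Suc n)) *\<^sub>R x) \<partial>lborel)"
proof -
  let ?m = "real (Suc n)" and ?f = "\<lambda>x. gauss 1 0 x * h (y - (1 / real (Suc n)) *\<^sub>R x)"
  have f_measurable: "?f \<in> borel_measurable borel" by measurable
  have "(\<integral>x. gauss (?m\<^sup>2) 0 x * h (y - x) \<partial>lborel) = (\<integral>x. ?f (?m *\<^sub>R x) \<partial>lborel)"
    by (simp add: gauss_def power2_eq_square mult.assoc del: of_nat_Suc)
  also have "\<dots> = (1 / ?m) ^ DIM('a) *\<^sub>R (\<integral>x. ?f x \<partial>lborel)"
    by (rule lborel_integral_scale[OF f_measurable]) simp
  finally show ?thesis
    unfolding mollify_def by (simp add: scaleR_conv_of_real power_divide del: of_nat_Suc)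
qed

lemma mollify_eq_convolution:
  assumes [measurable]: "h \<in> borel_measurable borel"
  shows "mollify n h y = of_real ((real (Suc n) / sqrt pi) ^ DIM('a)) *
    (\<integral>x. h x * gauss ((real (Suc n))\<^sup>2) 0 (y - x) \<partial>(lborel :: 'a::euclidean_space measure))"
proof -
  have "(\<lambda>x. h x * gauss ((real (Suc n))\<^sup>2) 0 (y - x)) \<in> borel_measurable borel" by measurable
  from lborel_integral_reflect[OF this, of y] show ?thesis by (simp add: mollify_def mult.commute)
qed

lemma schwartz_mollify:
  assumes h_rapid: "rapidly_integrable h"
  shows "schwartz (mollify n h)"
  unfolding mollify_eq_convolution[OF rapidly_integrable_measurable[OF h_rapid], abs_def]
  by (intro schwartz_cmult schwartz_weighted_integral h_rapid schwartz_family_translate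
    schwartz_gauss) simp

lemma weight_inverse_Suc_scaleR_power_le: "weight ((1 / real (Suc n)) *\<^sub>R x) ^ k \<le> weight x ^ k"
proof (rule power_mono)
  have "norm ((1 / real (Suc n)) *\<^sub>R x) \<le> 1 * norm x"
    unfolding norm_scaleR by (intro mult_right_mono) (auto simp: field_simps)
  then show "weight ((1 / real (Suc n)) *\<^sub>R x) \<le> weight x" by simp
qed simp

lemma growth_shifted_inverse_Suc:
  assumes growth: "\<And>x. norm (h x) \<le> C * weight x ^ K"
  shows "norm (h (y - (1 / real (Suc n)) *\<^sub>R x)) \<le> C * (weight y ^ K * weight x ^ K)"
proof -
  let ?u = "(1 / real (Suc n)) *\<^sub>R x"
  have "0 \<le> C" using order_trans[OF norm_ge_zero growth[of 0]] by simp
  have "weight (y - ?u) ^ K \<le> weight y ^ K * weight ?u ^ K"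
    using weight_add_power_le[of y "- ?u"] by simp
  also have "\<dots> \<le> weight y ^ K * weight x ^ K"
    by (intro mult_left_mono weight_inverse_Suc_scaleR_power_le) simp
  finally show ?thesis using \<open>0 \<le> C\<close> by (intro order_trans[OF growth] mult_left_mono)
qed

lemma mollify_tendsto:
  fixes h :: "'a::euclidean_space \<Rightarrow> complex"
  assumes h_measurable [measurable]: "h \<in> borel_measurable borel"
    and growth: "\<And>x. norm (h x) \<le> C * weight x ^ K"
    and cont: "isCont h y"
  shows "(\<lambda>n. mollify n h y) \<longlonglongrightarrow> h y"
proof -
  let ?u = "\<lambda>n x. (1 / real (Suc n)) *\<^sub>R x"
  have "(\<lambda>n. \<integral>x. gauss 1 0 x * h (y - ?u n x) \<partial>lborel)
      \<longlonglongrightarrow> (\<integral>x. gauss 1 0 x * h y \<partial>(lborel :: 'a measure))"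
  proof (rule integral_dominated_convergence[
      where w="\<lambda>x. (C * weight y ^ K) * (weight x ^ K * norm (gauss 1 0 x))"])
    show "integrable lborel (\<lambda>x::'a. (C * weight y ^ K) * (weight x ^ K * norm (gauss 1 0 x)))"
      by (intro integrable_mult_right rapidly_integrable_weight schwartz_rapidly_integrable
        schwartz_gauss) simp
    show "AE x in lborel. (\<lambda>n. gauss 1 0 x * h (y - ?u n x)) \<longlonglongrightarrow> gauss 1 0 x * h y"
    proof (intro AE_I2 tendsto_mult tendsto_const)
      fix x :: 'a
      have "(\<lambda>n. y - ?u n x) \<longlonglongrightarrow> y - 0 *\<^sub>R x"
        using LIMSEQ_inverse_real_of_nat by (intro tendsto_intros) (simp add: inverse_eq_divide)
      then show "(\<lambda>n. h (y - ?u n x)) \<longlonglongrightarrow> h y" by (intro isCont_tendsto_compose[OF cont]) simp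
    qed
    show "AE x in lborel. norm (gauss 1 0 x * h (y - ?u n x))
        \<le> (C * weight y ^ K) * (weight x ^ K * norm (gauss 1 0 x))" for n
    proof (rule AE_I2)
      fix x :: 'a
      from mult_left_mono[OF growth_shifted_inverse_Suc[OF growth, of y n x]
        norm_ge_zero[of "gauss 1 0 x"]]
      show "norm (gauss 1 0 x * h (y - ?u n x))
          \<le> (C * weight y ^ K) * (weight x ^ K * norm (gauss 1 0 x))"
        unfolding norm_mult by (simp only: mult_ac)
    qed
  qed measurable
  from tendsto_mult_left[OF this, of "of_real ((1 / sqrt pi) ^ DIM('a))"] show ?thesis
    unfolding mollify_eq_rescaled[OF h_measurable]
    by (simp add: gauss_integral_0 power_divide real_sqrt_eq_zero_cancel_iff)
qed

lemma mollify_uniform_decay: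
  fixes h :: "'a::euclidean_space \<Rightarrow> complex"
  assumes h_measurable [measurable]: "h \<in> borel_measurable borel"
    and decay: "\<And>x. weight x ^ k * norm (h x) \<le> C"
  obtains W where "\<And>n y. weight y ^ k * norm (mollify n h y) \<le> W"
proof -
  let ?c = "(1 / sqrt pi) ^ DIM('a)" and ?g = "gauss 1 (0::'a)"
  have gauss_rapid: "rapidly_integrable ?g"
    by (intro schwartz_rapidly_integrable schwartz_gauss) simp
  have C_nonneg: "0 \<le> C" using order_trans[OF norm_ge_zero norm_le_of_weighted_le[OF decay]] .
  have rescaled_bound: "weight y ^ k * norm (\<integral>x. ?g x * h (y - (1 / real (Suc n)) *\<^sub>R x) \<partial>lborel)
      \<le> (\<integral>x. C * (weight x ^ k * norm (?g x)) \<partial>lborel)" for n y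
  proof (rule weighted_norm_integral_le)
    let ?u = "\<lambda>x. (1 / real (Suc n)) *\<^sub>R x"
    show "integrable lborel (\<lambda>x. ?g x * h (y - ?u x))"
      by (rule rapidly_integrable_mult[OF gauss_rapid, where C=C and K=0])
        (use norm_le_of_weighted_le[OF decay] in auto)
    show "weight y ^ k * norm (?g x * h (y - ?u x)) \<le> C * (weight x ^ k * norm (?g x))" for x
    proof -
      have "weight y ^ k * norm (h (y - ?u x)) \<le> weight (?u x) ^ k * C"
        by (rule weighted_translate_le[OF decay]) simp
      also have "\<dots> \<le> weight x ^ k * C"
        by (intro mult_right_mono weight_inverse_Suc_scaleR_power_le C_nonneg)
      finally have
        "norm (?g x) * (weight y ^ k * norm (h (y - ?u x))) \<le> norm (?g x) * (weight x ^ k * C)"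
        by (intro mult_left_mono) auto
      then show ?thesis by (simp add: norm_mult mult_ac)
    qed
  qed (intro integrable_mult_right rapidly_integrable_weight gauss_rapid)
  have "weight y ^ k * norm (mollify n h y) \<le> ?c * (\<integral>x. C * (weight x ^ k * norm (?g x)) \<partial>lborel)"
    for n y
    using mult_left_mono[OF rescaled_bound[of y n], of ?c]
    unfolding mollify_eq_rescaled[OF h_measurable] norm_mult norm_of_real
    by (simp add: mult_ac)
  then show ?thesis by (rule that)
qed

lemma tempered_mollify_tendsto:
  fixes T :: "('a::euclidean_space \<Rightarrow> complex) \<Rightarrow> complex"
  assumes T_tempered: "tempered T" and \<phi>_schwartz: "schwartz \<phi>"
  shows "(\<lambda>n. T (mollify n \<phi>)) \<longlonglongrightarrow> T \<phi>"
proof -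
  let ?h = "\<lambda>x. T (\<lambda>y. \<phi> (y - x))"
  note translates_family = schwartz_family_translate[OF \<phi>_schwartz]
  have gauss_rapid: "rapidly_integrable (gauss ((real (Suc n))\<^sup>2) (0::'a))" for n
    by (intro schwartz_rapidly_integrable schwartz_gauss) simp
  have cont: "continuous_on UNIV (\<lambda>x. ?h (- x))"
    by (rule continuous_on_compose2[OF tempered_family_continuous[OF T_tempered translates_family]])
      (auto intro!: continuous_intros)
  obtain C K where "0 \<le> C" and growth: "\<And>x. norm (?h x) \<le> C * weight x ^ K"
    using tempered_family_bounds[OF T_tempered translates_family] by metis
  have "T (mollify n \<phi>) = mollify n (\<lambda>x. ?h (- x)) 0" for n
    unfolding mollify_def[abs_def]
      tempered_cmult[OF T_tempered schwartz_weighted_integral[OF gauss_rapid translates_family]]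
      tempered_integral_exchange[OF T_tempered gauss_rapid translates_family] by simp
  moreover have "(\<lambda>n. mollify n (\<lambda>x. ?h (- x)) 0) \<longlonglongrightarrow> ?h (- 0)"
  proof (rule mollify_tendsto)
    show "(\<lambda>x. ?h (- x)) \<in> borel_measurable borel"
      by (rule borel_measurable_continuous_onI[OF cont])
    show "norm (?h (- x)) \<le> C * weight x ^ K" for x using growth[of "- x"] by simp
    show "isCont (\<lambda>x. ?h (- x)) 0" using cont by (simp add: continuous_on_eq_continuous_at)
  qed
  ultimately show ?thesis by simp
qed

lemma tempered_eq_of_gauss:
  fixes S T :: "('a::euclidean_space \<Rightarrow> complex) \<Rightarrow> complex"
  assumes S_tempered: "tempered S" and T_tempered: "tempered T"
    and gauss_eq: "\<And>s b. s > 0 \<Longrightarrow> S (gauss s b) = T (gauss s b)"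
  shows "S = T"
proof (rule tempered_eqI[OF S_tempered T_tempered])
  fix \<phi> :: "'a \<Rightarrow> complex" assume \<phi>_schwartz: "schwartz \<phi>"
  have "S (mollify n \<phi>) = T (mollify n \<phi>)" for n
  proof -
    define s where "s = (real (Suc n))\<^sup>2"
    have s_pos: "s > 0" by (simp add: s_def)
    have gauss_schwartz: "schwartz (gauss s b)" for b :: 'a by (rule schwartz_gauss[OF s_pos])
    note family = schwartz_rapidly_integrable[OF \<phi>_schwartz]
      schwartz_family_translate[OF gauss_schwartz]
    have "S (\<lambda>y. gauss s 0 (y - x)) = T (\<lambda>y. gauss s 0 (y - x))" for x
      unfolding gauss_translate
      by (simp add: tempered_cmult[OF S_tempered gauss_schwartz]
        tempered_cmult[OF T_tempered gauss_schwartz] gauss_eq[OF s_pos])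
    then show ?thesis
      unfolding mollify_eq_convolution[OF schwartz_measurable[OF \<phi>_schwartz], abs_def]
        s_def[symmetric]
      by (simp add: tempered_cmult[OF S_tempered schwartz_weighted_integral[OF family]]
        tempered_cmult[OF T_tempered schwartz_weighted_integral[OF family]]
        tempered_integral_exchange[OF S_tempered family]
        tempered_integral_exchange[OF T_tempered family])
  qed
  then show "S \<phi> = T \<phi>"
    using LIMSEQ_unique[OF tempered_mollify_tendsto[OF S_tempered \<phi>_schwartz]]
      tempered_mollify_tendsto[OF T_tempered \<phi>_schwartz] by simp
qed

section \<open>Square-integrable functions as distributions\<close>

definition inverse_weight :: "'a::euclidean_space \<Rightarrow> complex" where
  "inverse_weight x = of_real (inverse (weight x ^ DIM('a)))"

lemma norm_inverse_weight:
  "norm (inverse_weight (x :: 'a::euclidean_space)) = inverse (weight x ^ DIM('a))"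
  unfolding inverse_weight_def norm_of_real using weight_power_pos by (intro abs_of_pos) simp

lemma square_integrable_inverse_weight:
  "square_integrable (inverse_weight :: 'a::euclidean_space \<Rightarrow> complex)"
  unfolding square_integrable_def
proof
  have "(inverse_weight :: 'a \<Rightarrow> complex) \<in> borel_measurable borel"
    unfolding inverse_weight_def by measurable
  then show "(inverse_weight :: 'a \<Rightarrow> complex) \<in> borel_measurable lebesgue"
    by (auto intro: measurable_completion)
  have "integrable lebesgue (\<lambda>x::'a. inverse (weight x ^ (2 * DIM('a))))"
    using integrable_inverse_weight by (subst integrable_completion) measurable
  then show "integrable lebesgue (\<lambda>x::'a. (cmod (inverse_weight x))\<^sup>2)"
    unfolding norm_inverse_weight by (simp add: power_inverse power_mult[symmetric] mult.commute)
qed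

lemma
  fixes f :: "'a::euclidean_space \<Rightarrow> complex"
  assumes f_measurable: "f \<in> borel_measurable borel"
    and decay: "\<And>x. weight x ^ DIM('a) * norm (f x) \<le> C"
  shows square_integrable_of_decay: "square_integrable f"
    and L2_norm_fun_le_of_decay: "L2_norm_fun f \<le> C * L2_norm_fun (inverse_weight :: 'a \<Rightarrow> complex)"
proof -
  have "0 \<le> C" using order_trans[OF norm_ge_zero norm_le_of_weighted_le[OF decay]] .
  then have dominated: "norm (f x) \<le> norm (of_real C * inverse_weight x)" for x
    using decay[of x] by (simp add: norm_mult norm_inverse_weight weight_power_mult_le_iff)
  have f_lebesgue: "f \<in> borel_measurable lebesgue"
    using f_measurable by (auto intro: measurable_completion)
  note dominating = square_integrable_cmult[OF square_integrable_inverse_weight, of "of_real C"]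
  show "square_integrable f"
    by (rule square_integrable_dominated[OF f_lebesgue dominating dominated])
  show "L2_norm_fun f \<le> C * L2_norm_fun (inverse_weight :: 'a \<Rightarrow> complex)"
    using L2_norm_fun_mono[OF f_lebesgue dominating dominated] \<open>0 \<le> C\<close>
    by (simp add: L2_norm_fun_cmult)
qed

lemma schwartz_square_integrable: "schwartz f \<Longrightarrow> square_integrable f"
  by (metis schwartz_decay square_integrable_of_decay schwartz_measurable)

lemma L2_norm_fun_le_schwartz_norm:
  fixes \<phi> :: "'a::euclidean_space \<Rightarrow> complex"
  assumes \<phi>_schwartz: "schwartz \<phi>"
  shows "L2_norm_fun \<phi> \<le> schwartz_norm DIM('a) \<phi> * L2_norm_fun (inverse_weight :: 'a \<Rightarrow> complex)"
proof (rule L2_norm_fun_le_of_decay[OF schwartz_measurable[OF \<phi>_schwartz]])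
  show "weight x ^ DIM('a) * norm (\<phi> x) \<le> schwartz_norm DIM('a) \<phi>" for x
    using weighted_pderivs_le_schwartz_seminorm[OF \<phi>_schwartz, of "[]"]
      schwartz_seminorm_le_schwartz_norm[OF \<phi>_schwartz order_refl, of "[]"]
    by (simp add: multi_indices_def) (meson order_trans)
qed

lemma dist_of_apply: "schwartz \<phi> \<Longrightarrow> dist_of f \<phi> = (\<integral>x. f x * \<phi> x \<partial>lebesgue)"
  by (simp add: dist_of_def)

lemma dist_of_bound:
  "square_integrable f \<Longrightarrow> schwartz \<phi> \<Longrightarrow> cmod (dist_of f \<phi>) \<le> L2_norm_fun f * L2_norm_fun \<phi>"
  by (simp add: dist_of_apply L2_pairing_bound schwartz_square_integrable)

lemma dist_of_diff:
  assumes "square_integrable f" "square_integrable g"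
  shows "dist_of (\<lambda>x. f x - g x) = (\<lambda>\<phi>. dist_of f \<phi> - dist_of g \<phi>)"
  using square_integrable_mult[OF assms(1) schwartz_square_integrable]
    square_integrable_mult[OF assms(2) schwartz_square_integrable]
  by (auto simp: dist_of_def fun_eq_iff left_diff_distrib)

lemma dist_of_tendsto:
  assumes f_L2: "\<And>n. square_integrable (f n)" and g_L2: "square_integrable g"
    and lim: "(\<lambda>n. L2_norm_fun (\<lambda>x. f n x - g x)) \<longlonglongrightarrow> 0" and \<phi>_schwartz: "schwartz \<phi>"
  shows "(\<lambda>n. dist_of (f n) \<phi>) \<longlonglongrightarrow> dist_of g \<phi>"
proof -
  have "(\<lambda>n. dist_of (f n) \<phi> - dist_of g \<phi>) \<longlonglongrightarrow> 0"
  proof (rule Lim_null_comparison[OF always_eventually[OF allI]])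
    show "norm (dist_of (f n) \<phi> - dist_of g \<phi>) \<le> L2_norm_fun (\<lambda>x. f n x - g x) * L2_norm_fun \<phi>"
      for n
      using dist_of_bound[OF square_integrable_diff[OF f_L2 g_L2] \<phi>_schwartz]
      by (simp add: dist_of_diff[OF f_L2 g_L2])
    show "(\<lambda>n. L2_norm_fun (\<lambda>x. f n x - g x) * L2_norm_fun \<phi>) \<longlonglongrightarrow> 0"
      by (rule tendsto_mult_left_zero[OF lim])
  qed
  then show ?thesis by (rule LIM_zero_cancel)
qed

lemma dist_of_tempered:
  fixes f :: "'a::euclidean_space \<Rightarrow> complex"
  assumes f_L2: "square_integrable f"
  shows "tempered (dist_of f)"
proof (rule temperedI)
  note integrable = square_integrable_mult[OF f_L2 schwartz_square_integrable]
  show "dist_of f (\<lambda>x. \<phi> x + \<psi> x) = dist_of f \<phi> + dist_of f \<psi>" if "schwartz \<phi>" "schwartz \<psi>" for \<phi> \<psi>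
    using that integrable by (simp add: dist_of_apply schwartz_add distrib_left)
  show "dist_of f (\<lambda>x. c * \<phi> x) = c * dist_of f \<phi>" if "schwartz \<phi>" for c \<phi>
    using that by (simp add: dist_of_apply schwartz_cmult mult.left_commute[of _ c])
  show "dist_of f \<phi> = 0" if "\<not> schwartz \<phi>" for \<phi> using that by (simp add: dist_of_def)
  show "norm (dist_of f \<phi>)
      \<le> (L2_norm_fun f * L2_norm_fun (inverse_weight :: 'a \<Rightarrow> complex)) * schwartz_norm DIM('a) \<phi>"
    if "schwartz \<phi>" for \<phi>
    using order_trans[OF dist_of_bound[OF f_L2 that]
      mult_left_mono[OF L2_norm_fun_le_schwartz_norm[OF that]]]
    by (simp add: L2_norm_fun_nonneg mult_ac)
qed

text \<open>\<open>h\<close> is the limit of its mollifications, which are Schwartz functions.\<close>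

lemma pairing_continuous_eq_0:
  fixes f h :: "'a::euclidean_space \<Rightarrow> complex"
  assumes f_L2: "square_integrable f" and orth: "\<And>\<phi>. schwartz \<phi> \<Longrightarrow> (\<integral>x. f x * \<phi> x \<partial>lebesgue) = 0"
    and h_continuous: "continuous_on UNIV h" and decay: "rapidly_decreasing h"
  shows "(\<integral>x. f x * h x \<partial>lebesgue) = 0"
proof -
  have h_borel: "h \<in> borel_measurable borel"
    by (rule borel_measurable_continuous_onI[OF h_continuous])
  have [measurable]: "f \<in> borel_measurable lebesgue" "h \<in> borel_measurable lebesgue"
    using square_integrable_measurable[OF f_L2] h_borel by (auto intro: measurable_completion)
  have mollify_schwartz: "schwartz (mollify n h)" for n
    by (intro schwartz_mollify rapidly_decreasing_rapidly_integrable h_borel decay)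
  have [measurable]: "mollify n h \<in> borel_measurable lebesgue" for n
    using schwartz_measurable[OF mollify_schwartz] by (auto intro: measurable_completion)
  obtain C where C_bound: "\<And>x. weight x ^ DIM('a) * norm (h x) \<le> C"
    using decay by (metis rapidly_decreasingE)
  obtain W where W_bound: "\<And>n y. weight y ^ DIM('a) * norm (mollify n h y) \<le> W"
    using mollify_uniform_decay[OF h_borel C_bound] by blast
  have "(\<lambda>n. \<integral>x. f x * mollify n h x \<partial>lebesgue) \<longlonglongrightarrow> (\<integral>x. f x * h x \<partial>lebesgue)"
  proof (rule integral_dominated_convergence[where w="\<lambda>x. W * norm (f x * inverse_weight x)"])
    show "integrable lebesgue (\<lambda>x. W * norm (f x * inverse_weight x))"
      by (intro integrable_mult_right integrable_norm square_integrable_mult f_L2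
        square_integrable_inverse_weight)
    show "AE x in lebesgue. (\<lambda>n. f x * mollify n h x) \<longlonglongrightarrow> f x * h x"
    proof (intro AE_I2 tendsto_mult tendsto_const mollify_tendsto[OF h_borel, where C=C and K=0])
      show "norm (h x) \<le> C * weight x ^ 0" for x using norm_le_of_weighted_le[OF C_bound] by simp
      show "isCont h x" for x using h_continuous by (simp add: continuous_on_eq_continuous_at)
    qed
    show "AE x in lebesgue. norm (f x * mollify n h x) \<le> W * norm (f x * inverse_weight x)" for n
    proof (rule AE_I2)
      fix x
      have "norm (mollify n h x) \<le> W * norm (inverse_weight x)"
        using W_bound[of x n] unfolding weight_power_mult_le_iff norm_inverse_weight .
      from mult_left_mono[OF this norm_ge_zero[of "f x"]]
      show "norm (f x * mollify n h x) \<le> W * norm (f x * inverse_weight x)"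
        by (simp add: norm_mult mult_ac)
    qed
  qed measurable
  then show ?thesis using orth[OF mollify_schwartz] by (simp add: LIMSEQ_const_iff)
qed

lemma lebesgue_measurable_AE_limit_bounded_continuous:
  fixes u :: "'a::euclidean_space \<Rightarrow> 'b::euclidean_space"
  assumes u_measurable: "u \<in> borel_measurable lebesgue" and norm_le_1: "\<And>x. norm (u x) \<le> 1"
  obtains g where "\<And>n::nat. continuous_on UNIV (g n)" "\<And>n x. norm (g n x) \<le> 1"
    "AE x in lebesgue. (\<lambda>n. g n x) \<longlonglongrightarrow> u x"
proof -
  obtain E g where "negligible E" and g_continuous: "\<And>n::nat. continuous_on UNIV (g n)"
    and lim: "\<And>x. x \<notin> E \<Longrightarrow> (\<lambda>n. g n x) \<longlonglongrightarrow> u x"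
    using lebesgue_measurable_imp_measurable_on[OF u_measurable, of UNIV]
    unfolding measurable_on_def by auto
  define clip :: "'b \<Rightarrow> 'b" where "clip v = v /\<^sub>R max 1 (norm v)" for v
  have cont_clip: "continuous_on UNIV clip"
    unfolding clip_def by (intro continuous_intros) (auto simp: max_def)
  show ?thesis
  proof
    show "continuous_on UNIV (\<lambda>x. clip (g n x))" for n
      by (rule continuous_on_compose2[OF cont_clip g_continuous]) simp
    show "norm (clip (g n x)) \<le> 1" for n x
      by (simp add: clip_def divide_inverse[symmetric] mult.commute[of "inverse _"] divide_le_eq_1
        less_max_iff_disj)
    have "AE x in lebesgue. x \<notin> E"
      using \<open>negligible E\<close> by (auto simp: negligible_iff_null_sets intro: AE_not_in)
    then show "AE x in lebesgue. (\<lambda>n. clip (g n x)) \<longlonglongrightarrow> u x"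
    proof eventually_elim
      case (elim x)
      have "isCont clip (u x)" using cont_clip by (simp add: continuous_on_eq_continuous_at)
      from isCont_tendsto_compose[OF this lim[OF elim]]
      have "(\<lambda>n. clip (g n x)) \<longlonglongrightarrow> clip (u x)" .
      also have "clip (u x) = u x" using norm_le_1[of x] by (simp add: clip_def max_absorb1)
      finally show ?case .
    qed
  qed
qed

lemma pairing_gauss_mult_eq_0:
  fixes f u :: "'a::euclidean_space \<Rightarrow> complex"
  assumes f_L2: "square_integrable f" and orth: "\<And>\<phi>. schwartz \<phi> \<Longrightarrow> (\<integral>x. f x * \<phi> x \<partial>lebesgue) = 0"
    and u_measurable [measurable]: "u \<in> borel_measurable lebesgue"
    and norm_le_1: "\<And>x. norm (u x) \<le> 1"
  shows "(\<integral>x. f x * (gauss 1 0 x * u x) \<partial>lebesgue) = 0"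
proof -
  let ?e = "gauss 1 (0::'a)"
  have gauss_schwartz: "schwartz ?e" by (intro schwartz_gauss) simp
  have [measurable]: "f \<in> borel_measurable lebesgue" "?e \<in> borel_measurable lebesgue"
    using f_L2 schwartz_square_integrable[OF gauss_schwartz]
    by (auto intro: square_integrable_measurable)
  obtain g where g_continuous: "\<And>n::nat. continuous_on UNIV (g n)" "\<And>n x. norm (g n x) \<le> 1"
    and lim: "AE x in lebesgue. (\<lambda>n. g n x) \<longlonglongrightarrow> u x"
    using lebesgue_measurable_AE_limit_bounded_continuous[OF u_measurable norm_le_1] by blast
  have dominated: "norm (?e x * g n x) \<le> norm (?e x)" for n x
    using g_continuous(2)[of n x] by (simp add: norm_mult mult_left_le)
  have cont: "continuous_on UNIV (\<lambda>x. ?e x * g n x)" for n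
    by (intro continuous_on_mult schwartz_continuous gauss_schwartz g_continuous)
  have [measurable]: "(\<lambda>x. ?e x * g n x) \<in> borel_measurable lebesgue" for n
    using borel_measurable_continuous_onI[OF cont] by (auto intro: measurable_completion)
  have "(\<integral>x. f x * (?e x * g n x) \<partial>lebesgue) = 0" for n
  proof (rule pairing_continuous_eq_0[OF f_L2 _ cont])
    show "rapidly_decreasing (\<lambda>x. ?e x * g n x)"
      by (rule rapidly_decreasing_dominated[OF schwartz_rapidly_decreasing[OF gauss_schwartz]
        dominated])
  qed (rule orth)
  moreover have "(\<lambda>n. \<integral>x. f x * (?e x * g n x) \<partial>lebesgue) \<longlonglongrightarrow> (\<integral>x. f x * (?e x * u x) \<partial>lebesgue)"
  proof (rule integral_dominated_convergence[where w="\<lambda>x. norm (f x * ?e x)"])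
    show "integrable lebesgue (\<lambda>x. norm (f x * ?e x))"
      by (intro integrable_norm square_integrable_mult f_L2 schwartz_square_integrable
        gauss_schwartz)
    show "AE x in lebesgue. (\<lambda>n. f x * (?e x * g n x)) \<longlonglongrightarrow> f x * (?e x * u x)"
      using lim by eventually_elim (intro tendsto_intros)
    show "AE x in lebesgue. norm (f x * (?e x * g n x)) \<le> norm (f x * ?e x)" for n
      unfolding norm_mult[of "f _"] by (intro AE_I2 mult_left_mono dominated) simp
  qed measurable
  ultimately show ?thesis by (simp add: LIMSEQ_const_iff)
qed

lemma pairing_eq_0_imp_AE_eq_0:
  fixes f :: "'a::euclidean_space \<Rightarrow> complex"
  assumes f_L2: "square_integrable f" and orth: "\<And>\<phi>. schwartz \<phi> \<Longrightarrow> (\<integral>x. f x * \<phi> x \<partial>lebesgue) = 0"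
  shows "AE x in lebesgue. f x = 0"
proof -
  let ?e = "gauss 1 (0::'a)"
  have gauss_L2: "square_integrable ?e" by (intro schwartz_square_integrable schwartz_gauss) simp
  have [measurable]: "f \<in> borel_measurable lebesgue" "(\<lambda>x. cnj (f x)) \<in> borel_measurable lebesgue"
    using f_L2 square_integrable_cnj[OF f_L2] by (auto intro: square_integrable_measurable)
  define u where "u x = inverse (norm (f x)) *\<^sub>R cnj (f x)" for x
  have f_mult_u: "f x * u x = of_real (norm (f x))" for x
    by (cases "f x = 0")
      (simp_all add: u_def complex_norm_square[symmetric] scaleR_conv_of_real power2_eq_square
        field_simps del: of_real_power)
  have "f x * (?e x * u x) = of_real (norm (f x * ?e x))" for x
  proof -
    have "f x * (?e x * u x) = ?e x * (f x * u x)" by simp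
    then show ?thesis unfolding f_mult_u by (simp add: norm_mult gauss_def)
  qed
  moreover have "(\<integral>x. f x * (?e x * u x) \<partial>lebesgue) = 0"
  proof (rule pairing_gauss_mult_eq_0[OF f_L2 orth])
    show "u \<in> borel_measurable lebesgue" unfolding u_def by measurable
    show "norm (u x) \<le> 1" for x by (cases "f x = 0") (simp_all add: u_def)
  qed
  ultimately have "(\<integral>x. norm (f x * ?e x) \<partial>lebesgue) = 0" by simp
  then have "AE x in lebesgue. norm (f x * ?e x) = 0"
    using integral_nonneg_eq_0_iff_AE[OF integrable_norm,
      OF square_integrable_mult[OF f_L2 gauss_L2]] by simp
  then show ?thesis by eventually_elim (simp add: gauss_def)
qed

lemma dist_of_eq_imp_L2_norm_fun_eq:
  assumes f_L2: "square_integrable f" and g_L2: "square_integrable g"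
    and dist_eq: "dist_of f = dist_of g"
  shows "L2_norm_fun f = L2_norm_fun g"
proof -
  have "AE x in lebesgue. f x - g x = 0"
  proof (rule pairing_eq_0_imp_AE_eq_0[OF square_integrable_diff[OF f_L2 g_L2]])
    show "(\<integral>x. (f x - g x) * \<phi> x \<partial>lebesgue) = 0" if "schwartz \<phi>" for \<phi>
      using fun_cong[OF dist_of_diff[OF f_L2 g_L2], of \<phi>] dist_eq that by (simp add: dist_of_apply)
  qed
  then have "AE x in lebesgue. f x = g x" by eventually_elim simp
  then show ?thesis by (rule L2_norm_fun_cong_AE[OF f_L2 g_L2])
qed

section \<open>Hilbert spaces of tempered distributions\<close>

lemma hilbert_in_S'_imp_hilbert_carrier:
  assumes "hilbert_in_S' V N"
  shows "hilbert_carrier (\<lambda>c T \<phi>. c * T \<phi>) V N"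
proof unfold_locales
  show "(\<lambda>\<phi>. a * (S + T) \<phi>) = (\<lambda>\<phi>. a * S \<phi>) + (\<lambda>\<phi>. a * T \<phi>)" for a
    and S T :: "('a \<Rightarrow> complex) \<Rightarrow> complex"
    by (simp add: fun_eq_iff distrib_left)
  show "(\<lambda>\<phi>. (a + b) * T \<phi>) = (\<lambda>\<phi>. a * T \<phi>) + (\<lambda>\<phi>. b * T \<phi>)" for a b
    and T :: "('a \<Rightarrow> complex) \<Rightarrow> complex"
    by (simp add: fun_eq_iff distrib_right)
qed (use assms in \<open>unfold hilbert_in_S'_def plus_fun_def zero_fun_def fun_diff_def,
    auto simp: mult.assoc\<close>)

locale hilbert_distributions =
  fixes V :: "(('a::euclidean_space \<Rightarrow> complex) \<Rightarrow> complex) set"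
    and N :: "(('a \<Rightarrow> complex) \<Rightarrow> complex) \<Rightarrow> real"
  assumes hilbert_in_S': "hilbert_in_S' V N"
begin

sublocale hilbert_carrier "\<lambda>c T \<phi>. c * T \<phi>" V N
  by (rule hilbert_in_S'_imp_hilbert_carrier[OF hilbert_in_S'])

lemma V_tempered: "T \<in> V \<Longrightarrow> tempered T"
  using hilbert_in_S' unfolding hilbert_in_S'_def by blast

lemma evaluation_bounded:
  assumes "schwartz \<phi>"
  obtains C where "\<And>T. T \<in> V \<Longrightarrow> cmod (T \<phi>) \<le> C * N T"
  using hilbert_in_S' assms unfolding hilbert_in_S'_def by metis

lemma evaluation_tendsto:
  assumes u_in_V: "\<And>n. u n \<in> V" and T_in_V: "T \<in> V" and lim: "(\<lambda>n. N (u n - T)) \<longlonglongrightarrow> 0"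
    and \<phi>_schwartz: "schwartz \<phi>"
  shows "(\<lambda>n. u n \<phi>) \<longlonglongrightarrow> T \<phi>"
proof -
  obtain C where C_bound: "\<And>T. T \<in> V \<Longrightarrow> cmod (T \<phi>) \<le> C * N T"
    using evaluation_bounded[OF \<phi>_schwartz] by blast
  have "(\<lambda>n. u n \<phi> - T \<phi>) \<longlonglongrightarrow> 0"
  proof (rule Lim_null_comparison[OF always_eventually[OF allI]])
    show "norm (u n \<phi> - T \<phi>) \<le> C * N (u n - T)" for n
      using C_bound[OF diff_V[OF u_in_V T_in_V]] by simp
    show "(\<lambda>n. C * N (u n - T)) \<longlonglongrightarrow> 0" by (rule tendsto_mult_right_zero[OF lim])
  qed
  then show ?thesis by (rule LIM_zero_cancel)
qed

lemma representer_exists: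
  assumes \<phi>_schwartz: "schwartz \<phi>"
  shows "\<exists>K. K \<in> V \<and> (\<forall>T\<in>V. re_inner T K = Re (T \<phi>))"
proof -
  obtain C where C_bound: "\<And>T. T \<in> V \<Longrightarrow> cmod (T \<phi>) \<le> C * N T"
    using evaluation_bounded[OF \<phi>_schwartz] by blast
  interpret graph: bounded_functional_graph "\<lambda>c T \<phi>. c * T \<phi>" V N "(\<lambda>T. (T, Re (T \<phi>))) ` V" C
  proof unfold_locales
    show "a \<le> C * N P" if "(P, a) \<in> (\<lambda>T. (T, Re (T \<phi>))) ` V" for P a
      using that C_bound complex_Re_le_cmod order_trans by blast
  qed (use zero_V add_V scale_V in auto)
  have "\<exists>K\<in>V. \<forall>T\<in>V. re_inner K T = Re (T \<phi>)" by (rule graph.riesz_representation) blast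
  then show ?thesis using re_inner_commute by auto
qed

definition representer :: "('a \<Rightarrow> complex) \<Rightarrow> ('a \<Rightarrow> complex) \<Rightarrow> complex" where
  "representer \<phi> = (SOME K. K \<in> V \<and> (\<forall>T\<in>V. re_inner T K = Re (T \<phi>)))"

lemma representer_V: "schwartz \<phi> \<Longrightarrow> representer \<phi> \<in> V"
  and re_inner_representer: "schwartz \<phi> \<Longrightarrow> T \<in> V \<Longrightarrow> re_inner T (representer \<phi>) = Re (T \<phi>)"
  using someI_ex[OF representer_exists, of \<phi>] unfolding representer_def by auto

lemma representer_unique:
  assumes "schwartz \<phi>" "K \<in> V" "\<And>T. T \<in> V \<Longrightarrow> re_inner T K = Re (T \<phi>)"
  shows "K = representer \<phi>"
  using assms by (intro re_inner_right_eq_imp_eq) (simp_all add: representer_V re_inner_representer)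

lemma representer_tempered: "schwartz \<phi> \<Longrightarrow> tempered (representer \<phi>)"
  by (intro V_tempered representer_V)

lemma representer_add:
  assumes \<phi>_schwartz: "schwartz \<phi>" and \<psi>_schwartz: "schwartz \<psi>"
  shows "representer (\<lambda>x. \<phi> x + \<psi> x) = representer \<phi> + representer \<psi>"
proof (rule representer_unique[symmetric])
  show "re_inner T (representer \<phi> + representer \<psi>) = Re (T (\<lambda>x. \<phi> x + \<psi> x))" if T_in_V: "T \<in> V"
    for T
    by (simp add: re_inner_add_right re_inner_representer representer_V tempered_add[OF V_tempered]
      T_in_V \<phi>_schwartz \<psi>_schwartz)
qed (intro schwartz_add add_V representer_V \<phi>_schwartz \<psi>_schwartz)+

lemma representer_diff:
  assumes \<phi>_schwartz: "schwartz \<phi>" and \<psi>_schwartz: "schwartz \<psi>"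
  shows "representer (\<lambda>x. \<phi> x - \<psi> x) = representer \<phi> - representer \<psi>"
  using representer_add[OF schwartz_diff[OF \<phi>_schwartz \<psi>_schwartz] \<psi>_schwartz] by simp

lemma representer_scale_real:
  assumes \<phi>_schwartz: "schwartz \<phi>"
  shows "representer (\<lambda>x. of_real t * \<phi> x) = (\<lambda>\<theta>. of_real t * representer \<phi> \<theta>)"
proof (rule representer_unique[symmetric])
  show "re_inner T (\<lambda>\<theta>. of_real t * representer \<phi> \<theta>) = Re (T (\<lambda>x. of_real t * \<phi> x))"
    if T_in_V: "T \<in> V" for T
  proof -
    note representer_in_V = representer_V[OF \<phi>_schwartz]
    have "re_inner T (\<lambda>\<theta>. of_real t * representer \<phi> \<theta>) = t * re_inner T (representer \<phi>)"
      using re_inner_scale_real_left[OF representer_in_V T_in_V]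
        re_inner_commute[OF T_in_V scale_V[OF representer_in_V]]
        re_inner_commute[OF T_in_V representer_in_V]
      by simp
    then show ?thesis
      by (simp add: re_inner_representer tempered_cmult[OF V_tempered] T_in_V \<phi>_schwartz)
  qed
qed (intro schwartz_cmult scale_V representer_V \<phi>_schwartz)+

lemma representer_hermitian:
  assumes \<phi>_schwartz: "schwartz \<phi>" and \<psi>_schwartz: "schwartz \<psi>"
  shows "representer \<phi> \<psi> = cnj (representer \<psi> \<phi>)"
proof (rule complex_eqI)
  note representers_in_V = representer_V[OF \<phi>_schwartz] representer_V[OF \<psi>_schwartz]
  show "Re (representer \<phi> \<psi>) = Re (cnj (representer \<psi> \<phi>))"
    using re_inner_representer[OF \<phi>_schwartz representers_in_V(2)]
      re_inner_representer[OF \<psi>_schwartz representers_in_V(1)]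
      re_inner_commute[OF representers_in_V]
    by simp
  have "re_inner (\<lambda>\<theta>. \<i> * representer \<psi> \<theta>) (representer \<phi>)
      = - re_inner (\<lambda>\<theta>. \<i> * representer \<phi> \<theta>) (representer \<psi>)"
    using re_inner_scale_ii_left[OF representers_in_V(2,1)]
      re_inner_commute[OF representers_in_V(2) scale_V[OF representers_in_V(1)]]
    by simp
  then have "Re (\<i> * representer \<psi> \<phi>) = - Re (\<i> * representer \<phi> \<psi>)"
    using re_inner_representer[OF \<phi>_schwartz scale_V[OF representers_in_V(2)]]
      re_inner_representer[OF \<psi>_schwartz scale_V[OF representers_in_V(1)]]
    by simp
  then show "Im (representer \<phi> \<psi>) = Im (cnj (representer \<psi> \<phi>))" by simp
qed

lemma representer_cmult:
  assumes \<phi>_schwartz: "schwartz \<phi>" and \<psi>_schwartz: "schwartz \<psi>"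
  shows "representer (\<lambda>x. c * \<phi> x) \<psi> = cnj c * representer \<phi> \<psi>"
  using representer_hermitian[OF schwartz_cmult[OF \<phi>_schwartz] \<psi>_schwartz, of c]
    representer_hermitian[OF \<phi>_schwartz \<psi>_schwartz]
    tempered_cmult[OF representer_tempered[OF \<psi>_schwartz] \<phi>_schwartz] by simp

lemma representer_self: "schwartz \<phi> \<Longrightarrow> representer \<phi> \<phi> = of_real ((N (representer \<phi>))\<^sup>2)"
  using re_inner_representer[OF _ representer_V, of \<phi> \<phi>] re_inner_self[OF representer_V, of \<phi>]
    representer_hermitian[of \<phi> \<phi>]
  by (auto simp: complex_eq_iff)

lemma isometry_representer:
  assumes \<phi>_schwartz: "schwartz \<phi>" and \<phi>'_schwartz: "schwartz \<phi>'"
    and U_V: "\<And>T. T \<in> V \<Longrightarrow> U T \<in> V" and N_U: "\<And>T. T \<in> V \<Longrightarrow> N (U T) = N T"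
    and U_add: "\<And>S T. U (S + T) = U S + U T" and U_diff: "\<And>S T. U (S - T) = U S - U T"
    and U'_V: "\<And>T. T \<in> V \<Longrightarrow> U' T \<in> V" and inverse: "\<And>T. T \<in> V \<Longrightarrow> U (U' T) = T"
    and eval: "\<And>T. T \<in> V \<Longrightarrow> U' T \<phi> = T \<phi>'"
  shows "U (representer \<phi>) = representer \<phi>'"
proof (rule representer_unique[OF \<phi>'_schwartz])
  note representer_in_V = representer_V[OF \<phi>_schwartz]
  show "U (representer \<phi>) \<in> V" by (rule U_V[OF representer_in_V])
  show "re_inner T (U (representer \<phi>)) = Re (T \<phi>')" if T_in_V: "T \<in> V" for T
  proof -
    have "re_inner T (U (representer \<phi>)) = re_inner (U (U' T)) (U (representer \<phi>))"
      by (simp add: inverse T_in_V)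
    also have "\<dots> = re_inner (U' T) (representer \<phi>)"
      unfolding re_inner_def U_add[symmetric] U_diff[symmetric]
      using N_U add_V diff_V U'_V[OF T_in_V] representer_in_V
      by simp
    also have "\<dots> = Re (T \<phi>')"
      using re_inner_representer[OF \<phi>_schwartz U'_V[OF T_in_V]] eval[OF T_in_V] by simp
    finally show ?thesis .
  qed
qed

definition representer_graph ::
  "(('a \<Rightarrow> complex) \<Rightarrow> complex) \<Rightarrow> ((('a \<Rightarrow> complex) \<Rightarrow> complex) \<times> real) set" where
  "representer_graph T = (\<lambda>\<phi>. (representer \<phi>, Re (T \<phi>))) ` {\<phi>. schwartz \<phi>}"

lemma representer_graphI: "schwartz \<phi> \<Longrightarrow> (representer \<phi>, Re (T \<phi>)) \<in> representer_graph T"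
  by (simp add: representer_graph_def)

lemma representer_graphE:
  assumes "(P, a) \<in> representer_graph T"
  obtains \<phi> where "schwartz \<phi>" "P = representer \<phi>" "a = Re (T \<phi>)"
  using assms by (auto simp: representer_graph_def)

lemma bounded_functional_graph_representer:
  assumes T_tempered: "tempered T"
    and bound: "\<And>\<phi>. schwartz \<phi> \<Longrightarrow> Re (T \<phi>) \<le> M * N (representer \<phi>)"
  shows "bounded_functional_graph (\<lambda>c T \<phi>. c * T \<phi>) V N (representer_graph T) M"
proof unfold_locales
  show "representer_graph T \<noteq> {}" using representer_graphI[OF schwartz_zero] by blast
  show "P \<in> V" "a \<le> M * N P" if "(P, a) \<in> representer_graph T" for P a
    using that by (auto elim!: representer_graphE simp: representer_V bound)
  show "(P + Q, a + b) \<in> representer_graph T"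
    if P_graph: "(P, a) \<in> representer_graph T" and Q_graph: "(Q, b) \<in> representer_graph T" for P Q a b
  proof -
    obtain \<phi> where "schwartz \<phi>" "P = representer \<phi>" "a = Re (T \<phi>)"
      using P_graph by (rule representer_graphE)
    moreover obtain \<psi> where "schwartz \<psi>" "Q = representer \<psi>" "b = Re (T \<psi>)"
      using Q_graph by (rule representer_graphE)
    ultimately show ?thesis
      using representer_graphI[OF schwartz_add, of \<phi> \<psi> T]
      by (simp add: representer_add tempered_add[OF T_tempered])
  qed
  show "((\<lambda>\<theta>. of_real t * P \<theta>), t * a) \<in> representer_graph T"
    if P_graph: "(P, a) \<in> representer_graph T" for P a t
  proof -
    obtain \<phi> where "schwartz \<phi>" "P = representer \<phi>" "a = Re (T \<phi>)"
      using P_graph by (rule representer_graphE)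
    then show ?thesis
      using representer_graphI[OF schwartz_cmult, of \<phi> "of_real t" T]
      by (simp add: representer_scale_real tempered_cmult[OF T_tempered])
  qed
qed

text \<open>The vector representing the functional \<open>representer \<phi> \<mapsto> Re (T \<phi>)\<close> is \<open>T\<close> itself.\<close>

lemma limit_of_representers:
  assumes T_tempered: "tempered T"
    and "\<And>\<phi>. schwartz \<phi> \<Longrightarrow> Re (T \<phi>) \<le> M * N (representer \<phi>)"
  obtains \<phi> where "T \<in> V" "\<And>n::nat. schwartz (\<phi> n)" "(\<lambda>n. N (representer (\<phi> n) - T)) \<longlonglongrightarrow> 0"
proof -
  interpret graph: bounded_functional_graph "\<lambda>c T \<phi>. c * T \<phi>" V N "representer_graph T" M
    by (rule bounded_functional_graph_representer[OF assms])
  obtain S u where S_in_V: "S \<in> V" and u_in_graph: "\<And>n::nat. u n \<in> fst ` representer_graph T"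
    and lim: "(\<lambda>n. N (u n - S)) \<longlonglongrightarrow> 0"
    and represents: "\<And>P a. (P, a) \<in> representer_graph T \<Longrightarrow> re_inner S P = a"
    using graph.riesz_representation by blast
  have "S = T"
    using represents[OF representer_graphI] re_inner_representer[OF _ S_in_V]
    by (intro tempered_eqI_Re V_tempered S_in_V T_tempered) simp
  moreover have "\<exists>\<phi>. schwartz \<phi> \<and> u n = representer \<phi>" for n
    using u_in_graph[of n] by (auto simp: representer_graph_def)
  then obtain \<phi> where "\<And>n. schwartz (\<phi> n)" "\<And>n. u n = representer (\<phi> n)" by metis
  ultimately show ?thesis using S_in_V lim by (intro that[of \<phi>]) auto
qed

end

section \<open>The invariant form\<close>

locale time_frequency_invariant = hilbert_distributions +
  assumes dtranslate_V: "T \<in> V \<Longrightarrow> dtranslate x T \<in> V"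
    and N_dtranslate: "T \<in> V \<Longrightarrow> N (dtranslate x T) = N T"
    and dmodulate_V: "T \<in> V \<Longrightarrow> dmodulate \<xi> T \<in> V"
    and N_dmodulate: "T \<in> V \<Longrightarrow> N (dmodulate \<xi> T) = N T"
begin

lemma dtranslate_representer:
  assumes \<phi>_schwartz: "schwartz \<phi>"
  shows "dtranslate x (representer \<phi>) = representer (\<lambda>y. \<phi> (y - x))"
proof (rule isometry_representer[OF \<phi>_schwartz _ dtranslate_V N_dtranslate])
  show "schwartz (\<lambda>y. \<phi> (y - x))" using schwartz_translate[OF \<phi>_schwartz, of "- x"] by simp
  show "dtranslate (- x) T \<in> V" if "T \<in> V" for T by (rule dtranslate_V[OF that])
qed (auto simp: dtranslate_def fun_eq_iff)

lemma dmodulate_representer: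
  assumes \<phi>_schwartz: "schwartz \<phi>"
  shows "dmodulate z (representer \<phi>) = representer (\<lambda>y. iexp (y \<bullet> (- z)) * \<phi> y)"
proof (rule isometry_representer[OF \<phi>_schwartz schwartz_modulate[OF \<phi>_schwartz] dmodulate_V
  N_dmodulate])
  show "dmodulate (- z) T \<in> V" if "T \<in> V" for T by (rule dmodulate_V[OF that])
  show "dmodulate z (dmodulate (- z) T) = T" for T
    by (simp add: dmodulate_def mult.assoc[symmetric] exp_add[symmetric])
qed (auto simp: dmodulate_def fun_eq_iff)

lemma representer_translate_invariant:
  "schwartz \<phi> \<Longrightarrow> representer (\<lambda>y. \<phi> (y - x)) (\<lambda>y. \<psi> (y - x)) = representer \<phi> \<psi>"
  unfolding dtranslate_representer[symmetric] by (simp add: dtranslate_def)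

lemma representer_modulate_adjoint:
  assumes \<phi>_schwartz: "schwartz \<phi>" and \<psi>_schwartz: "schwartz \<psi>"
  shows "representer \<psi> (\<lambda>y. iexp (y \<bullet> z) * \<phi> y) = cnj (representer \<phi> (\<lambda>y. iexp (y \<bullet> (- z)) * \<psi> y))"
proof -
  have "representer \<psi> (\<lambda>y. iexp (y \<bullet> z) * \<phi> y) = dmodulate z (representer \<psi>) \<phi>"
    by (simp add: dmodulate_def)
  then show ?thesis
    unfolding dmodulate_representer[OF \<psi>_schwartz]
      representer_hermitian[OF schwartz_modulate[OF \<psi>_schwartz] \<phi>_schwartz] .
qed

text \<open>A Gaussian is a superposition of characters, so it may be moved from one argument of the form
  to the other just as characters can.\<close>

lemma representer_gauss_mult:
  fixes b :: 'a
  assumes s_pos: "s > 0" and \<phi>_schwartz: "schwartz \<phi>" and \<psi>_schwartz: "schwartz \<psi>"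
  shows "representer \<psi> (\<lambda>y. gauss s b y * \<phi> y) = representer (\<lambda>y. gauss s b y * \<psi> y) \<phi>"
proof -
  obtain w where w_rapid: "rapidly_integrable w"
    and superposition: "\<And>x. gauss s b x = (\<integral>z. w z * iexp (x \<bullet> z) \<partial>lborel)"
    and w_minus: "\<And>z. w (- z) = cnj (w z)"
    using gauss_superposition[OF s_pos] by metis
  have expand: "representer \<theta> (\<lambda>y. gauss s b y * \<eta> y)
      = (\<integral>z. w z * representer \<theta> (\<lambda>y. iexp (y \<bullet> z) * \<eta> y) \<partial>lborel)"
    if \<theta>_schwartz: "schwartz \<theta>" and \<eta>_schwartz: "schwartz \<eta>" for \<theta> \<eta>
    using tempered_integral_exchange[OF representer_tempered[OF \<theta>_schwartz] w_rapid
      schwartz_family_modulate[OF \<eta>_schwartz]]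
    unfolding superposition by (simp add: mult.assoc[symmetric])
  let ?g = "\<lambda>z. cnj (w z * representer \<phi> (\<lambda>y. iexp (y \<bullet> z) * \<psi> y))"
  have "(\<lambda>z. w z * representer \<phi> (\<lambda>y. iexp (y \<bullet> z) * \<psi> y)) \<in> borel_measurable borel"
    by (rule borel_measurable_times[OF rapidly_integrable_measurable[OF w_rapid]
          tempered_family_measurable[OF representer_tempered[OF \<phi>_schwartz]
            schwartz_family_modulate[OF \<psi>_schwartz]]])
  then have g_measurable: "?g \<in> borel_measurable borel"
    by (rule borel_measurable_continuous_on[of cnj, rotated]) (intro continuous_intros)
  have "representer \<psi> (\<lambda>y. gauss s b y * \<phi> y) = (\<integral>z. ?g (0 - z) \<partial>lborel)"
    unfolding expand[OF \<psi>_schwartz \<phi>_schwartz]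
      representer_modulate_adjoint[OF \<phi>_schwartz \<psi>_schwartz]
    by (intro Bochner_Integration.integral_cong refl) (simp add: w_minus)
  also have "\<dots> = (\<integral>z. ?g z \<partial>lborel)" by (rule lborel_integral_reflect[OF g_measurable])
  also have "\<dots> = cnj (\<integral>z. w z * representer \<phi> (\<lambda>y. iexp (y \<bullet> z) * \<psi> y) \<partial>lborel)"
    by (rule Bochner_Integration.integral_cnj)
  also have "\<dots> = representer (\<lambda>y. gauss s b y * \<psi> y) \<phi>"
    unfolding expand[OF \<phi>_schwartz \<psi>_schwartz, symmetric]
    by (rule representer_hermitian[OF schwartz_gauss_mult[OF s_pos \<psi>_schwartz] \<phi>_schwartz,
      symmetric])
  finally show ?thesis .
qed

lemma representer_gauss_transfer:
  assumes t_pos: "t > 0" and m_less: "0 < m" "m < s"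
  shows "representer (gauss t c) (gauss s b)
      = representer (gauss (s + t - m) (b + c)) (gauss m (0::'a))"
proof -
  have "representer (gauss t c) (gauss s b)
      = representer (gauss t c) (\<lambda>y. gauss (s - m) b y * gauss m 0 y)"
    unfolding gauss_mult by simp
  also have "\<dots> = representer (\<lambda>y. gauss (s - m) b y * gauss t c y) (gauss m 0)"
    using m_less t_pos by (intro representer_gauss_mult schwartz_gauss) auto
  also have "(\<lambda>y. gauss (s - m) b y * gauss t c y) = gauss (s + t - m) (b + c)"
    by (simp add: gauss_mult fun_eq_iff algebra_simps)
  finally show ?thesis .
qed

lemma representer_gauss_eq_if_same_product:
  fixes b :: 'a
  assumes pos: "s > 0" "t > 0" "s' > 0" "t' > 0"
    and same_product: "s + t = s' + t'" "b + c = b' + c'"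
  shows "representer (gauss t c) (gauss s b) = representer (gauss t' c') (gauss s' b')"
proof -
  define m where "m = min s s' / 2"
  have m_less: "0 < m" "m < s" "m < s'" using pos by (auto simp: m_def min_def)
  show ?thesis
    using representer_gauss_transfer[OF pos(2) m_less(1,2), of c b]
      representer_gauss_transfer[OF pos(4) m_less(1,3), of c' b'] same_product by simp
qed

definition diagonal :: "real \<Rightarrow> complex" where
  "diagonal r = representer (gauss (r / 2) (0::'a)) (gauss (r / 2) 0)"

lemma diagonal_eq_translated:
  fixes x :: 'a
  assumes r_pos: "r > 0"
  shows "diagonal r = of_real (exp (- r * (x \<bullet> x)))
      * representer (gauss (r / 2) (r *\<^sub>R x)) (gauss (r / 2) (r *\<^sub>R x))"
proof -
  have gauss_schwartz: "schwartz (gauss (r / 2) b)" for b :: 'a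
    using r_pos by (intro schwartz_gauss) simp
  let ?a = "complex_of_real (exp (- (r / 2) * (x \<bullet> x)))"
  have translated: "(\<lambda>y. gauss (r / 2) 0 (y - x)) = (\<lambda>y. ?a * gauss (r / 2) (r *\<^sub>R x) y)"
    unfolding gauss_translate by simp
  have "diagonal r = representer (\<lambda>y. gauss (r / 2) 0 (y - x)) (\<lambda>y. gauss (r / 2) 0 (y - x))"
    unfolding diagonal_def by (rule representer_translate_invariant[OF gauss_schwartz, symmetric])
  also have "\<dots> = (?a * ?a) * representer (gauss (r / 2) (r *\<^sub>R x)) (gauss (r / 2) (r *\<^sub>R x))"
    unfolding translated
      tempered_cmult[OF representer_tempered[OF schwartz_cmult[OF gauss_schwartz]] gauss_schwartz]
      representer_cmult[OF gauss_schwartz gauss_schwartz]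
    by simp
  also have "?a * ?a = of_real (exp (- r * (x \<bullet> x)))"
    unfolding of_real_mult[symmetric] exp_add[symmetric] by (simp add: field_simps)
  finally show ?thesis .
qed

lemma representer_gauss_gauss:
  fixes b c :: 'a
  assumes s_pos: "s > 0" and t_pos: "t > 0"
  shows "representer (gauss t c) (gauss s b)
      = of_real (exp (((b + c) \<bullet> (b + c)) / (4 * (s + t)))) * diagonal (s + t)"
proof -
  define r where "r = s + t"
  have r_pos: "r > 0" using s_pos t_pos by (simp add: r_def)
  define x where "x = (1 / (2 * r)) *\<^sub>R (b + c)"
  have "r *\<^sub>R x + r *\<^sub>R x = b + c" using r_pos by (simp add: x_def scaleR_add_left[symmetric])
  then have "representer (gauss t c) (gauss s b)
      = representer (gauss (r / 2) (r *\<^sub>R x)) (gauss (r / 2) (r *\<^sub>R x))"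
    using r_pos s_pos t_pos by (intro representer_gauss_eq_if_same_product) (simp_all add: r_def)
  moreover have "r * (x \<bullet> x) = ((b + c) \<bullet> (b + c)) / (4 * r)"
    using r_pos by (simp add: x_def power2_eq_square divide_simps)
  ultimately show ?thesis
    unfolding r_def[symmetric] using diagonal_eq_translated[OF r_pos, of x] by (simp add: exp_minus)
qed

lemma representer_gauss_translated_gauss:
  fixes x :: 'a
  assumes s_pos: "s > 0" and w_pos: "w > 0"
  shows "representer (gauss w 0) (\<lambda>y. gauss s 0 (y - x))
      = diagonal (s + w) * gauss (s * w / (s + w)) 0 x"
proof -
  have gauss_schwartz: "schwartz (gauss s b)" "schwartz (gauss w b)" for b :: 'a
    using s_pos w_pos by (auto intro: schwartz_gauss)
  let ?X = "x \<bullet> x"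
  have square: "((2 * s) *\<^sub>R x + 0) \<bullet> ((2 * s) *\<^sub>R x + 0) / (4 * (s + w)) = s\<^sup>2 / (s + w) * ?X"
    using s_pos w_pos by (simp add: power2_eq_square divide_simps)
  have "representer (gauss w 0) (\<lambda>y. gauss s 0 (y - x))
      = of_real (exp (- s * ?X)) * representer (gauss w 0) (gauss s ((2 * s) *\<^sub>R x))"
    unfolding gauss_translate
      tempered_cmult[OF representer_tempered[OF gauss_schwartz(2)] gauss_schwartz(1)]
    by simp
  also have "\<dots> = diagonal (s + w) * of_real (exp (- s * ?X) * exp (s\<^sup>2 / (s + w) * ?X))"
    unfolding representer_gauss_gauss[OF s_pos w_pos] square by simp
  also have "exp (- s * ?X) * exp (s\<^sup>2 / (s + w) * ?X) = exp (- (s * w / (s + w)) * ?X)"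
  proof -
    have "- s + s\<^sup>2 / (s + w) = - (s * w / (s + w))"
      using s_pos w_pos by (simp add: field_simps power2_eq_square)
    then have "- s * ?X + s\<^sup>2 / (s + w) * ?X = - (s * w / (s + w)) * ?X" by (metis distrib_right)
    then show ?thesis unfolding exp_add[symmetric] by simp
  qed
  finally show ?thesis unfolding gauss_0_eq .
qed

lemma representer_gauss_convolution:
  assumes s_pos: "s > 0" and t_pos: "t > 0" and w_pos: "w > 0"
  shows "representer (gauss w 0) (\<lambda>y. \<integral>x. gauss t 0 x * gauss s 0 (y - x) \<partial>lborel)
    = diagonal (s + w) * of_real (sqrt (pi / (t + s * w / (s + w))) ^ DIM('a))"
proof -
  have gauss_schwartz: "schwartz (gauss s b)" "schwartz (gauss t b)" "schwartz (gauss w b)"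
    for b :: 'a
    using assms by (auto intro: schwartz_gauss)
  have product: "gauss t 0 x * (d * gauss r 0 x) = d * gauss (t + r) 0 x" for d r and x :: 'a
    using gauss_mult[of t 0 x r 0] by (simp add: mult.left_commute)
  have "representer (gauss w 0) (\<lambda>y. \<integral>x. gauss t 0 x * gauss s 0 (y - x) \<partial>lborel)
      = (\<integral>x. gauss t 0 x * representer (gauss w 0) (\<lambda>y. gauss s 0 (y - x)) \<partial>lborel)"
    by (rule tempered_integral_exchange[OF representer_tempered[OF gauss_schwartz(3)]
      schwartz_rapidly_integrable[OF gauss_schwartz(2)]
      schwartz_family_translate[OF gauss_schwartz(1)]])
  also have "\<dots> = (\<integral>x. diagonal (s + w) * gauss (t + s * w / (s + w)) (0::'a) x \<partial>lborel)"
    unfolding representer_gauss_translated_gauss[OF s_pos w_pos] product ..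
  also have "\<dots> = diagonal (s + w) * of_real (sqrt (pi / (t + s * w / (s + w))) ^ DIM('a))"
    using s_pos t_pos w_pos by (simp add: gauss_integral_0 add_pos_pos)
  finally show ?thesis .
qed

text \<open>The convolution of two Gaussians is symmetric in their widths, so it can be paired with a
  third Gaussian in two ways.\<close>

lemma diagonal_width_eq:
  assumes s_pos: "s > 0" and t_pos: "t > 0" and w_pos: "w > 0"
  shows "diagonal (s + w) * of_real (sqrt (s + w) ^ DIM('a))
      = diagonal (t + w) * of_real (sqrt (t + w) ^ DIM('a))"
proof -
  define q where "q = s * t + s * w + t * w"
  have q_pos: "q > 0" using assms by (simp add: q_def add_pos_pos)
  have width: "t + s * w / (s + w) = q / (s + w)" "s + t * w / (t + w) = q / (t + w)"
    using assms by (simp_all add: q_def field_simps)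
  have mass: "sqrt (pi / (q / r)) ^ DIM('a) = sqrt (pi / q) ^ DIM('a) * sqrt r ^ DIM('a)" for r
    unfolding power_mult_distrib[symmetric] real_sqrt_mult[symmetric] by simp
  have "(\<lambda>y. \<integral>x. gauss t 0 x * gauss s 0 (y - x) \<partial>lborel)
      = (\<lambda>y. \<integral>x. gauss s 0 x * gauss t 0 (y - x) \<partial>(lborel :: 'a measure))"
  proof
    fix y :: 'a
    have "(\<lambda>x. gauss s 0 x * gauss t 0 (y - x)) \<in> borel_measurable borel" by measurable
    from lborel_integral_reflect[OF this, of y]
    show "(\<integral>x. gauss t 0 x * gauss s 0 (y - x) \<partial>lborel)
        = (\<integral>x. gauss s 0 x * gauss t 0 (y - x) \<partial>lborel)"
      by (simp add: mult.commute)
  qed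
  then have "diagonal (s + w) * of_real (sqrt (pi / (q / (s + w))) ^ DIM('a))
      = diagonal (t + w) * of_real (sqrt (pi / (q / (t + w))) ^ DIM('a))"
    using representer_gauss_convolution[OF s_pos t_pos w_pos]
      representer_gauss_convolution[OF t_pos s_pos w_pos]
    unfolding width
    by metis
  then show ?thesis using q_pos unfolding mass by (simp add: mult.left_commute)
qed

definition form_const :: real where
  "form_const = (N (representer (gauss (1 / 2) 0)))\<^sup>2 / sqrt pi ^ DIM('a)"

lemma form_const_nonneg: "0 \<le> form_const"
  by (simp add: form_const_def)

lemma diagonal_eq:
  assumes r_pos: "r > 0"
  shows "diagonal r = of_real (form_const * sqrt (pi / r) ^ DIM('a))"
proof -
  define w where "w = min r 1 / 2"
  have w_less: "0 < w" "w < r" "w < 1" using r_pos by (auto simp: w_def min_def)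
  have "diagonal r * of_real (sqrt r ^ DIM('a)) = diagonal 1"
    using diagonal_width_eq[of "r - w" "1 - w" w] w_less by simp
  also have "\<dots> = of_real ((N (representer (gauss (1 / 2) 0)))\<^sup>2)"
    unfolding diagonal_def by (rule representer_self) (intro schwartz_gauss, simp)
  also have "(N (representer (gauss (1 / 2) 0)))\<^sup>2
      = form_const * sqrt (pi / r) ^ DIM('a) * sqrt r ^ DIM('a)"
    using r_pos by (simp add: form_const_def real_sqrt_divide power_divide)
  finally show ?thesis using r_pos by simp
qed

definition density :: "('a \<Rightarrow> complex) \<Rightarrow> 'a \<Rightarrow> complex" where
  "density \<phi> x = of_real form_const * cnj (\<phi> x)"

lemma square_integrable_density: "schwartz \<phi> \<Longrightarrow> square_integrable (density \<phi>)"
  unfolding density_def[abs_def]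
  by (intro square_integrable_cmult square_integrable_cnj schwartz_square_integrable)

lemma L2_norm_fun_density: "L2_norm_fun (density \<phi>) = form_const * L2_norm_fun \<phi>"
  unfolding density_def[abs_def] L2_norm_fun_cmult L2_norm_fun_cnj by (simp add: form_const_nonneg)

lemma density_diff: "density (\<lambda>x. \<phi> x - \<psi> x) = (\<lambda>x. density \<phi> x - density \<psi> x)"
  by (simp add: density_def fun_eq_iff right_diff_distrib)

lemma dist_of_density_hermitian:
  assumes "schwartz \<phi>" "schwartz \<psi>"
  shows "dist_of (density \<phi>) \<psi> = cnj (dist_of (density \<psi>) \<phi>)"
  unfolding dist_of_apply[OF assms(1)] dist_of_apply[OF assms(2)]
    Bochner_Integration.integral_cnj[symmetric]
  by (intro Bochner_Integration.integral_cong refl) (simp add: density_def)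

lemma representer_gauss:
  fixes c :: 'a
  assumes t_pos: "t > 0"
  shows "representer (gauss t c) = dist_of (density (gauss t c))"
proof (rule tempered_eq_of_gauss)
  have gauss_schwartz: "schwartz (gauss t c)" using t_pos by (rule schwartz_gauss)
  show "tempered (representer (gauss t c))" by (rule representer_tempered[OF gauss_schwartz])
  show "tempered (dist_of (density (gauss t c)))"
    by (intro dist_of_tempered square_integrable_density gauss_schwartz)
  fix s :: real and b :: 'a assume s_pos: "s > 0"
  have "dist_of (density (gauss t c)) (gauss s b)
      = (\<integral>x. of_real form_const * gauss (s + t) (b + c) x \<partial>lebesgue)"
    unfolding dist_of_apply[OF schwartz_gauss[OF s_pos]] gauss_mult[symmetric]
    by (simp add: density_def gauss_def mult_ac)
  also have "\<dots> = (\<integral>x. of_real form_const * gauss (s + t) (b + c) x \<partial>lborel)"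
    by (rule integral_completion) measurable
  also have "\<dots> = representer (gauss t c) (gauss s b)"
    using s_pos t_pos by (simp add: gauss_integral representer_gauss_gauss diagonal_eq)
  finally show "representer (gauss t c) (gauss s b) = dist_of (density (gauss t c)) (gauss s b)"
    by simp
qed

lemma representer_eq_dist_of:
  assumes \<phi>_schwartz: "schwartz \<phi>"
  shows "representer \<phi> = dist_of (density \<phi>)"
proof (rule tempered_eq_of_gauss)
  show "tempered (representer \<phi>)" by (rule representer_tempered[OF \<phi>_schwartz])
  show "tempered (dist_of (density \<phi>))"
    by (intro dist_of_tempered square_integrable_density \<phi>_schwartz)
  show "representer \<phi> (gauss s b) = dist_of (density \<phi>) (gauss s b)" if s_pos: "s > 0" for s b
    using representer_hermitian[OF \<phi>_schwartz schwartz_gauss[OF s_pos]]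
      dist_of_density_hermitian[OF \<phi>_schwartz schwartz_gauss[OF s_pos]]
    by (simp add: representer_gauss[OF s_pos])
qed

lemma N_representer:
  assumes \<phi>_schwartz: "schwartz \<phi>"
  shows "N (representer \<phi>) = sqrt form_const * L2_norm_fun \<phi>"
proof -
  have "complex_of_real ((N (representer \<phi>))\<^sup>2) = (\<integral>x. density \<phi> x * \<phi> x \<partial>lebesgue)"
    unfolding representer_self[OF \<phi>_schwartz, symmetric]
    by (subst representer_eq_dist_of[OF \<phi>_schwartz]) (rule dist_of_apply[OF \<phi>_schwartz])
  also have "\<dots> = (\<integral>x. of_real (form_const * (cmod (\<phi> x))\<^sup>2) \<partial>lebesgue)"
    by (intro Bochner_Integration.integral_cong refl)
      (simp add: density_def complex_norm_square mult_ac del: of_real_power)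
  also have "\<dots> = of_real (form_const * (L2_norm_fun \<phi>)\<^sup>2)"
    unfolding integral_complex_of_real L2_norm_fun_squared by simp
  finally have "(N (representer \<phi>))\<^sup>2 = (sqrt form_const * L2_norm_fun \<phi>)\<^sup>2"
    by (simp only: of_real_eq_iff power_mult_distrib real_sqrt_pow2[OF form_const_nonneg])
  then show ?thesis
    by (simp add: power2_eq_iff_nonneg N_nonneg representer_V \<phi>_schwartz form_const_nonneg
      L2_norm_fun_nonneg)
qed

lemma form_const_pos:
  assumes "V \<noteq> {0}" shows "form_const > 0"
proof (rule ccontr)
  assume "\<not> form_const > 0"
  then have "form_const = 0" using form_const_nonneg by simp
  have "T = 0" if T_in_V: "T \<in> V" for T
  proof (rule tempered_eqI_Re[OF V_tempered[OF T_in_V] V_tempered[OF zero_V]])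
    fix \<phi> :: "'a \<Rightarrow> complex" assume \<phi>_schwartz: "schwartz \<phi>"
    have "representer \<phi> = 0"
      using N_eq_0[OF representer_V[OF \<phi>_schwartz]] N_representer[OF \<phi>_schwartz] \<open>form_const = 0\<close>
      by simp
    then show "Re (T \<phi>) = Re (0 \<phi>)"
      using re_inner_representer[OF \<phi>_schwartz T_in_V] re_inner_commute[OF T_in_V zero_V]
        re_inner_zero_left[OF T_in_V]
      by simp
  qed
  then show False using assms zero_V by blast
qed

lemma L2_norm_fun_density_eq_N:
  assumes "schwartz \<phi>"
  shows "L2_norm_fun (density \<phi>) = sqrt form_const * N (representer \<phi>)"
  unfolding L2_norm_fun_density N_representer[OF assms] by (simp add: form_const_nonneg)

lemma L2_Cauchy_density:
  assumes pos: "form_const > 0" and \<phi>_schwartz: "\<And>n. schwartz (\<phi> n)" and T_in_V: "T \<in> V"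
    and lim: "(\<lambda>n. N (representer (\<phi> n) - T)) \<longlonglongrightarrow> 0"
  shows "L2_Cauchy (\<lambda>n. density (\<phi> n))"
  unfolding L2_Cauchy_def
proof (intro allI impI)
  fix e :: real assume "e > 0"
  then have "e / sqrt form_const > 0" using pos by simp
  then obtain M where "\<forall>m\<ge>M. \<forall>n\<ge>M. N (representer (\<phi> m) - representer (\<phi> n)) < e / sqrt form_const"
    using N_Cauchy_of_tendsto[OF representer_V[OF \<phi>_schwartz] T_in_V lim] by blast
  moreover have "L2_norm_fun (\<lambda>x. density (\<phi> m) x - density (\<phi> n) x)
      = sqrt form_const * N (representer (\<phi> m) - representer (\<phi> n))" for m n
    using L2_norm_fun_density_eq_N[OF schwartz_diff[OF \<phi>_schwartz \<phi>_schwartz]]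
    by (simp only: density_diff representer_diff \<phi>_schwartz)
  ultimately show "\<exists>M. \<forall>m\<ge>M. \<forall>n\<ge>M. L2_norm_fun (\<lambda>x. density (\<phi> m) x - density (\<phi> n) x) < e"
    using pos by (intro exI[of _ M]) (simp add: field_simps)
qed

lemma V_imp_dist_of:
  assumes pos: "form_const > 0" and T_in_V: "T \<in> V"
  obtains f where "square_integrable f" "T = dist_of f" "N T = L2_norm_fun f / sqrt form_const"
proof -
  have bound: "Re (T \<psi>) \<le> N T * N (representer \<psi>)" if "schwartz \<psi>" for \<psi>
    using re_inner_bound[OF T_in_V representer_V[OF that]] re_inner_representer[OF that T_in_V]
    by simp
  obtain \<phi> where \<phi>_schwartz: "\<And>n::nat. schwartz (\<phi> n)"
    and lim: "(\<lambda>n. N (representer (\<phi> n) - T)) \<longlonglongrightarrow> 0"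
    using limit_of_representers[OF V_tempered[OF T_in_V] bound] by metis
  note representers_in_V = representer_V[OF \<phi>_schwartz]
    and density_L2 = square_integrable_density[OF \<phi>_schwartz]
  obtain g where g_L2: "square_integrable g"
    and g_lim: "(\<lambda>n. L2_norm_fun (\<lambda>x. density (\<phi> n) x - g x)) \<longlonglongrightarrow> 0"
    using L2_complete[OF density_L2 L2_Cauchy_density[OF pos \<phi>_schwartz T_in_V lim]] by blast
  have "T = dist_of g"
  proof (rule tempered_eqI[OF V_tempered[OF T_in_V] dist_of_tempered[OF g_L2]])
    fix \<psi> :: "'a \<Rightarrow> complex" assume \<psi>_schwartz: "schwartz \<psi>"
    show "T \<psi> = dist_of g \<psi>"
      using evaluation_tendsto[OF representers_in_V T_in_V lim \<psi>_schwartz]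
        dist_of_tendsto[OF density_L2 g_L2 g_lim \<psi>_schwartz] LIMSEQ_unique
      unfolding representer_eq_dist_of[OF \<phi>_schwartz] by blast
  qed
  moreover have "L2_norm_fun g = sqrt form_const * N T"
  proof (rule LIMSEQ_unique)
    show "(\<lambda>n. L2_norm_fun (density (\<phi> n))) \<longlonglongrightarrow> L2_norm_fun g"
      by (rule L2_norm_fun_tendsto[OF density_L2 g_L2 g_lim])
    show "(\<lambda>n. L2_norm_fun (density (\<phi> n))) \<longlonglongrightarrow> sqrt form_const * N T"
      unfolding L2_norm_fun_density_eq_N[OF \<phi>_schwartz]
      by (intro tendsto_mult tendsto_const N_tendsto[OF representers_in_V T_in_V lim])
  qed
  ultimately show ?thesis using g_L2 pos by (intro that[of g]) auto
qed

lemma dist_of_in_V: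
  assumes pos: "form_const > 0" and f_L2: "square_integrable f"
  shows "dist_of f \<in> V"
proof -
  have "Re (dist_of f \<phi>) \<le> L2_norm_fun f / sqrt form_const * N (representer \<phi>)"
    if \<phi>_schwartz: "schwartz \<phi>" for \<phi>
    using order_trans[OF complex_Re_le_cmod dist_of_bound[OF f_L2 \<phi>_schwartz]] pos
    unfolding N_representer[OF \<phi>_schwartz]
    by simp
  then show ?thesis using limit_of_representers[OF dist_of_tempered[OF f_L2]] by metis
qed

lemma N_dist_of:
  assumes pos: "form_const > 0" and f_L2: "square_integrable f"
  shows "N (dist_of f) = L2_norm_fun f / sqrt form_const"
proof -
  obtain g where "square_integrable g" "dist_of f = dist_of g"
    "N (dist_of f) = L2_norm_fun g / sqrt form_const"
    using V_imp_dist_of[OF pos dist_of_in_V[OF pos f_L2]] by metis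
  then show ?thesis using dist_of_eq_imp_L2_norm_fun_eq[OF f_L2] by simp
qed

end

theorem theorem1p2:
  fixes V :: "(('a::euclidean_space \<Rightarrow> complex) \<Rightarrow> complex) set"
    and N :: "(('a \<Rightarrow> complex) \<Rightarrow> complex) \<Rightarrow> real"
  assumes "hilbert_in_S' V N"
    and "\<forall>T\<in>V. \<forall>x. dtranslate x T \<in> V \<and> N (dtranslate x T) = N T"
    and "\<forall>T\<in>V. \<forall>\<xi>. dmodulate \<xi> T \<in> V \<and> N (dmodulate \<xi> T) = N T"
    and "V \<noteq> {\<lambda>\<phi>. 0}"
  shows "V = dist_of ` {f. square_integrable f} \<and>
         (\<exists>C>0. \<forall>f. square_integrable f \<longrightarrow> N (dist_of f) = C * L2_norm_fun f)"
proof -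
  interpret time_frequency_invariant V N
    by unfold_locales (use assms in auto)
  have pos: "form_const > 0" using form_const_pos assms(4) by (simp add: zero_fun_def)
  have "V = dist_of ` {f. square_integrable f}"
    using V_imp_dist_of[OF pos] dist_of_in_V[OF pos] by blast
  moreover have "N (dist_of f) = (1 / sqrt form_const) * L2_norm_fun f" if "square_integrable f"
    for f
    using N_dist_of[OF pos that] by simp
  ultimately show ?thesis using pos by (intro conjI exI[of _ "1 / sqrt form_const"]) auto
qed

end
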